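(* Let $K$ be a real quadratic field, and let $S$, $K_S$, $\mathcal{O}_K$ be as in the context. Let $\phi=(\phi_\sigma)_{\sigma\in S}:[0,1]\to K_S$ be a continuously differentiable map such that $\phi'_\sigma(x)\neq0$ for all but finitely many $x\in[0,1]$ and every $\sigma\in S$. For $x\in[0,1]$ define $$\Phi(x):=\left(\begin{pmatrix}1&\phi_\sigma(x)\\0&1\end{pmatrix}\right)_{\sigma\in S}\in \mathrm{SL}_2(K_S).$$ Let $\mathbf{r}=(r_\sigma)_{\sigma\in S}\in\mathbb{R}^2$ be a real vector with $r_\sigma\ge0$ for $\sigma\in S$ and $\sum_{\sigma\in S}r_\sigma=1$. For $t\ge0$ let $$g(\mathbf{r})_t:=\left(\begin{pmatrix}e^{-r_\sigma t}&0\\0&e^{r_\sigma t}\end{pmatrix}\right)_{\sigma\in S}$$ act on $\mathrm{SL}_2(\mathcal{O}_K)\backslash \mathrm{SL}_2(K_S)$ by right multiplication. Let $g\in \mathrm{SL}_2(K_S)$ and $\Lambda=\mathrm{SL}_2(\mathcal{O}_K)g\in \mathrm{SL}_2(\mathcal{O}_K)\backslash \mathrm{SL}_2(K_S)$. Then the set $$\{x\in[0,1] : \Lambda\Phi(x)\text{ has bounded trajectory under the flow } g(\mathbf{r})_t\}$$ is winning in the sense of Schmidt (as a subset of $[0,1]$), and hence has Hausdorff dimension $1$.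
   Context: Number field notation. $K$ is a real quadratic extension of $\mathbb{Q}$, $\mathcal{O}_K$ is its ring of integers, $S$ is the set of its two real embeddings $\sigma:K\to\mathbb{R}$, and $K_S:=\mathbb{R}^2$ with coordinates indexed by $S$. $\tau:K\to K_S$, $\tau(x)=(\sigma(x))_{\sigma\in S}$, is extended entrywise to vectors and matrices. $\mathrm{SL}_2(K_S)=\prod_{\sigma\in S}\mathrm{SL}_2(\mathbb{R})$, and $\mathrm{SL}_2(\mathcal{O}_K)$ is regarded as a subgroup of it via $\tau$. Bounded trajectory. A point $y\in \mathrm{SL}_2(\mathcal{O}_K)\backslash \mathrm{SL}_2(K_S)$ has bounded trajectory under $g(\mathbf{r})_t$ if $\{y\, g(\mathbf{r})_t : t\ge 0\}$ is relatively compact in $\mathrm{SL}_2(\mathcal{O}_K)\backslash \mathrm{SL}_2(K_S)$. Schmidt's game. Let $X$ be a complete metric space (here $X=[0,1]$ with the usual metric), $W\subseteq X$, and $0<\alpha,\beta<1$. Balls are closed balls $B(x,\rho)$ with specified center and radius. Player A first chooses an arbitrary ball $A_0=B(x_0,\rho)$; Player B chooses a ball $B_0=B(y_0,\alpha\rho)\subset A_0$. In general, at step $n$ Player A chooses a ball $A_n=B(x_n,(\alpha\beta)^n\rho)\subset B_{n-1}$ and then Player B chooses a ball $B_n=B(y_n,\alpha(\alpha\beta)^n\rho)\subset A_n$. The intersection $\bigcap_n A_n$ is a single point $x_\infty$; Player B wins if $x_\infty\in W$. $W$ is $(\alpha,\beta)$-winning if Player B has a winning strategy, $\alpha$-winning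 if it is $(\alpha,\beta)$-winning for all $0<\beta<1$, and winning (in the sense of Schmidt) if it is $\alpha$-winning for some $\alpha>0$. *)

theory Defs
  imports "HOL-Analysis.Analysis" "HOL-Algebra.Coset"
begin

section \<open>Real quadratic fields\<close>

definition field_embedding :: "('a::field \<Rightarrow> 'b::field) \<Rightarrow> bool" where
  "field_embedding \<sigma> \<longleftrightarrow> \<sigma> 1 = 1 \<and>
     (\<forall>x y. \<sigma> (x + y) = \<sigma> x + \<sigma> y) \<and> (\<forall>x y. \<sigma> (x * y) = \<sigma> x * \<sigma> y)"

definition real_embeddings :: "('k::field \<Rightarrow> real) set" where
  "real_embeddings = {\<sigma>. field_embedding \<sigma>}"

text \<open>
  A quadratic extension of \<open>\<rat>\<close> of signature \<open>(2, 0)\<close>. Since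
  \<^const>\<open>vector_space.dim\<close> is 0 in infinite dimension, the value 2 entails finite dimension.
\<close>

definition real_quadratic_field :: "'k::field_char_0 itself \<Rightarrow> bool" where
  "real_quadratic_field _ \<longleftrightarrow>
     vector_space.dim (\<lambda>(q::rat) (x::'k). of_rat q * x) UNIV = 2 \<and>
     card (real_embeddings :: ('k \<Rightarrow> real) set) = 2"

text \<open>
  The set \<open>S\<close> is represented by a finite index type \<open>'s\<close> together with a bijection
  \<open>\<sigma> :: 's \<Rightarrow> 'k \<Rightarrow> real\<close> from it onto \<^const>\<open>real_embeddings\<close>. In this way \<open>K\<^sub>S\<close> is \<open>real ^ 's\<close>.
\<close>

lemma CARD_real_embeddings:
  fixes \<sigma> :: "'s::finite \<Rightarrow> 'k::field_char_0 \<Rightarrow> real"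
  assumes "real_quadratic_field TYPE('k)" and "bij_betw \<sigma> UNIV real_embeddings"
  shows "CARD('s) = 2"
  using assms bij_betw_same_card by (fastforce simp: real_quadratic_field_def)


section \<open>The space \<open>SL\<^sub>2(O\<^sub>K) \ SL\<^sub>2(K\<^sub>S)\<close>\<close>

type_synonym 's matrix_KS = "real ^ 2 ^ 2 ^ 's"

definition SL2_KS :: "'s::finite matrix_KS monoid" where
  "SL2_KS = \<lparr>carrier = {g. \<forall>s. det (g $ s) = 1},
             mult = (\<lambda>g h. \<chi> s. g $ s ** h $ s),
             one = (\<chi> s. mat 1)\<rparr>"

definition tau_matrix :: "('s::finite \<Rightarrow> 'k::field_char_0 \<Rightarrow> real) \<Rightarrow> 'k ^ 2 ^ 2 \<Rightarrow> 's matrix_KS" where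
  "tau_matrix \<sigma> A = (\<chi> s i j. \<sigma> s (A $ i $ j))"

definition SL2_OK :: "('s::finite \<Rightarrow> 'k::field_char_0 \<Rightarrow> real) \<Rightarrow> 's matrix_KS set" where
  "SL2_OK \<sigma> = tau_matrix \<sigma> ` {A. det A = 1 \<and> (\<forall>i j. algebraic_int (A $ i $ j))}"

lemma group_SL2_KS: "group (SL2_KS :: 's::finite matrix_KS monoid)"
proof (rule groupI)
  fix x :: "'s matrix_KS"
  assume x: "x \<in> carrier SL2_KS"
  have "\<exists>B. B ** x $ s = mat 1" for s
    using x by (simp add: SL2_KS_def invertible_det_nz flip: invertible_left_inverse)
  then obtain B where B: "\<And>s. B s ** x $ s = mat 1" by metis
  have "det (B s) = 1" for s
    using arg_cong[OF B[of s], of det] x by (simp add: SL2_KS_def det_mul)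
  then have "(\<chi> s. B s) \<in> carrier SL2_KS" "(\<chi> s. B s) \<otimes>\<^bsub>SL2_KS\<^esub> x = \<one>\<^bsub>SL2_KS\<^esub>"
    using B by (simp_all add: SL2_KS_def)
  then show "\<exists>y\<in>carrier SL2_KS. y \<otimes>\<^bsub>SL2_KS\<^esub> x = \<one>\<^bsub>SL2_KS\<^esub>" by blast
qed (auto simp: SL2_KS_def det_mul matrix_mul_assoc)

definition quotient_topology :: "'a topology \<Rightarrow> ('a \<Rightarrow> 'b) \<Rightarrow> 'b topology" where
  "quotient_topology X q =
     topology (\<lambda>U. U \<subseteq> q ` topspace X \<and> openin X {x \<in> topspace X. q x \<in> U})"

lemma openin_quotient_topology:
  "openin (quotient_topology X q) U \<longleftrightarrow>
     U \<subseteq> q ` topspace X \<and> openin X {x \<in> topspace X. q x \<in> U}"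
proof -
  have 1: "{x \<in> topspace X. q x \<in> A \<inter> B} = {x \<in> topspace X. q x \<in> A} \<inter> {x \<in> topspace X. q x \<in> B}" for A B
    by blast
  have 2: "{x \<in> topspace X. q x \<in> \<Union>\<K>} = (\<Union>A\<in>\<K>. {x \<in> topspace X. q x \<in> A})" for \<K>
    by blast
  have "istopology (\<lambda>U. U \<subseteq> q ` topspace X \<and> openin X {x \<in> topspace X. q x \<in> U})"
    unfolding istopology_def 1 2 by (auto intro!: openin_clauses)
  then show ?thesis
    by (simp add: quotient_topology_def topology_inverse')
qed

lemma topspace_quotient_topology: "topspace (quotient_topology X q) = q ` topspace X"
proof
  have "{x \<in> topspace X. q x \<in> q ` topspace X} = topspace X" by blast
  then show "q ` topspace X \<subseteq> topspace (quotient_topology X q)"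
    by (simp add: openin_subset openin_quotient_topology)
qed (use openin_quotient_topology[of X q "topspace (quotient_topology X q)"] in simp)

lemma quotient_map_quotient_topology: "quotient_map X (quotient_topology X q) q"
  by (auto simp: quotient_map_def topspace_quotient_topology openin_quotient_topology)

text \<open>The points are the right cosets \<open>SL\<^sub>2(O\<^sub>K) g\<close>; a group element \<open>h\<close> acts on them by
  \<open>y \<mapsto> y #>\<^bsub>SL2_KS\<^esub> h\<close>.\<close>

definition homogeneous_space :: "('s::finite \<Rightarrow> 'k::field_char_0 \<Rightarrow> real) \<Rightarrow> 's matrix_KS set topology" where
  "homogeneous_space \<sigma> =
     quotient_topology (top_of_set (carrier SL2_KS)) (\<lambda>g. SL2_OK \<sigma> #>\<^bsub>SL2_KS\<^esub> g)"

lemma topspace_homogeneous_space: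
  "topspace (homogeneous_space \<sigma>) = rcosets\<^bsub>SL2_KS\<^esub> SL2_OK \<sigma>"
  by (auto simp: homogeneous_space_def topspace_quotient_topology RCOSETS_def)

definition unipotent :: "real ^ 's::finite \<Rightarrow> 's matrix_KS" where
  "unipotent u = (\<chi> s. vector [vector [1, u $ s], vector [0, 1]])"

definition flow :: "real ^ 's::finite \<Rightarrow> real \<Rightarrow> 's matrix_KS" where
  "flow r t = (\<chi> s. vector [vector [exp (- (r $ s) * t), 0], vector [0, exp (r $ s * t)]])"

lemma unipotent_in_SL2_KS: "unipotent u \<in> carrier SL2_KS"
  by (simp add: unipotent_def SL2_KS_def det_2)

lemma flow_in_SL2_KS: "flow r t \<in> carrier SL2_KS"
  by (simp add: flow_def SL2_KS_def det_2 flip: exp_add)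

definition relatively_compactin :: "'a topology \<Rightarrow> 'a set \<Rightarrow> bool" where
  "relatively_compactin X T \<longleftrightarrow> T \<subseteq> topspace X \<and> compactin X (X closure_of T)"

definition bounded_trajectory ::
  "('s::finite \<Rightarrow> 'k::field_char_0 \<Rightarrow> real) \<Rightarrow> real ^ 's \<Rightarrow> 's matrix_KS set \<Rightarrow> bool" where
  "bounded_trajectory \<sigma> r y \<longleftrightarrow>
     relatively_compactin (homogeneous_space \<sigma>) {y #>\<^bsub>SL2_KS\<^esub> flow r t | t. t \<ge> 0}"


section \<open>Schmidt's game\<close>

definition ball_in :: "'a::metric_space set \<Rightarrow> 'a \<Rightarrow> real \<Rightarrow> 'a set" where
  "ball_in X x \<rho> = X \<inter> cball x \<rho>"

text \<open>
  Player A's ball at step \<open>n\<close> has centre \<open>x n\<close>. A strategy \<open>f\<close> for Player B gives the centre of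
  B's ball at step \<open>n\<close> from the initial radius \<open>\<rho>\<close> and the centres \<open>x 0, \<dots>, x n\<close> chosen so far.
\<close>

definition ball_A :: "'a::metric_space set \<Rightarrow> real \<Rightarrow> real \<Rightarrow> real \<Rightarrow> (nat \<Rightarrow> 'a) \<Rightarrow> nat \<Rightarrow> 'a set" where
  "ball_A X \<alpha> \<beta> \<rho> x n = ball_in X (x n) ((\<alpha> * \<beta>) ^ n * \<rho>)"

definition centre_B :: "(real \<Rightarrow> 'a list \<Rightarrow> 'a) \<Rightarrow> real \<Rightarrow> (nat \<Rightarrow> 'a) \<Rightarrow> nat \<Rightarrow> 'a" where
  "centre_B f \<rho> x n = f \<rho> (map x [0..<Suc n])"

definition ball_B :: "'a::metric_space set \<Rightarrow> real \<Rightarrow> real \<Rightarrow> (real \<Rightarrow> 'a list \<Rightarrow> 'a) \<Rightarrow>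
    real \<Rightarrow> (nat \<Rightarrow> 'a) \<Rightarrow> nat \<Rightarrow> 'a set" where
  "ball_B X \<alpha> \<beta> f \<rho> x n = ball_in X (centre_B f \<rho> x n) (\<alpha> * (\<alpha> * \<beta>) ^ n * \<rho>)"

definition legal_A :: "'a::metric_space set \<Rightarrow> real \<Rightarrow> real \<Rightarrow> (real \<Rightarrow> 'a list \<Rightarrow> 'a) \<Rightarrow>
    real \<Rightarrow> (nat \<Rightarrow> 'a) \<Rightarrow> nat \<Rightarrow> bool" where
  "legal_A X \<alpha> \<beta> f \<rho> x n \<longleftrightarrow> x n \<in> X \<and>
     (n > 0 \<longrightarrow> ball_A X \<alpha> \<beta> \<rho> x n \<subseteq> ball_B X \<alpha> \<beta> f \<rho> x (n - 1))"

definition legal_B :: "'a::metric_space set \<Rightarrow> real \<Rightarrow> real \<Rightarrow> (real \<Rightarrow> 'a list \<Rightarrow> 'a) \<Rightarrow>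
    real \<Rightarrow> (nat \<Rightarrow> 'a) \<Rightarrow> nat \<Rightarrow> bool" where
  "legal_B X \<alpha> \<beta> f \<rho> x n \<longleftrightarrow> centre_B f \<rho> x n \<in> X \<and>
     ball_B X \<alpha> \<beta> f \<rho> x n \<subseteq> ball_A X \<alpha> \<beta> \<rho> x n"

definition winning_strategy :: "'a::metric_space set \<Rightarrow> 'a set \<Rightarrow> real \<Rightarrow> real \<Rightarrow>
    (real \<Rightarrow> 'a list \<Rightarrow> 'a) \<Rightarrow> bool" where
  "winning_strategy X W \<alpha> \<beta> f \<longleftrightarrow> (\<forall>\<rho>>0. \<forall>x.
     (\<forall>n. (\<forall>k\<le>n. legal_A X \<alpha> \<beta> f \<rho> x k) \<longrightarrow> legal_B X \<alpha> \<beta> f \<rho> x n) \<and>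
     ((\<forall>n. legal_A X \<alpha> \<beta> f \<rho> x n) \<longrightarrow> (\<exists>z\<in>W. (\<Inter>n. ball_A X \<alpha> \<beta> \<rho> x n) = {z})))"

definition alpha_beta_winning :: "'a::metric_space set \<Rightarrow> 'a set \<Rightarrow> real \<Rightarrow> real \<Rightarrow> bool" where
  "alpha_beta_winning X W \<alpha> \<beta> \<longleftrightarrow> (\<exists>f. winning_strategy X W \<alpha> \<beta> f)"

definition alpha_winning :: "'a::metric_space set \<Rightarrow> 'a set \<Rightarrow> real \<Rightarrow> bool" where
  "alpha_winning X W \<alpha> \<longleftrightarrow> (\<forall>\<beta>. 0 < \<beta> \<and> \<beta> < 1 \<longrightarrow> alpha_beta_winning X W \<alpha> \<beta>)"

definition schmidt_winning :: "'a::metric_space set \<Rightarrow> 'a set \<Rightarrow> bool" where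
  "schmidt_winning X W \<longleftrightarrow> (\<exists>\<alpha>. 0 < \<alpha> \<and> \<alpha> < 1 \<and> alpha_winning X W \<alpha>)"


section \<open>Hausdorff dimension\<close>

text \<open>The case distinction is needed because \<open>0 powr 0 = 0\<close>; at exponent 0 every nonempty set
  has weight 1.\<close>

definition diameter_power :: "real \<Rightarrow> 'a::metric_space set \<Rightarrow> ennreal" where
  "diameter_power s U =
     (if U = {} then 0 else if s = 0 then 1 else ennreal (diameter U powr s))"

text \<open>Covers are restricted to bounded sets, as \<^const>\<open>diameter\<close> is unspecified on unbounded ones.\<close>

definition hausdorff_premeasure :: "real \<Rightarrow> real \<Rightarrow> 'a::metric_space set \<Rightarrow> ennreal" where
  "hausdorff_premeasure s \<delta> A =
     (INF U \<in> {U :: nat \<Rightarrow> 'a set. A \<subseteq> (\<Union>i. U i) \<and> (\<forall>i. bounded (U i) \<and> diameter (U i) \<le> \<delta>)}.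
        \<Sum>i. diameter_power s (U i))"

definition hausdorff_measure :: "real \<Rightarrow> 'a::metric_space set \<Rightarrow> ennreal" where
  "hausdorff_measure s A = (SUP \<delta> \<in> {0<..}. hausdorff_premeasure s \<delta> A)"

definition hausdorff_dimension :: "'a::metric_space set \<Rightarrow> ennreal" where
  "hausdorff_dimension A = (INF s \<in> {s. 0 \<le> s \<and> hausdorff_measure s A = 0}. ennreal s)"

end

theory Submission
  imports Defs
begin

text \<open>
  Order the two embeddings so that \<open>r\<^sub>a \<ge> r\<^sub>b\<close>. For \<open>w \<in> O\<^sub>K\<^sup>2\<close> let \<open>N w x t\<close> be the product over both
  embeddings of the sup norms of \<open>w g \<Phi>(x) g(r)\<^sub>t\<close>; this product does not see units of \<open>O\<^sub>K\<close>.

  If \<open>N w x t \<ge> \<epsilon>\<close> for all \<open>w \<noteq> 0\<close> and \<open>t \<ge> 0\<close>, the trajectory of \<open>x\<close> is bounded: by pigeonhole there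
  are more short vectors than a single \<open>K\<close>-line can carry, hence two independent ones, and the
  integral matrices of bounded determinant formed by them fall into finitely many classes modulo
  \<open>SL\<^sub>2(O\<^sub>K)\<close>.

  Player B enforces such a bound. The determinant of two vectors is an algebraic integer, so its
  norm is 0 or at least 1; therefore on an interval of length comparable to \<open>exp (- 2 r\<^sub>a t)\<close> all
  vectors with \<open>N w x t < \<epsilon>\<close> lie on one \<open>K\<close>-line. Since \<open>r\<^sub>b \<le> r\<^sub>a\<close>, \<open>N w x\<close> can drop at time \<open>t\<close> only if
  \<open>\<phi>\<^sub>a(x)\<close> is within \<open>exp (- 2 r\<^sub>a t)\<close> of the slope of that line, so the points where the bound first
  fails lie in an interval that is short compared with the current ball, and B can move away from
  it. The finitely many zeros of \<open>\<phi>\<^sub>a'\<close> are avoided in the opening moves.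

  For the dimension, let A choose among \<open>M\<close> separated balls at each move, following the base-\<open>M\<close>
  digits of \<open>y \<in> [0, 1)\<close>: the map from outcomes in \<open>W\<close> back to \<open>y\<close> is Hoelder with exponent \<open>s\<close> once
  \<open>M\<close> is large, for every \<open>s < 1\<close>.
\<close>

section \<open>Arithmetic of real quadratic fields\<close>

text \<open>Units of O_K make every short vector come with infinitely many others, so neither a
  single vector nor its norm at one embedding can guide the strategy. What the multiples of w share
  is the slope - D / A of their K-line at the embedding a, where (A, D) is the row w g; the size of
  the bad sets is estimated through it alone. The order of the constants matters. The first ball of
  A that misses the zeros gives a lower bound m for the derivative of \<phi> at a; m and the radius
  fix a starting time T0 after which the bad intervals are short; \<epsilon> comes last, because it
  must absorb the distortion exp (2 r T0), r the larger weight, between points of one ball. Matching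
  the time step to the ratio of radii makes all later scales copies of the first. The pigeonhole in
  Mahler's criterion succeeds because O_K^2 has rank 4 over the integers and a K-line has rank 2:
  some box of side R holds at least of order R^4 vectors, while a lower bound for N leaves room for
  only of order R^2 on a line.\<close>

locale field_emb =
  fixes f :: "'k::field_char_0 \<Rightarrow> real"
  assumes emb: "field_embedding f"
begin

lemma f_1 [simp]: "f 1 = 1" and f_add [simp]: "f (x + y) = f x + f y"
  and f_mult [simp]: "f (x * y) = f x * f y"
  using emb by (auto simp: field_embedding_def)

lemma f_0 [simp]: "f 0 = 0"
  using f_add[of 0 0] by simp

lemma f_minus [simp]: "f (- x) = - f x"
  using f_add[of x "- x"] by simp

lemma f_diff [simp]: "f (x - y) = f x - f y"
  using f_add[of x "- y"] by simp

lemma f_power [simp]: "f (x ^ n) = f x ^ n"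
  by (induction n) auto

lemma f_eq_0_iff [simp]: "f x = 0 \<longleftrightarrow> x = 0"
proof
  assume "f x = 0"
  then show "x = 0"
    using f_mult[of x "inverse x"] by (cases "x = 0") auto
qed auto

lemma f_of_nat [simp]: "f (of_nat n) = of_nat n"
  by (induction n) auto

lemma f_of_int [simp]: "f (of_int n) = of_int n"
  by (cases n) auto

lemma f_divide: "f (x / y) = f x / f y"
proof (cases "y = 0")
  case False
  then show ?thesis using f_mult[of "x / y" y] by (simp add: field_simps)
qed auto

lemma f_of_rat [simp]: "f (of_rat q) = of_rat q"
  by (cases q) (simp add: of_rat_rat f_divide)

end

text \<open>In lowest terms x = a / b, the last hypothesis makes b ^ n divide the fixed c for every
  n, which is impossible for b >= 2. Integrality of norms is obtained from this.\<close>

lemma Ints_of_bounded_denominators: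
  fixes x :: real
  assumes "x \<in> \<rat>" "c \<noteq> 0" "\<And>n. of_int c * x ^ n \<in> \<int>"
  shows "x \<in> \<int>"
proof -
  from assms(1) obtain a b where ab: "b > 0" "coprime a b" and x: "x = of_int a / of_int b"
    by (auto elim: Rats_cases')
  have dvd: "b ^ n dvd c" for n
  proof -
    obtain k where "of_int c * x ^ n = of_int k" using assms(3)[of n] by (auto elim: Ints_cases)
    then have "real_of_int (c * a ^ n) = of_int (k * b ^ n)"
      using ab by (simp add: x field_simps)
    then have "c * a ^ n = k * b ^ n" by linarith
    then have "b ^ n dvd c * a ^ n" by simp
    moreover have "coprime (b ^ n) (a ^ n)" using ab by (simp add: coprime_commute)
    ultimately show ?thesis by (simp add: coprime_dvd_mult_left_iff)
  qed
  have "b = 1"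
  proof (rule ccontr)
    assume "b \<noteq> 1"
    then have "b \<ge> 2" using ab by simp
    have "\<bar>c\<bar> < 2 ^ nat \<bar>c\<bar>"
      using of_nat_less_two_power[of "nat \<bar>c\<bar>", where 'a = int] by simp
    also have "\<dots> \<le> b ^ nat \<bar>c\<bar>" using \<open>b \<ge> 2\<close> by (intro power_mono) auto
    also have "\<dots> \<le> \<bar>c\<bar>" using dvd[of "nat \<bar>c\<bar>"] \<open>c \<noteq> 0\<close> ab
      by (intro zdvd_imp_le) auto
    finally show False by simp
  qed
  then show ?thesis by (simp add: x)
qed

text \<open>\<theta> is any generator with integral square; d may have square factors, so
  Z[\<theta>] may be smaller than the ring of integers. The gap is controlled by denominators, which
  is enough for the finiteness arguments.\<close>

locale real_quadratic =
  e1: field_emb \<tau>1 + e2: field_emb \<tau>2 for \<tau>1 \<tau>2 :: "'k::field_char_0 \<Rightarrow> real" +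
  fixes \<theta> :: 'k and d :: int
  assumes gen: "\<exists>p q. x = of_rat p + of_rat q * \<theta>"
    and theta_sq: "\<theta> * \<theta> = of_int d"
    and theta1: "\<tau>1 \<theta> \<noteq> 0"
    and theta2: "\<tau>2 \<theta> = - \<tau>1 \<theta>"
begin

section \<open>The order Z[\<theta>], integrality, norm and trace\<close>

definition quad_order :: "'k set" where
  "quad_order = {of_int m + of_int n * \<theta> |m n. True}"

lemma order_of_int [simp]: "of_int m \<in> quad_order"
  unfolding quad_order_def by (intro CollectI exI[of _ m] exI[of _ 0]) simp

lemma order_1 [simp]: "1 \<in> quad_order" and order_0 [simp]: "0 \<in> quad_order"
  using order_of_int[of 1] order_of_int[of 0] by simp_all

lemma order_theta [simp]: "\<theta> \<in> quad_order"
  unfolding quad_order_def by (intro CollectI exI[of _ 0] exI[of _ 1]) simp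

lemma order_add: "x \<in> quad_order \<Longrightarrow> y \<in> quad_order \<Longrightarrow> x + y \<in> quad_order"
proof -
  assume "x \<in> quad_order" "y \<in> quad_order"
  then obtain m n m' n' where "x = of_int m + of_int n * \<theta>" "y = of_int m' + of_int n' * \<theta>"
    by (auto simp: quad_order_def)
  then have "x + y = of_int (m + m') + of_int (n + n') * \<theta>" by (simp add: algebra_simps)
  then show ?thesis unfolding quad_order_def by blast
qed

lemma order_mult: "x \<in> quad_order \<Longrightarrow> y \<in> quad_order \<Longrightarrow> x * y \<in> quad_order"
proof -
  assume "x \<in> quad_order" "y \<in> quad_order"
  then obtain m n m' n' where "x = of_int m + of_int n * \<theta>" "y = of_int m' + of_int n' * \<theta>"
    by (auto simp: quad_order_def)
  then have "x * y = of_int (m * m') + of_int (m * n' + m' * n) * \<theta> + of_int (n * n') * (\<theta> * \<theta>)"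
    by (simp add: algebra_simps)
  also have "\<dots> = of_int (m * m' + n * n' * d) + of_int (m * n' + m' * n) * \<theta>"
    by (simp add: theta_sq)
  finally show ?thesis unfolding quad_order_def by blast
qed

lemma order_sum: "(\<And>i. i \<in> A \<Longrightarrow> f i \<in> quad_order) \<Longrightarrow> sum f A \<in> quad_order"
  by (induction A rule: infinite_finite_induct) (auto intro: order_add)

lemma order_denominator: "\<exists>c::int. c \<noteq> 0 \<and> of_int c * x \<in> quad_order"
proof -
  obtain p q where x: "x = of_rat p + of_rat q * \<theta>" using gen by blast
  obtain a b where p: "p = of_int a / of_int b" "b \<noteq> 0"
    by (metis quotient_of_div quotient_of_denom_pos less_irrefl surj_pair)
  obtain a' b' where q: "q = of_int a' / of_int b'" "b' \<noteq> 0"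
    by (metis quotient_of_div quotient_of_denom_pos less_irrefl surj_pair)
  have "of_int (b * b') * x = of_int (a * b') + of_int (a' * b) * \<theta>"
  proof -
    have "of_int b * of_rat p = (of_int a :: 'k)" "of_int b' * of_rat q = (of_int a' :: 'k)"
      using p q by (simp_all add: of_rat_divide)
    then show ?thesis by (simp add: x algebra_simps)
  qed
  then have "of_int (b * b') * x \<in> quad_order" unfolding quad_order_def by blast
  moreover have "b * b' \<noteq> 0" using p q by simp
  ultimately show ?thesis by blast
qed

text \<open>Almost integrality over Z[\<theta>]: one denominator serves all powers. This form is
  closed under sums and products by direct computation with the product of two denominators, and
  \<open>bdd_denoms_iff\<close> transfers the closure to algebraic integers.\<close>

definition bdd_denoms :: "'k \<Rightarrow> bool" where
  "bdd_denoms x \<longleftrightarrow> (\<exists>c::int. c \<noteq> 0 \<and> (\<forall>n. of_int c * x ^ n \<in> quad_order))"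

lemma bdd_denoms_add:
  assumes "bdd_denoms x" "bdd_denoms y" shows "bdd_denoms (x + y)"
proof -
  obtain c c' :: int where c: "c \<noteq> 0" "c' \<noteq> 0" "\<And>n. of_int c * x ^ n \<in> quad_order" "\<And>n. of_int c' * y ^ n \<in> quad_order"
    using assms by (auto simp: bdd_denoms_def)
  have "of_int (c * c') * (x + y) ^ n \<in> quad_order" for n
  proof -
    have "of_int (c * c') * (x + y) ^ n =
        (\<Sum>k\<le>n. of_int (int (n choose k)) * ((of_int c * x ^ k) * (of_int c' * y ^ (n - k))))"
      by (subst binomial_ring) (simp add: sum_distrib_left mult_ac)
    also have "\<dots> \<in> quad_order" by (intro order_sum order_mult c order_of_int)
    finally show ?thesis .
  qed
  then show ?thesis unfolding bdd_denoms_def using c by (intro exI[of _ "c * c'"]) auto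
qed

lemma bdd_denoms_mult:
  assumes "bdd_denoms x" "bdd_denoms y" shows "bdd_denoms (x * y)"
proof -
  obtain c c' :: int where c: "c \<noteq> 0" "c' \<noteq> 0" "\<And>n. of_int c * x ^ n \<in> quad_order" "\<And>n. of_int c' * y ^ n \<in> quad_order"
    using assms by (auto simp: bdd_denoms_def)
  have "of_int (c * c') * (x * y) ^ n \<in> quad_order" for n
    using order_mult[OF c(3)[of n] c(4)[of n]] by (simp add: power_mult_distrib mult_ac)
  then show ?thesis unfolding bdd_denoms_def using c by (intro exI[of _ "c * c'"]) auto
qed

lemma order_power: "x \<in> quad_order \<Longrightarrow> x ^ n \<in> quad_order"
  by (induction n) (auto intro: order_mult)

lemma bdd_denoms_order: "x \<in> quad_order \<Longrightarrow> bdd_denoms x"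
  unfolding bdd_denoms_def by (intro exI[of _ 1]) (auto intro: order_power)

text \<open>The product of denominators of 1, x, ..., x^(k-1) serves all powers, since the monic
  relation of degree k with integer coefficients expresses each higher power through lower
  ones.\<close>

lemma algebraic_int_imp_bdd_denoms:
  assumes "algebraic_int x" shows "bdd_denoms x"
proof -
  obtain p where p: "lead_coeff p = 1" "\<And>i. coeff p i \<in> \<int>" "poly p x = 0"
    using assms by (auto simp: algebraic_int.simps)
  define k where "k = degree p"
  obtain c :: "nat \<Rightarrow> int" where c: "\<And>i. c i \<noteq> 0" "\<And>i. of_int (c i) * x ^ i \<in> quad_order"
    using that[of "\<lambda>i. SOME c. c \<noteq> 0 \<and> of_int c * x ^ i \<in> quad_order"]
      someI_ex[OF order_denominator] by blast
  define C where "C = prod c {..<k}"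
  have root: "x ^ k = - (\<Sum>i<k. coeff p i * x ^ i)"
  proof -
    have "0 = (\<Sum>i\<le>k. coeff p i * x ^ i)" using p by (simp add: poly_altdef k_def)
    also have "\<dots> = (\<Sum>i<k. coeff p i * x ^ i) + x ^ k"
      using p by (simp add: k_def lessThan_Suc_atMost[symmetric])
    finally show ?thesis by (simp add: eq_neg_iff_add_eq_0 add.commute)
  qed
  have "of_int C * x ^ n \<in> quad_order" for n
  proof (induction n rule: less_induct)
    case (less n)
    show ?case
    proof (cases "n < k")
      case True
      then have "C = prod c ({..<k} - {n}) * c n"
        unfolding C_def by (subst prod.remove[of _ n]) (auto simp: mult_ac)
      then have "of_int C * x ^ n = of_int (prod c ({..<k} - {n})) * (of_int (c n) * x ^ n)"
        by (simp only: of_int_mult mult_ac)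
      also have "\<dots> \<in> quad_order" by (rule order_mult[OF order_of_int c(2)])
      finally show ?thesis .
    next
      case False
      then have "of_int C * x ^ n = of_int C * x ^ (n - k) * x ^ k"
        by (simp add: mult.assoc flip: power_add)
      also have "\<dots> = (\<Sum>i<k. (- coeff p i) * (of_int C * x ^ (n - k + i)))"
        by (simp add: root sum_distrib_left power_add mult_ac sum_negf)
      also have "\<dots> \<in> quad_order"
      proof (rule order_sum)
        fix i assume "i \<in> {..<k}"
        then have "of_int C * x ^ (n - k + i) \<in> quad_order" using False by (intro less) auto
        moreover have "- coeff p i \<in> quad_order"
          using p(2)[of i] order_of_int[of "- k" for k] by (auto elim!: Ints_cases)
        ultimately show "(- coeff p i) * (of_int C * x ^ (n - k + i)) \<in> quad_order" by (rule order_mult[rotated])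
      qed
      finally show ?thesis .
    qed
  qed
  then show ?thesis unfolding bdd_denoms_def using c by (intro exI[of _ C]) (auto simp: C_def)
qed

lemma tau_theta_sq: "\<tau>1 \<theta> * \<tau>1 \<theta> = of_int d"
  by (metis e1.f_mult e1.f_of_int theta_sq)

lemma norm_order: "x \<in> quad_order \<Longrightarrow> \<tau>1 x * \<tau>2 x \<in> \<int>"
proof -
  assume "x \<in> quad_order"
  then obtain m n where "x = of_int m + of_int n * \<theta>" by (auto simp: quad_order_def)
  then have "\<tau>1 x * \<tau>2 x = of_int (m * m) - of_int (n * n) * (\<tau>1 \<theta> * \<tau>1 \<theta>)"
    by (simp add: theta2 algebra_simps)
  then show ?thesis by (simp add: tau_theta_sq)
qed

lemma norm_rat: "\<tau>1 x * \<tau>2 x \<in> \<rat>"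
proof -
  obtain p q where "x = of_rat p + of_rat q * \<theta>" using gen by blast
  then have "\<tau>1 x * \<tau>2 x = of_rat (p * p) - of_rat (q * q) * (\<tau>1 \<theta> * \<tau>1 \<theta>)"
    by (simp add: theta2 algebra_simps of_rat_mult)
  then show ?thesis by (simp add: tau_theta_sq)
qed

text \<open>The norm of c x^n is an integer and equals c^2 times the n-th power of the norm of x, so
  this rational norm has bounded denominators.\<close>

lemma norm_bdd_denoms:
  assumes "bdd_denoms x" shows "\<tau>1 x * \<tau>2 x \<in> \<int>"
proof -
  obtain c :: int where c: "c \<noteq> 0" "\<And>n. of_int c * x ^ n \<in> quad_order"
    using assms by (auto simp: bdd_denoms_def)
  have "of_int (c * c) * (\<tau>1 x * \<tau>2 x) ^ n \<in> \<int>" for n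
    using norm_order[OF c(2)[of n]] by (simp add: power_mult_distrib mult_ac)
  moreover have "c * c \<noteq> 0" using c by simp
  ultimately show ?thesis by (intro Ints_of_bounded_denominators[OF norm_rat])
qed

text \<open>Norms suffice: the trace of x is N(1 + x) - N(x) - 1.\<close>

lemma trace_bdd_denoms:
  assumes "bdd_denoms x" shows "\<tau>1 x + \<tau>2 x \<in> \<int>"
proof -
  have "\<tau>1 (1 + x) * \<tau>2 (1 + x) \<in> \<int>"
    by (intro norm_bdd_denoms bdd_denoms_add bdd_denoms_order assms) simp
  then have "\<tau>1 (1 + x) * \<tau>2 (1 + x) - \<tau>1 x * \<tau>2 x - 1 \<in> \<int>"
    using norm_bdd_denoms[OF assms] by (intro Ints_diff) auto
  also have "\<tau>1 (1 + x) * \<tau>2 (1 + x) - \<tau>1 x * \<tau>2 x - 1 = \<tau>1 x + \<tau>2 x"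
    by (simp add: algebra_simps)
  finally show ?thesis .
qed

lemma char_poly:
  assumes "\<tau>1 x + \<tau>2 x = of_int t" "\<tau>1 x * \<tau>2 x = of_int n"
  shows "poly [:of_int n, - of_int t, 1:] x = 0"
proof -
  have "\<tau>1 (of_int n + x * (x - of_int t)) = 0"
    by (simp add: assms[symmetric] algebra_simps)
  then have "of_int n + x * (x - of_int t) = 0" unfolding e1.f_eq_0_iff .
  then show ?thesis by (simp add: algebra_simps)
qed

lemma bdd_denoms_iff: "bdd_denoms x \<longleftrightarrow> algebraic_int x"
proof
  assume x: "bdd_denoms x"
  obtain t n where tn: "\<tau>1 x + \<tau>2 x = of_int t" "\<tau>1 x * \<tau>2 x = of_int n"
    using norm_bdd_denoms[OF x] trace_bdd_denoms[OF x] by (auto elim!: Ints_cases)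
  have "coeff [:of_int n :: 'k, - of_int t, 1:] i \<in> \<int>" for i
    by (auto simp: coeff_pCons split: nat.splits)
  then show "algebraic_int x"
    by (intro algebraic_int.intros[OF _ _ char_poly[OF tn]]) auto
qed (rule algebraic_int_imp_bdd_denoms)

lemma algebraic_int_add: "algebraic_int x \<Longrightarrow> algebraic_int y \<Longrightarrow> algebraic_int (x + y)" for x y :: 'k
  by (rule bdd_denoms_add[unfolded bdd_denoms_iff])

lemma algebraic_int_mult: "algebraic_int x \<Longrightarrow> algebraic_int y \<Longrightarrow> algebraic_int (x * y)" for x y :: 'k
  by (rule bdd_denoms_mult[unfolded bdd_denoms_iff])

lemma algebraic_int_diff: "algebraic_int x \<Longrightarrow> algebraic_int y \<Longrightarrow> algebraic_int (x - y)" for x y :: 'k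
  using algebraic_int_add[of x "- y"] by simp

lemma algebraic_int_order: "x \<in> quad_order \<Longrightarrow> algebraic_int x"
  by (rule bdd_denoms_order[unfolded bdd_denoms_iff])

lemma norm_Ints: "algebraic_int x \<Longrightarrow> \<tau>1 x * \<tau>2 x \<in> \<int>"
  and trace_Ints: "algebraic_int x \<Longrightarrow> \<tau>1 x + \<tau>2 x \<in> \<int>"
  by (fact norm_bdd_denoms[unfolded bdd_denoms_iff] trace_bdd_denoms[unfolded bdd_denoms_iff])+

lemma norm_ge_1:
  assumes "algebraic_int x" "x \<noteq> 0" shows "\<bar>\<tau>1 x\<bar> * \<bar>\<tau>2 x\<bar> \<ge> 1"
  using Ints_nonzero_abs_ge1[OF norm_Ints[OF assms(1)]] assms(2) by (simp add: abs_mult)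

text \<open>Bounded conjugates bound trace and norm, which leaves finitely many quadratic
  polynomials, each with finitely many roots.\<close>

lemma finite_algebraic_int_bounded:
  "finite {x. algebraic_int x \<and> \<bar>\<tau>1 x\<bar> \<le> M \<and> \<bar>\<tau>2 x\<bar> \<le> M}"
proof (rule finite_subset)
  define P where "P = (\<lambda>z::int \<times> int. {x. poly [:of_int (snd z), - of_int (fst z), 1::'k:] x = 0})"
  let ?I = "{- \<lceil>2 * M\<rceil>..\<lceil>2 * M\<rceil>} \<times> {- \<lceil>M * M\<rceil>..\<lceil>M * M\<rceil>}"
  have "finite (P z)" for z unfolding P_def by (rule poly_roots_finite) simp
  then show "finite (\<Union> (P ` ?I))"
    by (simp del: finite_cartesian_product_iff add: finite_cartesian_product)
  show "{x. algebraic_int x \<and> \<bar>\<tau>1 x\<bar> \<le> M \<and> \<bar>\<tau>2 x\<bar> \<le> M} \<subseteq> \<Union> (P ` ?I)"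
  proof clarify
    fix x assume x: "algebraic_int x" "\<bar>\<tau>1 x\<bar> \<le> M" "\<bar>\<tau>2 x\<bar> \<le> M"
    obtain t n where tn: "\<tau>1 x + \<tau>2 x = of_int t" "\<tau>1 x * \<tau>2 x = of_int n"
      using norm_Ints[OF x(1)] trace_Ints[OF x(1)] by (auto elim!: Ints_cases)
    have "\<bar>real_of_int t\<bar> \<le> 2 * M" unfolding tn(1)[symmetric] using x by linarith
    moreover have "\<bar>real_of_int n\<bar> \<le> M * M" unfolding tn(2)[symmetric] abs_mult
      using x by (intro mult_mono) auto
    ultimately have "(t, n) \<in> ?I" unfolding mem_Times_iff fst_conv snd_conv atLeastAtMost_iff by linarith
    then show "x \<in> \<Union> (P ` ?I)" using char_poly[OF tn] unfolding P_def by (intro UN_I[of "(t, n)"]) auto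
  qed
qed

lemma d_pos: "d > 0"
proof -
  have "real_of_int d > 0" using tau_theta_sq theta1 by (metis not_real_square_gt_zero)
  then show ?thesis by simp
qed

text \<open>Write x = p + q \<theta>, with trace t and norm n. Then 2 p = t, and the square of the
  rational number 2 q d is d (t^2 - 4 n), so 2 q d is an integer as well. The factor 2 d is a crude
  bound for the gap between the ring of integers and Z[\<theta>].\<close>

lemma algebraic_int_denominator:
  assumes "algebraic_int x" shows "of_int (2 * d) * x \<in> quad_order"
proof -
  obtain p q where x: "x = of_rat p + of_rat q * \<theta>" using gen by blast
  obtain t where t: "\<tau>1 x + \<tau>2 x = of_int t" using trace_Ints[OF assms] by (auto elim!: Ints_cases)
  obtain n where n: "\<tau>1 x * \<tau>2 x = of_int n" using norm_Ints[OF assms] by (auto elim!: Ints_cases)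
  have "real_of_rat (2 * p) = of_int t" using t by (simp add: x theta2 of_rat_mult)
  then have p: "2 * p = of_int t" by (metis of_rat_of_int_eq of_rat_eq_iff)
  define y where "y = 2 * q * of_int d"
  have "real_of_rat (p * p - q * q * of_int d) = of_int n"
    using n tau_theta_sq by (simp add: x theta2 of_rat_mult of_rat_diff algebra_simps)
  then have "p * p - q * q * of_int d = of_int n" by (metis of_rat_of_int_eq of_rat_eq_iff)
  moreover have "y ^ 2 = of_int d * ((2 * p) * (2 * p) - 4 * (p * p - q * q * of_int d))"
    by (simp add: y_def power2_eq_square algebra_simps)
  ultimately have "y ^ 2 = of_int (d * (t * t - 4 * n))" by (simp add: p)
  then have "algebraic_int (y ^ 2)" using algebraic_int_of_int by metis
  then have "algebraic_int y"
  proof (rule algebraic_int_root)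
    show "poly [:0, 0, 1:] y = y ^ 2" by (simp add: power2_eq_square)
    show "\<forall>i. coeff [:0, 0, 1:: rat:] i \<in> \<int>" by (simp add: coeff_pCons split: nat.splits)
  qed simp_all
  then have "y \<in> \<int>"
    by (rule rational_algebraic_int_is_int) (metis Rats_of_rat of_rat_eq_id id_apply)
  then obtain k where k: "y = of_int k" by (auto elim: Ints_cases)
  have "of_int (2 * d) * x = of_int d * of_rat (2 * p) + of_rat y * \<theta>"
    by (simp add: x y_def of_rat_mult algebra_simps)
  also have "\<dots> = of_int (d * t) + of_int k * \<theta>" by (simp add: p k)
  finally show ?thesis unfolding quad_order_def by blast
qed

end

text \<open>Exchange puts 1 into a rational basis {1, w}; completing the square in the relation for
  w * w and clearing the denominator gives \<theta>. Both embeddings send \<theta> to square roots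
  of d, and embeddings that agree on \<theta> agree everywhere, so the two roots are
  opposite.\<close>

lemma real_quadratic_field_structure:
  fixes \<sigma> :: "'s::finite \<Rightarrow> 'k::field_char_0 \<Rightarrow> real"
  assumes K: "real_quadratic_field TYPE('k)"
    and S: "bij_betw \<sigma> UNIV (real_embeddings :: ('k \<Rightarrow> real) set)"
    and ab: "a \<noteq> b"
  obtains \<theta> d where "real_quadratic (\<sigma> a) (\<sigma> b) \<theta> d"
proof -
  let ?sc = "\<lambda>(q::rat) (x::'k). of_rat q * x"
  interpret V: vector_space ?sc
    by standard (simp_all add: of_rat_add of_rat_mult algebra_simps)
  have dim: "V.dim UNIV = 2" using K by (simp add: real_quadratic_field_def)
  obtain B where B: "V.independent B" "UNIV \<subseteq> V.span B" "card B = V.dim UNIV"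
    by (rule V.basis_exists[of UNIV])
  obtain u v where "B = {u, v}" using B(3) dim by (auto simp: card_2_iff)
  then have uv: "\<exists>p q. x = of_rat p * u + of_rat q * v" for x
  proof -
    have "x \<in> V.span {u, v}" using B(2) \<open>B = {u, v}\<close> by auto
    then obtain p q where "x - of_rat p * u = of_rat q * v"
      unfolding V.span_insert V.span_empty by auto
    then have "x = of_rat p * u + of_rat q * v" by (simp add: algebra_simps)
    then show ?thesis by blast
  qed
  have "\<exists>v::'k. \<forall>x. \<exists>p q. x = of_rat p + of_rat q * v"
  proof -
    obtain p q where pq: "1 = of_rat p * u + of_rat q * v" using uv by blast
    have swap: "\<exists>v::'k. \<forall>x. \<exists>p q. x = of_rat p + of_rat q * v"
      if "1 = of_rat p * u + of_rat q * v" "p \<noteq> 0" and repr: "\<And>x. \<exists>p q. x = of_rat p * u + of_rat q * v"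
      for p q and u v :: 'k
    proof (rule exI[of _ v], rule allI)
      fix x :: 'k
      obtain p' q' where x: "x = of_rat p' * u + of_rat q' * v" using repr by blast
      have u: "u = 1 / of_rat p - of_rat q / of_rat p * v" using that(1,2) by (simp add: field_simps)
      have "x = of_rat p' / of_rat p + (of_rat q' - of_rat p' * of_rat q / of_rat p) * v"
        unfolding x by (subst u) (simp add: algebra_simps)
      then have "x = of_rat (p' / p) + of_rat (q' - p' * q / p) * v"
        by (simp add: of_rat_divide of_rat_diff of_rat_mult)
      then show "\<exists>p q. x = of_rat p + of_rat q * v" by blast
    qed
    have "p \<noteq> 0 \<or> q \<noteq> 0" using pq by auto
    then show ?thesis
    proof
      assume "p \<noteq> 0"
      then show ?thesis using swap pq uv by blast
    next
      assume "q \<noteq> 0"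
      moreover have "1 = of_rat q * v + of_rat p * u" using pq by (simp only: add.commute)
      moreover have "\<exists>p q. x = of_rat p * v + of_rat q * u" for x using uv[of x] by (metis add.commute)
      ultimately show ?thesis using swap by blast
    qed
  qed
  then obtain w :: 'k where w: "\<And>x. \<exists>p q. x = of_rat p + of_rat q * w" by blast
  obtain p q where ww: "w * w = of_rat p + of_rat q * w" using w by blast
  obtain m k where mk: "p + q * q / 4 = of_int m / of_int k" "k > 0"
    by (metis quotient_of_div quotient_of_denom_pos surj_pair)
  define \<theta> where "\<theta> = of_int k * (w - of_rat (q / 2))"
  \<comment> \<open>\<theta> is k times an element whose square is m / k.\<close>
  define d where "d = m * k"
  have "(w - of_rat (q / 2)) * (w - of_rat (q / 2)) = w * w - of_rat q * w + of_rat (q * q / 4)"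
    by (simp add: algebra_simps of_rat_mult of_rat_divide)
  also have "\<dots> = of_rat (p + q * q / 4)" by (simp add: ww of_rat_add)
  finally have "\<theta> * \<theta> = of_int k * of_int k * of_rat (of_int m / of_int k)"
    by (simp add: \<theta>_def mk(1)[symmetric] mult_ac)
  also have "\<dots> = of_int d" using mk(2) by (simp add: d_def of_rat_divide)
  finally have sq: "\<theta> * \<theta> = of_int d" .
  have gen: "\<exists>p q. x = of_rat p + of_rat q * \<theta>" for x
  proof -
    obtain p' q' where x: "x = of_rat p' + of_rat q' * w" using w by blast
    have "w = \<theta> / of_int k + of_rat (q / 2)" using mk(2) by (simp add: \<theta>_def)
    then have "x = of_rat p' + of_rat q' * (\<theta> / of_int k + of_rat (q / 2))" by (simp only: x)
    then have "x = of_rat (p' + q' * (q / 2)) + of_rat (q' / of_int k) * \<theta>"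
      by (simp add: of_rat_add of_rat_mult of_rat_divide distrib_left)
    then show ?thesis by blast
  qed
  have emb: "field_embedding (\<sigma> s)" for s
    using S by (auto simp: bij_betw_def real_embeddings_def)
  interpret e1: field_emb "\<sigma> a" using emb by unfold_locales
  interpret e2: field_emb "\<sigma> b" using emb by unfold_locales
  have neq: "\<sigma> a \<noteq> \<sigma> b" using S ab by (auto simp: bij_betw_def inj_def)
  have neq': "\<sigma> a \<theta> \<noteq> \<sigma> b \<theta>"
  proof
    assume eq: "\<sigma> a \<theta> = \<sigma> b \<theta>"
    have "\<sigma> a x = \<sigma> b x" for x
    proof -
      obtain p q where "x = of_rat p + of_rat q * \<theta>" using gen by blast
      then show ?thesis by (simp add: eq)
    qed
    with neq show False by auto
  qed
  have "\<sigma> a \<theta> * \<sigma> a \<theta> = of_int d" "\<sigma> b \<theta> * \<sigma> b \<theta> = of_int d"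
    by (metis e1.f_mult e1.f_of_int sq) (metis e2.f_mult e2.f_of_int sq)
  then have "\<sigma> a \<theta> = \<sigma> b \<theta> \<or> \<sigma> a \<theta> = - \<sigma> b \<theta>" by (metis square_eq_iff)
  then have "\<sigma> b \<theta> = - \<sigma> a \<theta>" using neq' by auto
  moreover from this have "\<sigma> a \<theta> \<noteq> 0" using neq' by auto
  ultimately have "real_quadratic (\<sigma> a) (\<sigma> b) \<theta> d"
    using gen sq by unfold_locales auto
  then show ?thesis by (rule that)
qed

section \<open>Schmidt games on the unit interval\<close>

text \<open>The half of the ball that points to the farther endpoint of [0, 1] is not cut off, as
  \<rho> is at most 1/2.\<close>

lemma interval_in_ball:
  fixes x \<rho> :: real
  assumes "x \<in> {0..1}" "0 < \<rho>" "\<rho> \<le> 1/2"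
  obtains l where "{l..l + \<rho>} \<subseteq> ball_in {0..1} x \<rho>"
proof (cases "x \<le> 1/2")
  case True
  then show ?thesis using assms by (intro that[of x]) (auto simp: ball_in_def dist_real_def)
next
  case False
  then show ?thesis using assms by (intro that[of "x - \<rho>"]) (auto simp: ball_in_def dist_real_def)
qed

text \<open>Two balls of radius \<rho> / 8 sit at the two ends of an interval of length \<rho>, with
  a gap of \<rho> / 2 between them; a set whose points are closer than this gap misses one of them.
  This is the origin of \<alpha> = 1/8.\<close>

lemma ball_in_avoiding_small_set:
  fixes x \<rho> :: real
  assumes x: "x \<in> {0..1}" and \<rho>: "0 < \<rho>" "\<rho> \<le> 1/2"
    and T: "\<And>u v. u \<in> T \<inter> ball_in {0..1} x \<rho> \<Longrightarrow> v \<in> T \<inter> ball_in {0..1} x \<rho> \<Longrightarrow> \<bar>u - v\<bar> < \<rho> / 2"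
  shows "\<exists>y\<in>{0..1}. ball_in {0..1} y (\<rho> / 8) \<subseteq> ball_in {0..1} x \<rho> \<and> ball_in {0..1} y (\<rho> / 8) \<inter> T = {}"
proof -
  obtain l where l: "{l..l + \<rho>} \<subseteq> ball_in {0..1} x \<rho>" using interval_in_ball[OF x \<rho>] .
  have sub: "{l..l + \<rho>} \<subseteq> {0..1}" using l by (auto simp: ball_in_def)
  define y where "y = (\<lambda>i::bool. if i then l + \<rho> / 8 else l + 7 * \<rho> / 8)"
  have y01: "y i \<in> {0..1}" for i
    by (rule subsetD[OF sub]) (use \<rho> in \<open>auto simp: y_def\<close>)
  have ysub: "ball_in {0..1} (y i) (\<rho> / 8) \<subseteq> {l..l + \<rho>}" for i
  proof
    fix x assume "x \<in> ball_in {0..1} (y i) (\<rho> / 8)"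
    then have "y i - x \<le> \<rho> / 8" "x - y i \<le> \<rho> / 8"
      unfolding ball_in_def Int_iff mem_cball dist_real_def by linarith+
    then show "x \<in> {l..l + \<rho>}" using \<rho>(1) unfolding y_def atLeastAtMost_iff by (cases i; simp; linarith)
  qed
  have "\<exists>i. ball_in {0..1} (y i) (\<rho> / 8) \<inter> T = {}"
  proof (rule ccontr)
    assume "\<not> ?thesis"
    then obtain u v where u: "u \<in> ball_in {0..1} (y True) (\<rho> / 8) \<inter> T"
      and v: "v \<in> ball_in {0..1} (y False) (\<rho> / 8) \<inter> T" by blast
    have "\<bar>u - v\<bar> < \<rho> / 2"
      using u v ysub l by (intro T) blast+
    moreover have "u \<le> l + \<rho> / 4" "v \<ge> l + 3 * \<rho> / 4"
      using u v unfolding y_def ball_in_def Int_iff mem_cball dist_real_def if_True if_False by linarith+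
    ultimately show False using \<rho> by linarith
  qed
  then show ?thesis using y01 ysub l by blast
qed

text \<open>The default \<open>x\<close> keeps the move legal whatever \<open>T\<close> is, so that
  Player B obeys the rules even where no avoidance is possible, for instance in balls of large
  radius.\<close>

definition avoiding_move :: "real set \<Rightarrow> real \<Rightarrow> real \<Rightarrow> real" where
  "avoiding_move T \<rho> x =
     (if \<exists>y\<in>{0..1}. ball_in {0..1} y (\<rho> / 8) \<subseteq> ball_in {0..1} x \<rho> \<and> ball_in {0..1} y (\<rho> / 8) \<inter> T = {}
      then SOME y. y \<in> {0..1} \<and> ball_in {0..1} y (\<rho> / 8) \<subseteq> ball_in {0..1} x \<rho> \<and>
        ball_in {0..1} y (\<rho> / 8) \<inter> T = {}
      else x)"

lemma avoiding_move_legal: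
  assumes "x \<in> {0..1}" "\<rho> > 0"
  shows "avoiding_move T \<rho> x \<in> {0..1}"
    "ball_in {0..1} (avoiding_move T \<rho> x) (\<rho> / 8) \<subseteq> ball_in {0..1} x \<rho>"
proof -
  have *: "ball_in {0..1} x (\<rho> / 8) \<subseteq> ball_in {0..1} x \<rho>"
    using assms by (auto simp: ball_in_def)
  have "avoiding_move T \<rho> x \<in> {0..1} \<and>
    ball_in {0..1} (avoiding_move T \<rho> x) (\<rho> / 8) \<subseteq> ball_in {0..1} x \<rho>"
  proof (cases "\<exists>y. y \<in> {0..1} \<and> ball_in {0..1} y (\<rho> / 8) \<subseteq> ball_in {0..1} x \<rho> \<and> ball_in {0..1} y (\<rho> / 8) \<inter> T = {}")
    case True
    show ?thesis using someI_ex[OF True] True unfolding avoiding_move_def by auto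
  next
    case False
    then show ?thesis using * assms unfolding avoiding_move_def by auto
  qed
  then show "avoiding_move T \<rho> x \<in> {0..1}"
    "ball_in {0..1} (avoiding_move T \<rho> x) (\<rho> / 8) \<subseteq> ball_in {0..1} x \<rho>" by auto
qed

lemma avoiding_move_avoids:
  fixes x \<rho> :: real
  assumes "x \<in> {0..1}" "0 < \<rho>" "\<rho> \<le> 1/2"
    and "\<And>u v. u \<in> T \<inter> ball_in {0..1} x \<rho> \<Longrightarrow> v \<in> T \<inter> ball_in {0..1} x \<rho> \<Longrightarrow> \<bar>u - v\<bar> < \<rho> / 2"
  shows "ball_in {0..1} (avoiding_move T \<rho> x) (\<rho> / 8) \<inter> T = {}"
proof -
  have ex: "\<exists>y. y \<in> {0..1} \<and> ball_in {0..1} y (\<rho> / 8) \<subseteq> ball_in {0..1} x \<rho> \<and> ball_in {0..1} y (\<rho> / 8) \<inter> T = {}"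
    using ball_in_avoiding_small_set[OF assms] by blast
  show ?thesis using someI_ex[OF ex] ex unfolding avoiding_move_def by auto
qed

lemma Inter_ball_A_singleton:
  fixes x :: "nat \<Rightarrow> real"
  assumes q: "0 < \<alpha> * \<beta>" "\<alpha> * \<beta> < 1" and \<rho>: "\<rho> > 0"
    and dec: "\<And>n. ball_A {0..1} \<alpha> \<beta> \<rho> x (Suc n) \<subseteq> ball_A {0..1} \<alpha> \<beta> \<rho> x n"
    and x: "\<And>n. x n \<in> {0..1}"
  shows "\<exists>z. (\<Inter>n. ball_A {0..1} \<alpha> \<beta> \<rho> x n) = {z}"
proof -
  let ?A = "ball_A {0..1} \<alpha> \<beta> \<rho> x"
  have "decseq ?A" using dec by (rule decseq_SucI)
  have mem: "x n \<in> ?A n" for n using x[of n] q \<rho> by (simp add: ball_A_def ball_in_def)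
  have "(\<Inter>n. ?A n) \<noteq> {}"
  proof (rule compact_nest)
    show "compact (?A n)" for n
      unfolding ball_A_def ball_in_def by (intro closed_Int_compact compact_cball closed_atLeastAtMost)
    show "?A n \<noteq> {}" for n using mem by blast
    show "?A n \<subseteq> ?A m" if "m \<le> n" for m n using \<open>decseq ?A\<close> that by (rule decseqD)
  qed
  then obtain z where z: "z \<in> (\<Inter>n. ?A n)" by blast
  have "w = z" if w: "w \<in> (\<Inter>n. ?A n)" for w
  proof (rule ccontr)
    assume "w \<noteq> z"
    have "(\<lambda>n. 2 * ((\<alpha> * \<beta>) ^ n * \<rho>)) \<longlonglongrightarrow> 2 * (0 * \<rho>)"
      using q by (intro tendsto_intros LIMSEQ_power_zero) auto
    then have "(\<lambda>n. 2 * ((\<alpha> * \<beta>) ^ n * \<rho>)) \<longlonglongrightarrow> 0" by simp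
    then have "\<forall>\<^sub>F n in sequentially. 2 * ((\<alpha> * \<beta>) ^ n * \<rho>) < \<bar>w - z\<bar>"
      by (rule order_tendstoD) (use \<open>w \<noteq> z\<close> in simp)
    then obtain n where n: "2 * ((\<alpha> * \<beta>) ^ n * \<rho>) < \<bar>w - z\<bar>"
      by (auto simp: eventually_sequentially)
    have "w \<in> ?A n" "z \<in> ?A n" using w z by blast+
    then show False using n by (auto simp: ball_A_def ball_in_def dist_real_def)
  qed
  then show ?thesis using z by blast
qed

text \<open>The interface between game and flow: q is the ratio of consecutive radii of A, and
  \<open>Bad j\<close> is to be dodged when the radius is \<rho>0 * q ^ j. Shortness is asked only
  inside the first ball, because the constants depend on that ball, and only relative to the current
  ball, in the form that \<open>avoiding_move_avoids\<close> consumes.\<close>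

definition avoidable_family :: "real set \<Rightarrow> real \<Rightarrow> real \<Rightarrow> real \<Rightarrow> (nat \<Rightarrow> real set) \<Rightarrow> bool" where
  "avoidable_family W x0 \<rho>0 q Bad \<longleftrightarrow>
     (\<forall>j x u v. x \<in> {0..1} \<longrightarrow> ball_in {0..1} x (\<rho>0 * q ^ j) \<subseteq> ball_in {0..1} x0 \<rho>0 \<longrightarrow>
        u \<in> Bad j \<inter> ball_in {0..1} x (\<rho>0 * q ^ j) \<longrightarrow> v \<in> Bad j \<inter> ball_in {0..1} x (\<rho>0 * q ^ j) \<longrightarrow>
        \<bar>u - v\<bar> < \<rho>0 * q ^ j / 2) \<and>
     (\<forall>z \<in> ball_in {0..1} x0 \<rho>0. (\<forall>j. z \<notin> Bad j) \<longrightarrow> z \<in> W)"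

text \<open>The opening has a length depending only on \<rho>: B idles until the radius is at most
  1/2, then spends one move on each point of Z, a singleton being trivially avoidable. The ball that
  A plays next misses Z, and \<open>bad\<close> is applied to that ball, so the bad sets may depend
  on it.\<close>

lemma winning_by_avoidance:
  fixes W :: "real set"
  assumes Z: "finite Z" and \<beta>: "0 < \<beta>" "\<beta> < 1"
    and bad: "\<And>x0 \<rho>0. x0 \<in> {0..1} \<Longrightarrow> \<rho>0 > 0 \<Longrightarrow> ball_in {0..1} x0 \<rho>0 \<inter> Z = {} \<Longrightarrow>
      \<exists>Bad. avoidable_family W x0 \<rho>0 (1/8 * \<beta>) Bad"
  shows "alpha_beta_winning {0..1} W (1/8) \<beta>"
proof -
  define q where "q = 1/8 * \<beta>"
  have q: "0 < q" "q < 1" using \<beta> by (auto simp: q_def)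
  define BD where "BD = (\<lambda>x0 \<rho>0. SOME Bad. avoidable_family W x0 \<rho>0 q Bad)"
  have BD: "avoidable_family W x0 \<rho>0 q (BD x0 \<rho>0)"
    if "x0 \<in> {0..1}" "\<rho>0 > 0" "ball_in {0..1} x0 \<rho>0 \<inter> Z = {}" for x0 \<rho>0
    unfolding BD_def q_def by (rule someI_ex[OF bad[OF that]])
  obtain zs where zs: "set zs = Z" using finite_list[OF Z] by blast
  define N1 where "N1 = (\<lambda>\<rho>. LEAST n. q ^ n * \<rho> \<le> 1/2)"
  define N2 where "N2 = (\<lambda>\<rho>. N1 \<rho> + length zs)"
  \<comment> \<open>The number of the current move is the length of the history minus 1. From move
    N2 on, the family belongs to the ball of A at move N2, whose centre is read off the history as
    \<open>xs ! N2 \<rho>\<close>.\<close>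
  define T where "T = (\<lambda>\<rho> xs. let n = length xs - 1 in
     if n < N1 \<rho> then {} else if n < N2 \<rho> then {zs ! (n - N1 \<rho>)}
     else BD (xs ! N2 \<rho>) (q ^ N2 \<rho> * \<rho>) (n - N2 \<rho>))"
  define f where "f = (\<lambda>\<rho> xs. avoiding_move (T \<rho> xs) (q ^ (length xs - 1) * \<rho>) (last xs))"
  have "winning_strategy {0..1} W (1/8) \<beta> f"
    unfolding winning_strategy_def
  proof (intro allI impI conjI)
    fix \<rho> :: real and x :: "nat \<Rightarrow> real" assume \<rho>: "\<rho> > 0"
    define r where "r = (\<lambda>n. q ^ n * \<rho>)"
    have r_pos: "r n > 0" for n using q \<rho> by (simp add: r_def)
    have A_eq: "ball_A {0..1} (1/8) \<beta> \<rho> x n = ball_in {0..1} (x n) (r n)" for n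
      by (simp add: ball_A_def r_def q_def)
    have B_eq: "ball_B {0..1} (1/8) \<beta> f \<rho> x n = ball_in {0..1} (centre_B f \<rho> x n) (r n / 8)" for n
      by (simp add: ball_B_def r_def q_def)
    define hist where "hist = (\<lambda>n. map x [0..<Suc n])"
    have centre: "centre_B f \<rho> x n = avoiding_move (T \<rho> (hist n)) (r n) (x n)" for n
      by (simp add: centre_B_def f_def hist_def r_def)
    have legal: "legal_B {0..1} (1/8) \<beta> f \<rho> x n" if "x n \<in> {0..1}" for n
      unfolding legal_B_def A_eq B_eq centre using avoiding_move_legal[OF that r_pos] by blast
    {
      fix n assume "\<forall>k\<le>n. legal_A {0..1} (1/8) \<beta> f \<rho> x k"
      then show "legal_B {0..1} (1/8) \<beta> f \<rho> x n" by (intro legal) (auto simp: legal_A_def)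
    next
      assume A: "\<forall>n. legal_A {0..1} (1/8) \<beta> f \<rho> x n"
      then have x: "x n \<in> {0..1}" for n by (simp add: legal_A_def)
      have AB: "ball_A {0..1} (1/8) \<beta> \<rho> x (Suc n) \<subseteq> ball_B {0..1} (1/8) \<beta> f \<rho> x n" for n
        using A[rule_format, of "Suc n"] by (simp add: legal_A_def)
      have BA: "ball_B {0..1} (1/8) \<beta> f \<rho> x n \<subseteq> ball_A {0..1} (1/8) \<beta> \<rho> x n" for n
        using legal[OF x] by (simp add: legal_B_def)
      have dec: "ball_A {0..1} (1/8) \<beta> \<rho> x (Suc n) \<subseteq> ball_A {0..1} (1/8) \<beta> \<rho> x n" for n
        using AB BA by blast
      obtain z where z: "(\<Inter>n. ball_A {0..1} (1/8) \<beta> \<rho> x n) = {z}"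
        using Inter_ball_A_singleton[of "1/8" \<beta> \<rho> x, OF _ _ \<rho> dec x] \<beta> by auto
      have zB: "z \<in> ball_in {0..1} (centre_B f \<rho> x n) (r n / 8)" for n
        using z AB[of n] unfolding B_eq by blast
      have dec': "ball_in {0..1} (x n) (r n) \<subseteq> ball_in {0..1} (x m) (r m)" if "m \<le> n" for m n
        using decseqD[OF decseq_SucI[of "ball_A {0..1} (1/8) \<beta> \<rho> x", OF dec] that] unfolding A_eq .
      have "\<exists>n. r n \<le> 1/2"
      proof -
        have "r \<longlonglongrightarrow> 0 * \<rho>" unfolding r_def using q by (intro tendsto_intros LIMSEQ_power_zero) auto
        then have "\<forall>\<^sub>F n in sequentially. r n < 1/2" by (rule order_tendstoD) simp
        then show ?thesis by (auto simp: eventually_sequentially intro: less_imp_le)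
      qed
      then have "r (N1 \<rho>) \<le> 1/2" unfolding r_def N1_def by (rule LeastI_ex)
      moreover have "r n \<le> r (N1 \<rho>)" if "n \<ge> N1 \<rho>" for n
        unfolding r_def using q \<rho> that by (intro mult_right_mono power_decreasing) auto
      ultimately have small: "r n \<le> 1/2" if "n \<ge> N1 \<rho>" for n using that by force
      have avoid: "ball_in {0..1} (x (Suc n)) (r (Suc n)) \<inter> T \<rho> (hist n) = {}"
        and avoid_z: "z \<notin> T \<rho> (hist n)"
        if "n \<ge> N1 \<rho>"
          "\<And>u v. u \<in> T \<rho> (hist n) \<inter> ball_in {0..1} (x n) (r n) \<Longrightarrow>
             v \<in> T \<rho> (hist n) \<inter> ball_in {0..1} (x n) (r n) \<Longrightarrow> \<bar>u - v\<bar> < r n / 2" for n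
        using avoiding_move_avoids[OF x r_pos small[OF that(1)] that(2)] AB[of n] zB[of n]
        unfolding A_eq B_eq centre by blast+
      define N where "N = N2 \<rho>"
      have noZ: "ball_in {0..1} (x N) (r N) \<inter> Z = {}"
      proof -
        have "ball_in {0..1} (x N) (r N) \<inter> {zs ! i} = {}" if i: "i < length zs" for i
        proof -
          let ?n = "N1 \<rho> + i"
          have T: "T \<rho> (hist ?n) = {zs ! i}" using i by (simp add: T_def hist_def N2_def)
          have "ball_in {0..1} (x (Suc ?n)) (r (Suc ?n)) \<inter> T \<rho> (hist ?n) = {}"
            by (rule avoid) (auto simp: T r_pos)
          moreover have "ball_in {0..1} (x N) (r N) \<subseteq> ball_in {0..1} (x (Suc ?n)) (r (Suc ?n))"
            using i by (intro dec') (simp add: N_def N2_def)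
          ultimately show ?thesis unfolding T by blast
        qed
        then show ?thesis unfolding zs[symmetric] by (auto simp: in_set_conv_nth)
      qed
      have r_add: "r N * q ^ j = r (N + j)" for j by (simp add: r_def power_add)
      have P: "avoidable_family W (x N) (r N) q (BD (x N) (r N))" by (rule BD[OF x r_pos noZ])
      have "z \<notin> BD (x N) (r N) j" for j
      proof -
        have T: "T \<rho> (hist (N + j)) = BD (x N) (r N) j"
          by (simp add: T_def hist_def N_def N2_def r_def nth_append del: upt_Suc)
        have "z \<notin> T \<rho> (hist (N + j))"
        proof (rule avoid_z)
          show "N1 \<rho> \<le> N + j" by (simp add: N_def N2_def)
          have "ball_in {0..1} (x (N + j)) (r (N + j)) \<subseteq> ball_in {0..1} (x N) (r N)"
            by (rule dec') simp
          then show "\<bar>u - v\<bar> < r (N + j) / 2"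
            if "u \<in> T \<rho> (hist (N + j)) \<inter> ball_in {0..1} (x (N + j)) (r (N + j))"
              "v \<in> T \<rho> (hist (N + j)) \<inter> ball_in {0..1} (x (N + j)) (r (N + j))" for u v
            using that P x[of "N + j"] unfolding T avoidable_family_def r_add by blast
        qed
        then show ?thesis by (simp add: T)
      qed
      moreover have "z \<in> ball_in {0..1} (x N) (r N)" using z unfolding A_eq by blast
      ultimately have "z \<in> W" using P unfolding avoidable_family_def by blast
      then show "\<exists>z\<in>W. (\<Inter>n. ball_A {0..1} (1/8) \<beta> \<rho> x n) = {z}" using z by blast
    }
  qed
  then show ?thesis unfolding alpha_beta_winning_def by blast
qed

section \<open>Hausdorff dimension of winning sets\<close>

lemma tendsto_powr_neg_nat:
  fixes e :: real assumes "e < 0"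
  shows "(\<lambda>n. real n powr e) \<longlonglongrightarrow> 0"
  using tendsto_neg_powr[OF assms filterlim_real_sequentially] .

text \<open>A cover by N intervals of length 1 / N has weight N^(1 - s), which tends to 0; it is
  admissible as soon as 1 / N is at most \<delta>.\<close>

lemma hausdorff_measure_unit_interval:
  fixes W :: "real set"
  assumes W: "W \<subseteq> {0..1}" and s: "s > 1"
  shows "hausdorff_measure s W = 0"
proof -
  have "hausdorff_premeasure s \<delta> W \<le> 0" if \<delta>: "\<delta> > 0" for \<delta>
  proof (rule tendsto_lowerbound)
    have "(\<lambda>N. real N powr (1 - s)) \<longlonglongrightarrow> 0" by (rule tendsto_powr_neg_nat) (use s in simp)
    from tendsto_ennrealI[OF this]
    show "(\<lambda>N. ennreal (real N powr (1 - s))) \<longlonglongrightarrow> 0" by simp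
    have "hausdorff_premeasure s \<delta> W \<le> ennreal (real N powr (1 - s))" if N: "N \<ge> nat \<lceil>1 / \<delta>\<rceil> + 1" for N
    proof -
      define U where "U = (\<lambda>i. if i < N then {real i / real N..real (i + 1) / real N} else {})"
      have N0: "N > 0" using N by simp
      have "1 / \<delta> \<le> real N" using N by linarith
      then have N\<delta>: "1 / real N \<le> \<delta>" using N0 \<delta> by (simp add: field_simps)
      have diam: "diameter (U i) = 1 / real N" if "i < N" for i
      proof -
        have "real i / real N \<le> real (i + 1) / real N" by (intro divide_right_mono) auto
        then show ?thesis using that by (simp add: U_def diameter_closed_interval diff_divide_distrib[symmetric])
      qed
      have cover: "W \<subseteq> (\<Union>i. U i)"
      proof
        fix x assume "x \<in> W"
        then have x: "0 \<le> x" "x \<le> 1" using W by auto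
        define i where "i = (if x = 1 then N - 1 else nat \<lfloor>x * real N\<rfloor>)"
        have "i < N \<and> real i \<le> x * real N \<and> x * real N \<le> real (i + 1)"
        proof (cases "x = 1")
          case True
          then show ?thesis using N0 by (simp add: i_def)
        next
          case False
          then have "x * real N < real N" using x N0 by simp
          moreover have "0 \<le> x * real N" using x by simp
          ultimately have "nat \<lfloor>x * real N\<rfloor> < N \<and> real (nat \<lfloor>x * real N\<rfloor>) \<le> x * real N \<and>
              x * real N \<le> real (nat \<lfloor>x * real N\<rfloor> + 1)" by linarith
          then show ?thesis using False by (simp only: i_def if_False)
        qed
        then have "x \<in> U i" using N0 by (simp add: U_def field_simps)
        then show "x \<in> (\<Union>i. U i)" by blast
      qed
      have "hausdorff_premeasure s \<delta> W \<le> (\<Sum>i. diameter_power s (U i))"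
        unfolding hausdorff_premeasure_def
      proof (rule INF_lower, intro CollectI conjI allI cover)
        show "bounded (U i)" for i by (simp add: U_def)
        show "diameter (U i) \<le> \<delta>" for i
          using diam[of i] N\<delta> \<delta> by (cases "i < N") (simp_all add: U_def)
      qed
      also have "\<dots> = (\<Sum>i<N. diameter_power s (U i))"
        by (rule suminf_finite) (auto simp: U_def diameter_power_def)
      also have "\<dots> = (\<Sum>i<N. ennreal ((1 / real N) powr s))"
      proof (rule sum.cong)
        fix i assume i: "i \<in> {..<N}"
        then have "U i \<noteq> {}" using N0 by (simp add: U_def divide_right_mono)
        then show "diameter_power s (U i) = ennreal ((1 / real N) powr s)"
          using s i diam[of i] by (simp add: diameter_power_def)
      qed simp
      also have "\<dots> = ennreal (real N * (1 / real N) powr s)"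
        by (simp add: ennreal_mult ennreal_of_nat_eq_real_of_nat)
      also have "real N * (1 / real N) powr s = real N powr (1 - s)"
        using N0 by (simp add: powr_diff powr_divide)
      finally show ?thesis .
    qed
    then show "\<forall>\<^sub>F N in sequentially. hausdorff_premeasure s \<delta> W \<le> ennreal (real N powr (1 - s))"
      by (auto simp: eventually_sequentially)
  qed simp
  then show ?thesis by (simp add: hausdorff_measure_def)
qed

text \<open>Mass distribution with Lebesgue measure on [0, 1): the preimage under G of a covering
  set U lies in an interval of length 2 C diam(U)^s, and these intervals cover [0, 1). The preimage
  is enclosed in an interval, not measured itself, because G is an arbitrary choice function in the
  application.\<close>

lemma hausdorff_measure_pos:
  fixes W :: "real set" and G :: "real \<Rightarrow> real"
  assumes s: "0 \<le> s" and C: "C > 0"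
    and G: "\<And>y. y \<in> {0..<1} \<Longrightarrow> G y \<in> W"
    and holder: "\<And>y y'. y \<in> {0..<1} \<Longrightarrow> y' \<in> {0..<1} \<Longrightarrow> y \<noteq> y' \<Longrightarrow> \<bar>y - y'\<bar> \<le> C * \<bar>G y - G y'\<bar> powr s"
  shows "hausdorff_measure s W \<noteq> 0"
proof -
  have main: "ennreal (1 / (2 * C)) \<le> (\<Sum>i. diameter_power s (U i))"
    if cover: "W \<subseteq> (\<Union>i. U i)" and bdd: "\<And>i. bounded (U i)" for U :: "nat \<Rightarrow> real set"
  proof -
    define D where "D = (\<lambda>i. if U i = {} then 0 else if s = 0 then 1 else diameter (U i) powr s)"
    have D: "diameter_power s (U i) = ennreal (D i)" for i by (simp add: D_def diameter_power_def)
    have D0: "D i \<ge> 0" for i by (simp add: D_def)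
    have "\<exists>I. \<forall>i. I i \<in> sets lborel \<and> {y \<in> {0..<1}. G y \<in> U i} \<subseteq> I i \<and>
        emeasure lborel (I i) \<le> ennreal (2 * C) * ennreal (D i)"
    proof (rule choice, rule allI)
      fix i
      show "\<exists>I. I \<in> sets lborel \<and> {y \<in> {0..<1}. G y \<in> U i} \<subseteq> I \<and>
        emeasure lborel I \<le> ennreal (2 * C) * ennreal (D i)"
      proof (cases "\<exists>y. y \<in> {0..<1} \<and> G y \<in> U i")
        case True
        then obtain y0 where y0: "y0 \<in> {0..<1}" "G y0 \<in> U i" by blast
        have "y \<in> {y0 - C * D i..y0 + C * D i}" if y: "y \<in> {0..<1}" "G y \<in> U i" for y
        proof (cases "y = y0")
          case True
          then show ?thesis using C D0[of i] by simp
        next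
          case False
          have "\<bar>G y - G y0\<bar> powr s \<le> D i"
          proof (cases "s = 0")
            case True
            have "U i \<noteq> {}" using y by blast
            then show ?thesis using True by (simp add: D_def powr_def)
          next
            case False
            have "\<bar>G y - G y0\<bar> \<le> diameter (U i)"
              using diameter_bounded_bound[OF bdd y(2) y0(2)] by (simp add: dist_real_def)
            then have "\<bar>G y - G y0\<bar> powr s \<le> diameter (U i) powr s" using s by (intro powr_mono2) auto
            moreover have "U i \<noteq> {}" using y by blast
            ultimately show ?thesis using False by (simp add: D_def)
          qed
          then have "\<bar>y - y0\<bar> \<le> C * D i"
            by (intro order_trans[OF holder[OF y(1) y0(1) False]] mult_left_mono) (use C in auto)
          then show ?thesis unfolding atLeastAtMost_iff by linarith
        qed
        then have "{y \<in> {0..<1}. G y \<in> U i} \<subseteq> {y0 - C * D i..y0 + C * D i}" by blast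
        moreover have "emeasure lborel {y0 - C * D i..y0 + C * D i} = ennreal (2 * C) * ennreal (D i)"
        proof -
          have "y0 - C * D i \<le> y0 + C * D i" using C D0[of i] by simp
          then have "emeasure lborel {y0 - C * D i..y0 + C * D i} = ennreal (2 * C * D i)" by simp
          then show ?thesis using C D0[of i] by (simp only: ennreal_mult)
        qed
        moreover have "{y0 - C * D i..y0 + C * D i} \<in> sets lborel" by simp
        ultimately show ?thesis by (intro exI[of _ "{y0 - C * D i..y0 + C * D i}"]) simp
      next
        case False
        then have "{y \<in> {0..<1}. G y \<in> U i} = {}" by blast
        then show ?thesis by (intro exI[of _ "{}"]) simp
      qed
    qed
    then obtain I where I: "\<And>i. I i \<in> sets lborel" "\<And>i. {y \<in> {0..<1}. G y \<in> U i} \<subseteq> I i"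
      "\<And>i. emeasure lborel (I i) \<le> ennreal (2 * C) * ennreal (D i)" by blast
    have "(1::ennreal) = emeasure lborel {0..<1::real}" by simp
    also have "\<dots> \<le> emeasure lborel (\<Union>i. I i)"
    proof (rule emeasure_mono)
      show "{0..<1} \<subseteq> (\<Union>i. I i)"
      proof
        fix y :: real assume y: "y \<in> {0..<1}"
        then obtain i where "G y \<in> U i" using G cover by blast
        then show "y \<in> (\<Union>i. I i)" using I(2)[of i] y by blast
      qed
      show "(\<Union>i. I i) \<in> sets lborel" by (rule sets.countable_UN) (use I(1) in blast)
    qed
    also have "\<dots> \<le> (\<Sum>i. emeasure lborel (I i))"
      by (rule emeasure_subadditive_countably) (use I(1) in blast)
    also have "\<dots> \<le> (\<Sum>i. ennreal (2 * C) * ennreal (D i))"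
      by (intro suminf_le I summableI)
    also have "\<dots> = ennreal (2 * C) * (\<Sum>i. diameter_power s (U i))"
      by (simp add: D)
    finally have "ennreal (1 / (2 * C)) * 1 \<le> ennreal (1 / (2 * C)) * (ennreal (2 * C) * (\<Sum>i. diameter_power s (U i)))"
      by (intro mult_left_mono) auto
    also have "\<dots> = (\<Sum>i. diameter_power s (U i))"
    proof -
      have "ennreal (1 / (2 * C)) * ennreal (2 * C) = ennreal (1 / (2 * C) * (2 * C))"
        by (rule ennreal_mult[symmetric]) (use C in auto)
      also have "\<dots> = 1" using C by simp
      finally show ?thesis by (simp only: mult.assoc[symmetric] mult_1)
    qed
    finally show ?thesis by simp
  qed
  have "ennreal (1 / (2 * C)) \<le> hausdorff_premeasure s 1 W"
    unfolding hausdorff_premeasure_def by (intro INF_greatest main) auto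
  also have "\<dots> \<le> hausdorff_measure s W"
    unfolding hausdorff_measure_def by (intro SUP_upper) auto
  finally show ?thesis using C by (auto simp: ennreal_eq_0_iff)
qed

section \<open>Base-M digits and the tree of plays\<close>

lemma floor_power_digit:
  fixes y :: real and M :: nat
  assumes "M > 0"
  shows "\<lfloor>real M ^ Suc n * y\<rfloor> = int M * \<lfloor>real M ^ n * y\<rfloor> + \<lfloor>real M ^ Suc n * y\<rfloor> mod int M"
proof -
  have "real M ^ n * y = real M ^ Suc n * y / real_of_int (int M)" using assms by simp
  then have "\<lfloor>real M ^ n * y\<rfloor> = \<lfloor>real M ^ Suc n * y\<rfloor> div int M"
    by (simp only: floor_divide_real_eq_div[of "int M"] of_nat_0_le_iff)
  then show ?thesis by simp
qed

text \<open>Equality of the first n digits amounts to equal integer parts of M^n y and M^n y', hence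
  to distance at most M^(-n). Distinct points therefore have a first differing digit, and that is
  the n obtained.\<close>

lemma digit_separation:
  fixes y y' :: real and M :: nat
  assumes M: "M \<ge> 2" and y: "y \<in> {0..<1}" "y' \<in> {0..<1}" "y \<noteq> y'"
  defines "dig \<equiv> \<lambda>y n. nat (\<lfloor>real M ^ Suc n * y\<rfloor> mod int M)"
  obtains n where "\<And>k. k < n \<Longrightarrow> dig y k = dig y' k" "dig y n \<noteq> dig y' n" "\<bar>y - y'\<bar> \<le> (1 / real M) ^ n"
proof -
  have agree: "\<bar>y - y'\<bar> \<le> (1 / real M) ^ n" if "\<And>k. k < n \<Longrightarrow> dig y k = dig y' k" for n
  proof -
    have "\<lfloor>real M ^ n * y\<rfloor> = \<lfloor>real M ^ n * y'\<rfloor>" using that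
    proof (induction n)
      case 0
      have "\<lfloor>y\<rfloor> = 0" "\<lfloor>y'\<rfloor> = 0" using y by (auto simp: floor_eq_iff)
      then show ?case by simp
    next
      case (Suc n)
      have "\<lfloor>real M ^ Suc n * y\<rfloor> mod int M = \<lfloor>real M ^ Suc n * y'\<rfloor> mod int M"
        using Suc.prems[of n] M by (simp add: dig_def nat_eq_iff)
      moreover have "\<lfloor>real M ^ n * y\<rfloor> = \<lfloor>real M ^ n * y'\<rfloor>" using Suc by simp
      ultimately have "int M * \<lfloor>real M ^ n * y\<rfloor> + \<lfloor>real M ^ Suc n * y\<rfloor> mod int M =
          int M * \<lfloor>real M ^ n * y'\<rfloor> + \<lfloor>real M ^ Suc n * y'\<rfloor> mod int M" by (simp only:)
      then show ?case using floor_power_digit[of M n y] floor_power_digit[of M n y'] M by simp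
    qed
    then have "\<bar>real M ^ n * y - real M ^ n * y'\<bar> \<le> 1" by linarith
    moreover have "real M ^ n * \<bar>y - y'\<bar> = \<bar>real M ^ n * (y - y')\<bar>" by (simp add: abs_mult)
    ultimately have "\<bar>y - y'\<bar> * real M ^ n \<le> 1" by (simp only: right_diff_distrib mult.commute[of "\<bar>y - y'\<bar>"])
    then show ?thesis using M by (simp add: power_one_over pos_le_divide_eq)
  qed
  have "\<exists>n. dig y n \<noteq> dig y' n"
  proof (rule ccontr)
    assume "\<not> ?thesis"
    then have "\<bar>y - y'\<bar> \<le> (1 / real M) ^ n" for n by (intro agree) auto
    moreover have "(\<lambda>n. (1 / real M) ^ n) \<longlonglongrightarrow> 0" using M by (intro LIMSEQ_power_zero) auto
    ultimately have "\<bar>y - y'\<bar> \<le> 0" by (intro LIMSEQ_le_const[of _ 0]) blast+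
    with y show False by simp
  qed
  then have "dig y (LEAST n. dig y n \<noteq> dig y' n) \<noteq> dig y' (LEAST n. dig y n \<noteq> dig y' n)"
    by (rule LeastI_ex)
  moreover have "dig y k = dig y' k" if "k < (LEAST n. dig y n \<noteq> dig y' n)" for k
    using not_less_Least[OF that] by simp
  ultimately show ?thesis using that agree by blast
qed

text \<open>An interval of length r inside B's ball is cut into 4 M units, and child k is the ball
  of radius one unit about the mark 4 k + 2. Different children are then at least two units apart,
  and the radius corresponds to \<beta> = 1 / (4 M).\<close>

definition child_centre :: "nat \<Rightarrow> real \<Rightarrow> real \<Rightarrow> nat \<Rightarrow> real" where
  "child_centre M y r k = (if y \<le> 1/2 then y else y - r) + r * (4 * real k + 2) / (4 * real M)"

lemma child_ball:
  assumes "y \<in> {0..1}" "0 < r" "r \<le> 1/2" "k < M"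
  shows "child_centre M y r k \<in> {0..1}"
    "ball_in {0..1} (child_centre M y r k) (r / (4 * real M)) \<subseteq> ball_in {0..1} y r"
proof -
  define c where "c = child_centre M y r k"
  define l where "l = (if y \<le> 1/2 then y else y - r)"
  have M: "M > 0" "real k + 1 \<le> real M" using assms by auto
  have c: "c = l + r * (4 * real k + 2) / (4 * real M)"
    by (simp add: c_def child_centre_def l_def)
  have "r * 1 / (4 * real M) \<le> r * (4 * real k + 2) / (4 * real M)"
    using assms by (intro divide_right_mono mult_left_mono) auto
  then have lo: "l \<le> c - r / (4 * real M)" by (simp add: c)
  have "r * (4 * real k + 2) + r \<le> r * (4 * real M)"
    using M assms mult_left_mono[of "4 * real k + 3" "4 * real M" r] by (simp add: algebra_simps)
  then have "r * (4 * real k + 2) / (4 * real M) + r / (4 * real M) \<le> r"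
    using M assms by (simp add: field_simps)
  then have hi: "c + r / (4 * real M) \<le> l + r"
    by (simp add: c)
  have pos: "r / (4 * real M) > 0" using assms M by simp
  have l: "0 \<le> l" "l + r \<le> 1" "y - r \<le> l" "l \<le> y" using assms by (auto simp: l_def)
  show "child_centre M y r k \<in> {0..1}" using lo hi pos l unfolding c_def[symmetric] by simp
  show "ball_in {0..1} (child_centre M y r k) (r / (4 * real M)) \<subseteq> ball_in {0..1} y r"
    using lo hi pos l unfolding c_def[symmetric] by (auto simp: ball_in_def dist_real_def)
qed

lemma child_separation:
  assumes "r > 0" "M > 0" "k \<noteq> k'"
    and "z \<in> ball_in {0..1} (child_centre M y r k) (r / (4 * real M))"
    and "z' \<in> ball_in {0..1} (child_centre M y r k') (r / (4 * real M))"
  shows "\<bar>z - z'\<bar> \<ge> r / (4 * real M)"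
proof -
  define e where "e = r / (4 * real M)"
  have e: "e > 0" using assms by (simp add: e_def)
  have "child_centre M y r k - child_centre M y r k' = e * (4 * (real k - real k'))"
    by (simp add: child_centre_def e_def diff_divide_distrib[symmetric]) (simp add: algebra_simps)
  moreover have "\<bar>real k - real k'\<bar> \<ge> 1" using \<open>k \<noteq> k'\<close> by linarith
  ultimately have "\<bar>child_centre M y r k - child_centre M y r k'\<bar> \<ge> e * 4"
    using e by (simp add: abs_mult)
  then show ?thesis using assms(4,5) e unfolding e_def[symmetric] ball_in_def by (auto simp: dist_real_def)
qed

text \<open>The play is kept as a list because this is the form in which the strategy f receives it.
  A opens with centre 1/2 and radius 1/2, that is, with all of [0, 1], and then follows the digits
  \<open>a\<close>.\<close>

primrec history :: "(real \<Rightarrow> real list \<Rightarrow> real) \<Rightarrow> nat \<Rightarrow> real \<Rightarrow> real \<Rightarrow> (nat \<Rightarrow> nat) \<Rightarrow> nat \<Rightarrow> real list" where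
  "history f M \<alpha> q a 0 = [1/2]"
| "history f M \<alpha> q a (Suc n) = history f M \<alpha> q a n @
     [child_centre M (f (1/2) (history f M \<alpha> q a n)) (\<alpha> * q ^ n * (1/2)) (a n)]"

lemma length_history [simp]: "length (history f M \<alpha> q a n) = Suc n"
  by (induction n) auto

lemma history_eq_map:
  "history f M \<alpha> q a n = map (\<lambda>n. last (history f M \<alpha> q a n)) [0..<Suc n]"
proof (induction n)
  case (Suc n)
  have "map (\<lambda>n. last (history f M \<alpha> q a n)) [0..<Suc (Suc n)] =
      map (\<lambda>n. last (history f M \<alpha> q a n)) [0..<Suc n] @ [last (history f M \<alpha> q a (Suc n))]"
    by simp
  also have "\<dots> = history f M \<alpha> q a n @ [last (history f M \<alpha> q a (Suc n))]"
    by (simp only: Suc.IH[symmetric])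
  finally show ?case by simp
qed simp

lemma history_cong:
  "(\<And>k. k < n \<Longrightarrow> a k = b k) \<Longrightarrow> history f M \<alpha> q a n = history f M \<alpha> q b n"
  by (induction n) auto

text \<open>If n is the first position where the digits of y and y' differ, the two plays share
  their first n + 1 moves and then enter separated children, so the outcomes are at distance at
  least q^(n+1) / 2, while y and y' are at distance at most M^(-n).\<close>

lemma schmidt_winning_imp_hausdorff_measure_nonzero:
  assumes win: "schmidt_winning {0..1} W" and s: "0 \<le> s" "s < 1"
  shows "hausdorff_measure s (W :: real set) \<noteq> 0"
proof -
  obtain \<alpha> where \<alpha>: "0 < \<alpha>" "\<alpha> < 1" "alpha_winning {0..1} W \<alpha>"
    using win by (auto simp: schmidt_winning_def)
  \<comment> \<open>The condition is 1 / M <= q^s for q = \<alpha> / (4 M), as derived in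
    \<open>qs\<close>: with each digit, distances of y must shrink at least as fast as the s-th
    powers of distances of outcomes. It can be met because s < 1.\<close>
  obtain M :: nat where M: "M \<ge> 2" "(4 / \<alpha>) powr s \<le> real M powr (1 - s)"
  proof -
    have "(\<lambda>n. real n powr (s - 1)) \<longlonglongrightarrow> 0" by (rule tendsto_powr_neg_nat) (use s in simp)
    then have "\<forall>\<^sub>F n in sequentially. real n powr (s - 1) < inverse ((4 / \<alpha>) powr s)"
      by (rule order_tendstoD) (use \<alpha> in simp)
    then obtain N where N: "\<And>n. n \<ge> N \<Longrightarrow> real n powr (s - 1) < inverse ((4 / \<alpha>) powr s)"
      unfolding eventually_sequentially by blast
    define n where "n = max N 2"
    have "(4 / \<alpha>) powr s < inverse (real n powr (s - 1))"
    proof -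
      have "real n powr (s - 1) < inverse ((4 / \<alpha>) powr s)" by (rule N) (simp add: n_def)
      moreover have "0 < real n powr (s - 1)" by (simp add: n_def)
      ultimately have "inverse (inverse ((4 / \<alpha>) powr s)) < inverse (real n powr (s - 1))"
        by (rule less_imp_inverse_less)
      then show ?thesis by (simp only: inverse_inverse_eq)
    qed
    also have "\<dots> = real n powr (1 - s)" using powr_minus[of "real n" "s - 1"] by simp
    finally have "(4 / \<alpha>) powr s \<le> real n powr (1 - s)" by (rule less_imp_le)
    moreover have "n \<ge> 2" by (simp add: n_def)
    ultimately show ?thesis using that by blast
  qed
  define \<beta> where "\<beta> = 1 / (4 * real M)"
  define q where "q = \<alpha> * \<beta>"
  have \<beta>: "0 < \<beta>" "\<beta> < 1" using M by (auto simp: \<beta>_def)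
  have q: "0 < q" "q < 1" using \<alpha> \<beta> mult_strict_mono[of \<alpha> 1 \<beta> 1] by (auto simp: q_def)
  have qs: "1 / real M \<le> q powr s"
  proof -
    have "q = inverse (real M * (4 / \<alpha>))" by (simp add: q_def \<beta>_def field_simps)
    then have "q powr s = inverse ((real M * (4 / \<alpha>)) powr s)"
      by (simp only: inverse_powr)
    also have "(real M * (4 / \<alpha>)) powr s = real M powr s * (4 / \<alpha>) powr s"
      by (simp only: powr_mult)
    finally have "q powr s = inverse (real M powr s * (4 / \<alpha>) powr s)" .
    moreover have "real M powr s * (4 / \<alpha>) powr s \<le> real M powr s * real M powr (1 - s)"
      using M by (intro mult_left_mono) auto
    then have "real M powr s * (4 / \<alpha>) powr s \<le> real M" using M by (simp flip: powr_add)
    ultimately show ?thesis using M \<alpha> by (simp add: inverse_eq_divide frac_le)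
  qed
  obtain f where f: "winning_strategy {0..1} W \<alpha> \<beta> f"
    using \<alpha>(3) \<beta> by (auto simp: alpha_winning_def alpha_beta_winning_def)
  have fx: "(\<forall>n. (\<forall>k\<le>n. legal_A {0..1} \<alpha> \<beta> f (1/2) x k) \<longrightarrow> legal_B {0..1} \<alpha> \<beta> f (1/2) x n) \<and>
     ((\<forall>n. legal_A {0..1} \<alpha> \<beta> f (1/2) x n) \<longrightarrow> (\<exists>z\<in>W. (\<Inter>n. ball_A {0..1} \<alpha> \<beta> (1/2) x n) = {z}))" for x
    using f[unfolded winning_strategy_def, THEN spec[of _ "1/2"]] by simp
  define H where "H = history f M \<alpha> q"
  define x where "x = (\<lambda>a n. last (H a n))"
  define r where "r = (\<lambda>n. \<alpha> * q ^ n * (1/2))"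
  have r: "0 < r n" "r n \<le> 1/2" for n
    using \<alpha> q power_le_one[of q n] mult_le_one[of \<alpha> "q ^ n"] by (auto simp: r_def)
  have H_map: "H a n = map (x a) [0..<Suc n]" for a n
    unfolding x_def H_def by (rule history_eq_map)
  have centre: "centre_B f (1/2) (x a) n = f (1/2) (H a n)" for a n
    by (simp only: centre_B_def H_map)
  have x0: "x a 0 = 1/2" and xSuc: "x a (Suc n) = child_centre M (f (1/2) (H a n)) (r n) (a n)" for a n
    by (simp_all add: x_def H_def r_def)
  have A_Suc: "ball_A {0..1} \<alpha> \<beta> (1/2) (x a) (Suc n) =
      ball_in {0..1} (child_centre M (f (1/2) (H a n)) (r n) (a n)) (r n / (4 * real M))" for a n
    by (simp add: ball_A_def xSuc r_def q_def[symmetric]) (simp add: q_def \<beta>_def mult_ac)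
  have legal: "\<forall>k\<le>n. legal_A {0..1} \<alpha> \<beta> f (1/2) (x a) k" if a: "\<And>k. a k < M" for a n
  proof (induction n)
    case 0
    then show ?case by (simp add: legal_A_def x0)
  next
    case (Suc n)
    then have "legal_B {0..1} \<alpha> \<beta> f (1/2) (x a) n"
      using fx[of "x a"] by blast
    then have y: "f (1/2) (H a n) \<in> {0..1}" by (simp add: legal_B_def centre)
    have "legal_A {0..1} \<alpha> \<beta> f (1/2) (x a) (Suc n)"
      unfolding legal_A_def A_Suc
      using child_ball[OF y r a] by (auto simp: ball_B_def centre xSuc r_def q_def[symmetric])
    then show ?case using Suc by (auto simp: le_Suc_eq)
  qed
  have "\<exists>z\<in>W. \<forall>n. z \<in> ball_A {0..1} \<alpha> \<beta> (1/2) (x a) n" if "\<And>k. a k < M" for a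
  proof -
    have "legal_A {0..1} \<alpha> \<beta> f (1/2) (x a) n" for n using legal[of a n, OF that] by simp
    then have "\<exists>z\<in>W. (\<Inter>n. ball_A {0..1} \<alpha> \<beta> (1/2) (x a) n) = {z}"
      using fx[of "x a"] by blast
    then show ?thesis by blast
  qed
  then obtain z where z: "\<And>a. (\<And>k. a k < M) \<Longrightarrow> z a \<in> W"
      "\<And>a n. (\<And>k. a k < M) \<Longrightarrow> z a \<in> ball_A {0..1} \<alpha> \<beta> (1/2) (x a) n"
    by metis
  define dig where "dig = (\<lambda>(y::real) n. nat (\<lfloor>real M ^ Suc n * y\<rfloor> mod int M))"
  have dig: "dig y k < M" for y k using M by (simp add: dig_def nat_less_iff)
  \<comment> \<open>The factor M pays for the difference between n and n + 1 digits, and 2 powr s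
    for the initial radius 1/2.\<close>
  define C where "C = real M * 2 powr s"
  have C: "C > 0" using M by (simp add: C_def)
  show ?thesis
  proof (rule hausdorff_measure_pos[OF s(1) C, of "\<lambda>y. z (dig y)"])
    show "z (dig y) \<in> W" for y using z(1) dig by blast
    fix y y' :: real assume y: "y \<in> {0..<1}" "y' \<in> {0..<1}" "y \<noteq> y'"
    obtain n where n: "\<And>k. k < n \<Longrightarrow> dig y k = dig y' k" "dig y n \<noteq> dig y' n" "\<bar>y - y'\<bar> \<le> (1 / real M) ^ n"
      using digit_separation[OF M(1) y] unfolding dig_def by blast
    have H: "H (dig y) n = H (dig y') n" unfolding H_def by (rule history_cong) (rule n(1))
    have "\<bar>z (dig y) - z (dig y')\<bar> \<ge> r n / (4 * real M)"
    proof (rule child_separation[OF r(1) _ n(2)])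
      show "M > 0" using M by simp
      show "z (dig y) \<in> ball_in {0..1} (child_centre M (f (1/2) (H (dig y) n)) (r n) (dig y n)) (r n / (4 * real M))"
        using z(2)[of "dig y" "Suc n"] dig unfolding A_Suc by blast
      show "z (dig y') \<in> ball_in {0..1} (child_centre M (f (1/2) (H (dig y) n)) (r n) (dig y' n)) (r n / (4 * real M))"
        using z(2)[of "dig y'" "Suc n"] dig unfolding A_Suc H by blast
    qed
    also have "r n / (4 * real M) = q ^ Suc n / 2" by (simp add: r_def q_def \<beta>_def)
    finally have "(q ^ Suc n / 2) powr s \<le> \<bar>z (dig y) - z (dig y')\<bar> powr s"
      using q s by (intro powr_mono2) auto
    moreover have "(q ^ Suc n / 2) powr s = (q powr s) ^ Suc n / 2 powr s"
    proof -
      have "(q ^ Suc n) powr s = (q powr real (Suc n)) powr s" using q by (simp only: powr_realpow)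
      also have "\<dots> = (q powr s) powr real (Suc n)" by (simp only: powr_powr mult.commute)
      also have "\<dots> = (q powr s) ^ Suc n" using q by (intro powr_realpow) simp
      finally show ?thesis by (simp only: powr_divide)
    qed
    moreover have "(1 / real M) ^ Suc n / 2 powr s \<le> (q powr s) ^ Suc n / 2 powr s"
      using qs by (intro power_mono divide_right_mono) auto
    ultimately have "(1 / real M) ^ Suc n / 2 powr s \<le> \<bar>z (dig y) - z (dig y')\<bar> powr s"
      by linarith
    then have "C * ((1 / real M) ^ Suc n / 2 powr s) \<le> C * \<bar>z (dig y) - z (dig y')\<bar> powr s"
      using C by (intro mult_left_mono) auto
    moreover have "C * ((1 / real M) ^ Suc n / 2 powr s) = (1 / real M) ^ n"
      using M by (simp add: C_def)
    ultimately show "\<bar>y - y'\<bar> \<le> C * \<bar>z (dig y) - z (dig y')\<bar> powr s" using n(3) by linarith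
  qed
qed

theorem schmidt_winning_imp_hausdorff_dimension:
  fixes W :: "real set"
  assumes win: "schmidt_winning {0..1} W" and W: "W \<subseteq> {0..1}"
  shows "hausdorff_dimension W = 1"
proof (rule antisym)
  have "hausdorff_dimension W \<le> ennreal (1 + e)" if "e > 0" for e
    unfolding hausdorff_dimension_def
  proof (rule INF_lower, intro CollectI conjI)
    show "hausdorff_measure (1 + e) W = 0"
      by (rule hausdorff_measure_unit_interval[OF W]) (use that in linarith)
    show "0 \<le> 1 + e" using that by linarith
  qed
  then have "hausdorff_dimension W \<le> 1 + ennreal e" if "e > 0" for e
    using that ennreal_plus[of 1 e] by (metis ennreal_1 less_imp_le zero_le_one)
  then show "hausdorff_dimension W \<le> 1" by (rule ennreal_le_epsilon)
  show "1 \<le> hausdorff_dimension W"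
    unfolding hausdorff_dimension_def
  proof (rule INF_greatest)
    fix s assume s: "s \<in> {s. 0 \<le> s \<and> hausdorff_measure s W = 0}"
    have "1 \<le> s"
    proof (rule ccontr)
      assume "\<not> 1 \<le> s"
      then have "hausdorff_measure s W \<noteq> 0"
        by (intro schmidt_winning_imp_hausdorff_measure_nonzero[OF win]) (use s in auto)
      then show False using s by blast
    qed
    then show "1 \<le> ennreal s" by simp
  qed
qed

section \<open>Avoiding the cusp\<close>

text \<open>The sup norm of the row vector (A, B) after right multiplication by diag (exp (- r t),
  exp (r t)), which is one component of g(r)_t.\<close>

definition weighted_norm :: "real \<Rightarrow> real \<Rightarrow> real \<Rightarrow> real \<Rightarrow> real" where
  "weighted_norm r A B t = max (\<bar>A\<bar> * exp (- r * t)) (\<bar>B\<bar> * exp (r * t))"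

lemma weighted_norm_nonneg [simp]: "weighted_norm r A B t \<ge> 0"
  by (simp add: weighted_norm_def le_max_iff_disj)

lemma weighted_norm_bounds:
  "\<bar>A\<bar> * exp (- r * t) \<le> weighted_norm r A B t" "\<bar>B\<bar> * exp (r * t) \<le> weighted_norm r A B t"
  by (auto simp: weighted_norm_def)

lemma weighted_norm_decay:
  assumes "r \<ge> 0" "s \<ge> 0"
  shows "exp (- r * s) * weighted_norm r A B t \<le> weighted_norm r A B (t + s)"
proof -
  have e: "exp (- r * (t + s)) = exp (- r * s) * exp (- r * t)" "exp (r * (t + s)) = exp (r * s) * exp (r * t)"
    by (simp_all add: algebra_simps flip: exp_add)
  have "exp (- r * s) * (\<bar>A\<bar> * exp (- r * t)) \<le> weighted_norm r A B (t + s)"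
    using weighted_norm_bounds(1)[of A r "t + s" B] unfolding e by (simp add: mult_ac)
  moreover have "exp (- r * s) * (\<bar>B\<bar> * exp (r * t)) \<le> exp (r * s) * (\<bar>B\<bar> * exp (r * t))"
    using assms by (intro mult_right_mono) (auto simp: minus_le_iff)
  then have "exp (- r * s) * (\<bar>B\<bar> * exp (r * t)) \<le> weighted_norm r A B (t + s)"
    using weighted_norm_bounds(2)[of B r "t + s" A] unfolding e by (simp add: mult_ac)
  ultimately show ?thesis
    by (subst weighted_norm_def) (simp add: max_def)
qed

lemma weighted_norm_growth:
  assumes "\<bar>A\<bar> * exp (- r * t) \<le> \<bar>B\<bar> * exp (r * t)"
  shows "exp (r * s) * weighted_norm r A B t \<le> weighted_norm r A B (t + s)"
proof -
  have "weighted_norm r A B t = \<bar>B\<bar> * exp (r * t)" using assms by (simp add: weighted_norm_def)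
  moreover have "exp (r * (t + s)) = exp (r * s) * exp (r * t)"
    by (simp add: algebra_simps flip: exp_add)
  ultimately show ?thesis using weighted_norm_bounds(2)[of B r "t + s" A] by (simp add: mult_ac)
qed

text \<open>Passing to another point of the curve adds A * y to the second coordinate, where y is
  the increment of \<phi>. Under the flow this is y exp (2 r t) times the first coordinate, so norms
  at points within a multiple of exp (- 2 r t) of each other are comparable.\<close>

lemma weighted_norm_shear:
  assumes "\<bar>y\<bar> * exp (2 * r * t) \<le> \<kappa>" "\<kappa> \<ge> 0"
  shows "weighted_norm r A (B + A * y) t \<le> (1 + \<kappa>) * weighted_norm r A B t"
proof -
  let ?n = "weighted_norm r A B t"
  have e: "exp (2 * r * t) * exp (- r * t) = exp (r * t)" by (simp flip: exp_add)
  have "(\<bar>y\<bar> * exp (2 * r * t)) * (\<bar>A\<bar> * exp (- r * t)) = \<bar>A * y\<bar> * (exp (2 * r * t) * exp (- r * t))"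
    by (simp only: abs_mult mult_ac)
  moreover have "\<bar>B + A * y\<bar> * exp (r * t) \<le> (\<bar>B\<bar> + \<bar>A * y\<bar>) * exp (r * t)"
    by (intro mult_right_mono abs_triangle_ineq) auto
  ultimately have "\<bar>B + A * y\<bar> * exp (r * t) \<le> \<bar>B\<bar> * exp (r * t) + (\<bar>y\<bar> * exp (2 * r * t)) * (\<bar>A\<bar> * exp (- r * t))"
    by (simp only: e distrib_right)
  also have "\<dots> \<le> ?n + \<kappa> * ?n"
    using assms by (intro add_mono mult_mono weighted_norm_bounds) auto
  finally have "\<bar>B + A * y\<bar> * exp (r * t) \<le> (1 + \<kappa>) * ?n" by (simp add: distrib_right)
  moreover have "\<bar>A\<bar> * exp (- r * t) \<le> (1 + \<kappa>) * ?n"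
    using weighted_norm_bounds(1)[of A r t B] mult_nonneg_nonneg[OF assms(2), of ?n]
    by (simp add: distrib_right)
  ultimately show ?thesis by (subst weighted_norm_def) simp
qed

lemma det_le_weighted_norm:
  "\<bar>A * B' - B * A'\<bar> \<le> 2 * weighted_norm r A B t * weighted_norm r A' B' t"
proof -
  have e: "exp (- r * t) * exp (r * t) = 1" by (simp flip: exp_add)
  have "\<bar>A * B'\<bar> = (\<bar>A\<bar> * exp (- r * t)) * (\<bar>B'\<bar> * exp (r * t))"
    using e by (simp add: abs_mult mult_ac)
  also have "\<dots> \<le> weighted_norm r A B t * weighted_norm r A' B' t"
    by (intro mult_mono weighted_norm_bounds) auto
  finally have 1: "\<bar>A * B'\<bar> \<le> weighted_norm r A B t * weighted_norm r A' B' t" .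
  have "\<bar>B * A'\<bar> = (\<bar>B\<bar> * exp (r * t)) * (\<bar>A'\<bar> * exp (- r * t))"
    using e by (simp add: abs_mult mult_ac)
  also have "\<dots> \<le> weighted_norm r A B t * weighted_norm r A' B' t"
    by (intro mult_mono weighted_norm_bounds) auto
  finally show ?thesis using 1 by linarith
qed

text \<open>This isolates what the game needs from the number field. (A, D) is the row w g at each
  embedding, and index 1 is the embedding of larger weight. \<open>det\<close> is the gap in the
  values of the norm form; its vanishing alternative is recorded at index 1, where the slope D1 / A1
  will be compared. \<open>initial\<close> is uniform along the curve.\<close>

locale weighted_pair =
  fixes L :: "'w set" and A1 D1 A2 D2 :: "'w \<Rightarrow> real" and \<phi>1 \<phi>2 :: "real \<Rightarrow> real" and r1 r2 C c0 :: real
  assumes r: "r2 \<ge> 0" "r2 \<le> r1" "r1 + r2 = 1"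
    and C: "C \<ge> 0"
    and lip1: "\<And>x y. x \<in> {0..1} \<Longrightarrow> y \<in> {0..1} \<Longrightarrow> \<bar>\<phi>1 x - \<phi>1 y\<bar> \<le> C * \<bar>x - y\<bar>"
    and lip2: "\<And>x y. x \<in> {0..1} \<Longrightarrow> y \<in> {0..1} \<Longrightarrow> \<bar>\<phi>2 x - \<phi>2 y\<bar> \<le> C * \<bar>x - y\<bar>"
    and det: "\<And>w w'. w \<in> L \<Longrightarrow> w' \<in> L \<Longrightarrow> A1 w * D1 w' = D1 w * A1 w' \<or>
      \<bar>A1 w * D1 w' - D1 w * A1 w'\<bar> * \<bar>A2 w * D2 w' - D2 w * A2 w'\<bar> \<ge> 1"
    and c0: "c0 > 0"
    and initial: "\<And>w x. w \<in> L \<Longrightarrow> x \<in> {0..1} \<Longrightarrow>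
      c0 \<le> weighted_norm r1 (A1 w) (A1 w * \<phi>1 x + D1 w) 0 * weighted_norm r2 (A2 w) (A2 w * \<phi>2 x + D2 w) 0"
begin

definition n1 where "n1 w x t = weighted_norm r1 (A1 w) (A1 w * \<phi>1 x + D1 w) t"
definition n2 where "n2 w x t = weighted_norm r2 (A2 w) (A2 w * \<phi>2 x + D2 w) t"
definition N where "N w x t = n1 w x t * n2 w x t"

lemma nonneg [simp]: "n1 w x t \<ge> 0" "n2 w x t \<ge> 0" "N w x t \<ge> 0"
  by (simp_all add: n1_def n2_def N_def)

lemma r1_pos: "r1 > 0" using r by simp

text \<open>Each factor loses at most its own rate, and the rates add up to r1 + r2 = 1.\<close>

lemma N_decay:
  assumes "s \<ge> 0" shows "exp (- s) * N w x t \<le> N w x (t + s)"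
proof -
  have "(exp (- r1 * s) * n1 w x t) * (exp (- r2 * s) * n2 w x t) \<le> n1 w x (t + s) * n2 w x (t + s)"
    unfolding n1_def n2_def using r assms by (intro mult_mono weighted_norm_decay) auto
  moreover have "exp (- s) = exp (- r1 * s) * exp (- r2 * s)"
  proof -
    have "- s = - r1 * s + - r2 * s" using r(3) by (metis distrib_right minus_add_distrib mult_minus1)
    then show ?thesis by (simp only: exp_add)
  qed
  ultimately show ?thesis unfolding N_def by (simp only: mult_ac)
qed

text \<open>Since \<open>r2 \<le> r1\<close>, the product can only drop while the first factor is in its contracting
  regime, i.e. while \<open>\<phi>1 x\<close> is close to a number depending only on the line through \<open>w\<close>.\<close>

lemma contracting_if_dropping:
  assumes "s \<ge> 0" "N w x (t + s) < N w x t"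
  shows "A1 w \<noteq> 0" "\<bar>\<phi>1 x + D1 w / A1 w\<bar> \<le> exp (- 2 * r1 * t)"
proof -
  let ?B = "A1 w * \<phi>1 x + D1 w"
  \<comment> \<open>If the expanding coordinate already dominated, the first factor would gain exp
    (r1 s) while the second loses at most exp (- r2 s), and the product could not drop.\<close>
  have lt: "\<bar>?B\<bar> * exp (r1 * t) < \<bar>A1 w\<bar> * exp (- r1 * t)"
  proof (rule ccontr)
    assume "\<not> ?thesis"
    then have "\<bar>A1 w\<bar> * exp (- r1 * t) \<le> \<bar>?B\<bar> * exp (r1 * t)" by (simp only: not_less)
    from weighted_norm_growth[OF this]
    have "(exp (r1 * s) * n1 w x t) * (exp (- r2 * s) * n2 w x t) \<le> n1 w x (t + s) * n2 w x (t + s)"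
      unfolding n1_def n2_def using r assms(1) by (intro mult_mono weighted_norm_decay) auto
    moreover have "exp (r1 * s) * exp (- r2 * s) \<ge> 1"
      using r assms by (simp flip: exp_add add: mult_right_mono)
    then have "1 * N w x t \<le> (exp (r1 * s) * exp (- r2 * s)) * N w x t"
      by (intro mult_right_mono) auto
    ultimately show False using assms(2) by (simp add: N_def mult_ac)
  qed
  show A: "A1 w \<noteq> 0"
  proof
    assume "A1 w = 0"
    then have "\<bar>A1 w\<bar> * exp (- r1 * t) = 0" by simp
    with lt have "\<bar>?B\<bar> * exp (r1 * t) < 0" by (simp only:)
    then show False by (simp add: mult_less_0_iff)
  qed
  have "\<bar>?B\<bar> * exp (r1 * t) * exp (- r1 * t) \<le> \<bar>A1 w\<bar> * exp (- r1 * t) * exp (- r1 * t)"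
    using lt by (intro mult_right_mono) auto
  then have "\<bar>?B\<bar> \<le> \<bar>A1 w\<bar> * exp (- 2 * r1 * t)"
    by (simp add: mult.assoc del: mult_le_cancel_left mult_le_cancel_right flip: exp_add)
  moreover have "\<phi>1 x + D1 w / A1 w = ?B / A1 w" using A by (simp add: field_simps)
  ultimately show "\<bar>\<phi>1 x + D1 w / A1 w\<bar> \<le> exp (- 2 * r1 * t)"
    using A by (simp only: abs_divide pos_divide_le_eq zero_less_abs_iff mult.commute simp_thms)
qed

text \<open>The two vectors are short at different points x and x'. Shearing the second one to x
  costs a factor 1 + \<kappa> at each embedding; each determinant is at most twice a product of
  norms, so the product of the two determinants falls below 1 and \<open>det\<close> leaves only the
  vanishing alternative.\<close>

lemma same_line:
  assumes w: "w \<in> L" "w' \<in> L" and x: "x \<in> {0..1}" "x' \<in> {0..1}" and t: "t \<ge> 0"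
    and close: "C * \<bar>x - x'\<bar> * exp (2 * r1 * t) \<le> \<kappa>" and \<kappa>: "\<kappa> \<ge> 0"
    and small: "4 * (1 + \<kappa>)^2 * (N w x t * N w' x' t) < 1"
  shows "A1 w * D1 w' = D1 w * A1 w'"
proof (rule ccontr)
  assume neq: "\<not> ?thesis"
  have y1: "\<bar>\<phi>1 x - \<phi>1 x'\<bar> * exp (2 * r1 * t) \<le> \<kappa>"
    by (rule order_trans[OF mult_right_mono[OF lip1[OF x]] close]) simp
  \<comment> \<open>Closeness is measured at the faster rate r1, hence also suffices for the slower
    second factor.\<close>
  have "exp (2 * r2 * t) \<le> exp (2 * r1 * t)" using r t by (simp add: mult_right_mono)
  then have "\<bar>\<phi>2 x - \<phi>2 x'\<bar> * exp (2 * r2 * t) \<le> (C * \<bar>x - x'\<bar>) * exp (2 * r1 * t)"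
    using lip2[OF x] C by (intro mult_mono) auto
  then have y2: "\<bar>\<phi>2 x - \<phi>2 x'\<bar> * exp (2 * r2 * t) \<le> \<kappa>" using close by simp
  have n1: "n1 w' x t \<le> (1 + \<kappa>) * n1 w' x' t"
    using weighted_norm_shear[OF y1 \<kappa>, of "A1 w'" "A1 w' * \<phi>1 x' + D1 w'"] by (simp add: n1_def algebra_simps)
  have n2: "n2 w' x t \<le> (1 + \<kappa>) * n2 w' x' t"
    using weighted_norm_shear[OF y2 \<kappa>, of "A2 w'" "A2 w' * \<phi>2 x' + D2 w'"] by (simp add: n2_def algebra_simps)
  have "\<bar>A1 w * D1 w' - D1 w * A1 w'\<bar> \<le> 2 * n1 w x t * n1 w' x t"
    using det_le_weighted_norm[of "A1 w" "A1 w' * \<phi>1 x + D1 w'" "A1 w * \<phi>1 x + D1 w" "A1 w'" r1 t]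
    by (simp add: n1_def algebra_simps)
  also have "\<dots> \<le> 2 * n1 w x t * ((1 + \<kappa>) * n1 w' x' t)" by (intro mult_left_mono n1) auto
  finally have 1: "\<bar>A1 w * D1 w' - D1 w * A1 w'\<bar> \<le> 2 * n1 w x t * ((1 + \<kappa>) * n1 w' x' t)" .
  have "\<bar>A2 w * D2 w' - D2 w * A2 w'\<bar> \<le> 2 * n2 w x t * n2 w' x t"
    using det_le_weighted_norm[of "A2 w" "A2 w' * \<phi>2 x + D2 w'" "A2 w * \<phi>2 x + D2 w" "A2 w'" r2 t]
    by (simp add: n2_def algebra_simps)
  also have "\<dots> \<le> 2 * n2 w x t * ((1 + \<kappa>) * n2 w' x' t)" by (intro mult_left_mono n2) auto
  finally have 2: "\<bar>A2 w * D2 w' - D2 w * A2 w'\<bar> \<le> 2 * n2 w x t * ((1 + \<kappa>) * n2 w' x' t)" .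
  have "1 \<le> \<bar>A1 w * D1 w' - D1 w * A1 w'\<bar> * \<bar>A2 w * D2 w' - D2 w * A2 w'\<bar>"
    using det[OF w] neq by blast
  also have "\<dots> \<le> (2 * n1 w x t * ((1 + \<kappa>) * n1 w' x' t)) * (2 * n2 w x t * ((1 + \<kappa>) * n2 w' x' t))"
    using 1 2 \<kappa> by (intro mult_mono) auto
  also have "\<dots> = 4 * (1 + \<kappa>)^2 * (N w x t * N w' x' t)" by (simp add: N_def power2_eq_square mult_ac)
  finally show False using small by simp
qed

text \<open>All vectors responsible for \<open>Bad j\<close> in the current ball lie on one line,
  hence have one slope, and \<phi>1 is close to the negative of this slope at every bad point. Since
  \<phi>1 expands distances by at least m, bad points are close to each other. The step s of the
  times t j satisfies exp (- 2 r1 s) = q, so the estimates are the same for all j.\<close>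

lemma bad_sets:
  assumes x0: "x0 \<in> {0..1}" and \<rho>0: "\<rho>0 > 0" and m: "m > 0" and q: "0 < q" "q < 1"
    and expanding: "\<And>x y. x \<in> ball_in {0..1} x0 \<rho>0 \<Longrightarrow> y \<in> ball_in {0..1} x0 \<rho>0 \<Longrightarrow>
      m * \<bar>x - y\<bar> \<le> \<bar>\<phi>1 x - \<phi>1 y\<bar>"
  shows "\<exists>Bad. avoidable_family {z. \<exists>\<epsilon>>0. \<forall>w\<in>L. \<forall>t\<ge>0. \<epsilon> \<le> N w z t} x0 \<rho>0 q Bad"
proof -
  define s where "s = - ln q / (2 * r1)"
  have "ln q < 0" using q by simp
  then have s: "s > 0" using r1_pos unfolding s_def by (intro divide_pos_pos) auto
  have es: "exp (- 2 * r1 * s) = q" using q r1_pos by (simp add: s_def)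
  \<comment> \<open>Chosen so that 2 y q^j / q equals m times half the radius \<rho>0 q^j; the
    division by q arises because the slope estimate holds at the earlier time t j - s.\<close>
  define y where "y = m * \<rho>0 * q / 4"
  have y: "y > 0" using m \<rho>0 q by (simp add: y_def)
  \<comment> \<open>The maximum with s keeps t 0 - s nonnegative, and the summand 1 makes exp (- 2
    r1 T0) < y strict.\<close>
  define T0 where "T0 = max s ((1 - ln y) / (2 * r1))"
  have T0: "s \<le> T0" by (simp add: T0_def)
  have "(1 - ln y) / (2 * r1) \<le> T0" by (simp add: T0_def)
  then have "- 2 * r1 * T0 < ln y" using r1_pos by (simp add: field_simps)
  then have eT0: "exp (- 2 * r1 * T0) < y" using y by (metis exp_less_cancel_iff exp_ln)
  define t where "t = (\<lambda>j. T0 + real j * s)"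
  have et: "exp (- 2 * r1 * t j) = exp (- 2 * r1 * T0) * q ^ j" for j
    unfolding t_def es[symmetric] exp_of_nat_mult[symmetric] by (simp add: algebra_simps flip: exp_add)
  \<comment> \<open>C times the diameter bound 2 \<rho>0 q^j times exp (2 r1 (t j)); the powers of q
    cancel, so \<kappa> is the same for every j.\<close>
  define \<kappa> where "\<kappa> = 2 * C * \<rho>0 * exp (2 * r1 * T0)"
  have \<kappa>: "\<kappa> \<ge> 0" using C \<rho>0 by (simp add: \<kappa>_def)
  \<comment> \<open>The first term lets the initial bound survive up to time T0, the second gives 4
    (1 + \<kappa>)^2 \<epsilon>^2 <= 1/4 for \<open>same_line\<close>.\<close>
  define \<epsilon> where "\<epsilon> = min (c0 * exp (- T0)) (1 / (4 * (1 + \<kappa>)))"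
  have \<epsilon>: "\<epsilon> > 0" "\<epsilon> \<le> c0 * exp (- T0)" "\<epsilon> \<le> 1 / (4 * (1 + \<kappa>))"
    using c0 \<kappa> by (auto simp: \<epsilon>_def)
  have t0: "t j \<ge> 0" "t j - s \<ge> 0" for j
  proof -
    have "real j * s \<ge> 0" using s by simp
    then show "t j \<ge> 0" "t j - s \<ge> 0" using s T0 unfolding t_def by linarith+
  qed
  \<comment> \<open>The second conjunct restricts to a first failure on the time grid: it makes the
    norm of every failing vector drop between t j - s and t j, as
    \<open>contracting_if_dropping\<close> requires, and it is supplied by induction for a point
    that has avoided the earlier sets.\<close>
  define Bad where "Bad = (\<lambda>j. {x. (\<exists>w\<in>L. N w x (t j) < \<epsilon>) \<and> (\<forall>w\<in>L. \<epsilon> \<le> N w x (t j - s))})"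
  have "\<bar>u - v\<bar> < \<rho>0 * q ^ j / 2"
    if x: "x \<in> {0..1}" "ball_in {0..1} x (\<rho>0 * q ^ j) \<subseteq> ball_in {0..1} x0 \<rho>0"
      and u: "u \<in> Bad j" "u \<in> ball_in {0..1} x (\<rho>0 * q ^ j)"
      and v: "v \<in> Bad j" "v \<in> ball_in {0..1} x (\<rho>0 * q ^ j)" for j x u v
  proof -
    obtain w where w: "w \<in> L" "N w u (t j) < \<epsilon>" "\<epsilon> \<le> N w u (t j - s)" using u by (auto simp: Bad_def)
    obtain w' where w': "w' \<in> L" "N w' v (t j) < \<epsilon>" "\<epsilon> \<le> N w' v (t j - s)" using v by (auto simp: Bad_def)
    have uv: "u \<in> {0..1}" "v \<in> {0..1}" using u v by (auto simp: ball_in_def)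
    have "dist u v \<le> dist x u + dist x v" by (rule dist_triangle3)
    then have duv: "\<bar>u - v\<bar> \<le> 2 * (\<rho>0 * q ^ j)" using u v by (simp add: ball_in_def dist_real_def)
    have "exp (2 * r1 * t j) * q ^ j = exp (2 * r1 * T0)"
    proof -
      have "exp (2 * r1 * t j) * (exp (- 2 * r1 * T0) * q ^ j) * exp (2 * r1 * T0) = exp (2 * r1 * T0)"
        unfolding et[symmetric] by (simp flip: exp_add)
      moreover have "exp (- 2 * r1 * T0) * exp (2 * r1 * T0) = 1" by (simp flip: exp_add)
      ultimately show ?thesis by (metis (no_types) mult.assoc mult.commute mult_1)
    qed
    moreover have "C * \<bar>u - v\<bar> * exp (2 * r1 * t j) \<le> C * (2 * (\<rho>0 * q ^ j)) * exp (2 * r1 * t j)"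
      using C by (intro mult_right_mono mult_left_mono duv) auto
    ultimately have close: "C * \<bar>u - v\<bar> * exp (2 * r1 * t j) \<le> \<kappa>"
      by (simp add: \<kappa>_def mult_ac)
    have "N w u (t j) * N w' v (t j) \<le> (1 / (4 * (1 + \<kappa>))) * (1 / (4 * (1 + \<kappa>)))"
      using w w' \<epsilon> \<kappa> by (intro mult_mono) auto
    then have "4 * (1 + \<kappa>)^2 * (N w u (t j) * N w' v (t j)) \<le> 4 * (1 + \<kappa>)^2 * ((1 / (4 * (1 + \<kappa>))) * (1 / (4 * (1 + \<kappa>))))"
      by (intro mult_left_mono) auto
    also have "\<dots> = 1 / 4"
    proof -
      have *: "4 * k^2 * ((1 / (4 * k)) * (1 / (4 * k))) = 1 / 4" if "k > 0" for k :: real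
        using that by (simp add: power2_eq_square)
      show ?thesis by (rule *) (use \<kappa> in simp)
    qed
    finally have "4 * (1 + \<kappa>)^2 * (N w u (t j) * N w' v (t j)) < 1" by linarith
    then have eq: "A1 w * D1 w' = D1 w * A1 w'"
      by (rule same_line[OF w(1) w'(1) uv t0(1) close \<kappa>])
    have "N w u (t j - s + s) < N w u (t j - s)" "N w' v (t j - s + s) < N w' v (t j - s)"
      using w w' by auto
    note cu = contracting_if_dropping[OF less_imp_le[OF s] this(1)]
      and cv = contracting_if_dropping[OF less_imp_le[OF s] this(2)]
    have "D1 w' / A1 w' = D1 w / A1 w" using eq cu(1) cv(1) by (simp add: field_simps)
    then have "\<bar>\<phi>1 u - \<phi>1 v\<bar> \<le> 2 * exp (- 2 * r1 * (t j - s))"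
      using cu(2) cv(2) by linarith
    also have "exp (- 2 * r1 * (t j - s)) = exp (- 2 * r1 * T0) * q ^ j / q"
    proof -
      have "- 2 * r1 * (t j - s) = - 2 * r1 * t j - (- 2 * r1 * s)" by (simp add: algebra_simps)
      then show ?thesis by (simp only: exp_diff et es)
    qed
    finally have "\<bar>\<phi>1 u - \<phi>1 v\<bar> \<le> 2 * (exp (- 2 * r1 * T0) * q ^ j / q)" .
    moreover have "u \<in> ball_in {0..1} x0 \<rho>0" "v \<in> ball_in {0..1} x0 \<rho>0" using u v x by blast+
    ultimately have "m * \<bar>u - v\<bar> \<le> 2 * (exp (- 2 * r1 * T0) * q ^ j / q)"
      using expanding order_trans by blast
    also have "\<dots> < 2 * (y * q ^ j / q)"
      using eT0 q by (intro mult_strict_left_mono divide_strict_right_mono mult_strict_right_mono) auto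
    also have "\<dots> = m * (\<rho>0 * q ^ j / 2)" using q by (simp add: y_def)
    finally show ?thesis using m by simp
  qed
  moreover have "\<exists>\<epsilon>>0. \<forall>w\<in>L. \<forall>t\<ge>0. \<epsilon> \<le> N w z t"
    if z: "z \<in> ball_in {0..1} x0 \<rho>0" "\<And>j. z \<notin> Bad j" for z
  proof -
    have z01: "z \<in> {0..1}" using z by (simp add: ball_in_def)
    have start: "\<epsilon> \<le> N w z u" if "w \<in> L" "0 \<le> u" "u \<le> T0" for w u
    proof -
      have "\<epsilon> \<le> c0 * exp (- u)" using \<epsilon>(2) c0 that
        by (meson exp_le_cancel_iff le_imp_neg_le less_imp_le mult_left_mono order_trans)
      also have "\<dots> \<le> N w z 0 * exp (- u)"
        using initial[OF that(1) z01] by (intro mult_right_mono) (auto simp: N_def n1_def n2_def)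
      also have "\<dots> \<le> N w z u" using N_decay[OF that(2), of w z 0] by (simp add: mult.commute)
      finally show ?thesis .
    qed
    have prev: "\<forall>w\<in>L. \<epsilon> \<le> N w z (t j - s)" for j
    proof (induction j)
      case 0
      show ?case using start t0(2)[of 0] s by (simp add: t_def)
    next
      case (Suc j)
      have "\<forall>w\<in>L. \<epsilon> \<le> N w z (t j)" using Suc z(2)[of j] by (force simp: Bad_def not_less)
      moreover have "t (Suc j) - s = t j" by (simp add: t_def algebra_simps)
      ultimately show ?case by simp
    qed
    have grid: "\<epsilon> \<le> N w z (t j)" if "w \<in> L" for w j
    proof -
      have "t (Suc j) - s = t j" by (simp add: t_def algebra_simps)
      then show ?thesis using prev[of "Suc j"] that by simp
    qed
    \<comment> \<open>Between grid times the norm loses at most the factor exp (- s).\<close>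
    have "exp (- s) * \<epsilon> \<le> N w z u" if wu: "w \<in> L" "u \<ge> 0" for w u
    proof (cases "u \<le> T0")
      case True
      have "exp (- s) * \<epsilon> \<le> 1 * \<epsilon>" using s \<epsilon> by (intro mult_right_mono) auto
      then show ?thesis using start[OF wu True] by simp
    next
      case False
      define j where "j = nat \<lfloor>(u - T0) / s\<rfloor>"
      have "0 \<le> (u - T0) / s" using False s by simp
      then have "real j \<le> (u - T0) / s" "(u - T0) / s \<le> real j + 1" unfolding j_def by linarith+
      then have j: "t j \<le> u" "u - t j \<le> s" using s by (auto simp: t_def field_simps)
      have "exp (- s) * \<epsilon> \<le> exp (- (u - t j)) * N w z (t j)"
        using j \<epsilon> by (intro mult_mono grid wu) auto
      also have "\<dots> \<le> N w z u" using N_decay[of "u - t j" w z "t j"] j by simp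
      finally show ?thesis .
    qed
    then show ?thesis using \<epsilon>(1) by (intro exI[of _ "exp (- s) * \<epsilon>"]) auto
  qed
  ultimately show ?thesis unfolding avoidable_family_def by (intro exI[of _ Bad]) blast
qed

text \<open>On a ball free of zeros the continuous \<phi>1' is bounded away from 0 by compactness,
  and the mean value theorem turns this into the expansion hypothesis of
  \<open>bad_sets\<close>.\<close>

lemma winning:
  assumes deriv: "\<And>x. x \<in> {0..1} \<Longrightarrow> (\<phi>1 has_real_derivative \<phi>1' x) (at x within {0..1})"
    and cont: "continuous_on {0..1} \<phi>1'" and fin: "finite {x \<in> {0..1}. \<phi>1' x = 0}"
    and W: "\<And>z. z \<in> {0..1} \<Longrightarrow> \<exists>\<epsilon>>0. \<forall>w\<in>L. \<forall>t\<ge>0. \<epsilon> \<le> N w z t \<Longrightarrow> z \<in> W"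
  shows "schmidt_winning {0..1} W"
proof -
  have "alpha_beta_winning {0..1} W (1/8) \<beta>" if \<beta>: "0 < \<beta>" "\<beta> < 1" for \<beta>
  proof (rule winning_by_avoidance[OF fin \<beta>])
    fix x0 \<rho>0 :: real
    assume x0: "x0 \<in> {0..1}" and \<rho>0: "\<rho>0 > 0" and Z: "ball_in {0..1} x0 \<rho>0 \<inter> {x \<in> {0..1}. \<phi>1' x = 0} = {}"
    let ?I = "ball_in {0..1} x0 \<rho>0"
    have I: "?I = {max 0 (x0 - \<rho>0)..min 1 (x0 + \<rho>0)}"
      by (auto simp: ball_in_def dist_real_def abs_le_iff)
    have cpt: "compact ?I" unfolding I by (rule compact_Icc)
    have ne: "?I \<noteq> {}" using x0 \<rho>0 by (auto simp: ball_in_def)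
    have cont': "continuous_on ?I (\<lambda>x. \<bar>\<phi>1' x\<bar>)"
      by (intro continuous_intros continuous_on_subset[OF cont]) (auto simp: ball_in_def)
    obtain p where p: "p \<in> ?I" "\<And>x. x \<in> ?I \<Longrightarrow> \<bar>\<phi>1' p\<bar> \<le> \<bar>\<phi>1' x\<bar>"
      using continuous_attains_inf[OF cpt ne cont'] by auto
    define m where "m = \<bar>\<phi>1' p\<bar>"
    have m: "m > 0" using Z p(1) by (auto simp: m_def ball_in_def)
    have less: "m * \<bar>x - y\<bar> \<le> \<bar>\<phi>1 x - \<phi>1 y\<bar>" if "x \<in> ?I" "y \<in> ?I" "x \<le> y" for x y
    proof -
      have sub: "{x..y} \<subseteq> {0..1}" "{x..y} \<subseteq> ?I" using that unfolding I by auto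
      have "\<exists>\<xi>\<in>{x..y}. \<phi>1 y - \<phi>1 x = (\<lambda>h. h * \<phi>1' \<xi>) (y - x)"
      proof (rule mvt_very_simple[OF that(3)])
        fix \<xi> assume "x \<le> \<xi>" "\<xi> \<le> y"
        then have "(\<phi>1 has_real_derivative \<phi>1' \<xi>) (at \<xi> within {x..y})"
          using sub by (intro DERIV_subset[OF deriv sub(1)]) auto
        then show "(\<phi>1 has_derivative (\<lambda>h. h * \<phi>1' \<xi>)) (at \<xi> within {x..y})"
          by (simp add: has_field_derivative_def mult.commute[of _ "\<phi>1' \<xi>"])
      qed
      then obtain \<xi> where \<xi>: "\<xi> \<in> {x..y}" "\<phi>1 y - \<phi>1 x = (y - x) * \<phi>1' \<xi>" by auto
      then have "\<bar>\<phi>1 x - \<phi>1 y\<bar> = \<bar>x - y\<bar> * \<bar>\<phi>1' \<xi>\<bar>" by (metis abs_minus_commute abs_mult)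
      also have "\<dots> \<ge> \<bar>x - y\<bar> * m"
        using p(2)[of \<xi>] \<xi>(1) sub unfolding m_def by (intro mult_left_mono) auto
      finally show ?thesis by (simp add: mult.commute)
    qed
    have expanding: "m * \<bar>x - y\<bar> \<le> \<bar>\<phi>1 x - \<phi>1 y\<bar>" if "x \<in> ?I" "y \<in> ?I" for x y
      using less[OF that] less[OF that(2,1)] by (cases "x \<le> y") (simp_all add: abs_minus_commute)
    have q: "0 < 1/8 * \<beta>" "1/8 * \<beta> < 1" using \<beta> by auto
    have "\<exists>Bad. avoidable_family {z. \<exists>\<epsilon>>0. \<forall>w\<in>L. \<forall>t\<ge>0. \<epsilon> \<le> N w z t} x0 \<rho>0 (1/8 * \<beta>) Bad"
      by (rule bad_sets[OF x0 \<rho>0 m q]) (rule expanding)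
    then obtain Bad where Bad: "avoidable_family {z. \<exists>\<epsilon>>0. \<forall>w\<in>L. \<forall>t\<ge>0. \<epsilon> \<le> N w z t} x0 \<rho>0 (1/8 * \<beta>) Bad" ..
    have "avoidable_family W x0 \<rho>0 (1/8 * \<beta>) Bad"
      unfolding avoidable_family_def
    proof (intro conjI ballI impI)
      show "\<forall>j x u v. x \<in> {0..1} \<longrightarrow>
          ball_in {0..1} x (\<rho>0 * (1/8 * \<beta>) ^ j) \<subseteq> ball_in {0..1} x0 \<rho>0 \<longrightarrow>
          u \<in> Bad j \<inter> ball_in {0..1} x (\<rho>0 * (1/8 * \<beta>) ^ j) \<longrightarrow>
          v \<in> Bad j \<inter> ball_in {0..1} x (\<rho>0 * (1/8 * \<beta>) ^ j) \<longrightarrow> \<bar>u - v\<bar> < \<rho>0 * (1/8 * \<beta>) ^ j / 2"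
        using Bad unfolding avoidable_family_def by (rule conjunct1)
      fix z assume z: "z \<in> ?I" "\<forall>j. z \<notin> Bad j"
      then have "z \<in> {z. \<exists>\<epsilon>>0. \<forall>w\<in>L. \<forall>t\<ge>0. \<epsilon> \<le> N w z t}"
        using Bad unfolding avoidable_family_def by blast
      then show "z \<in> W" using z(1) by (intro W) (auto simp: ball_in_def)
    qed
    then show "\<exists>Bad. avoidable_family W x0 \<rho>0 (1/8 * \<beta>) Bad" by blast
  qed
  then show ?thesis unfolding schmidt_winning_def alpha_winning_def by (intro exI[of _ "1/8"]) auto
qed

end

section \<open>Mahler's criterion along an orbit\<close>

lemma pigeonhole_fibre:
  assumes P: "finite P" and cells: "finite Z" "f ` P \<subseteq> Z" and card: "k * card Z < card P"
  shows "\<exists>z\<in>Z. k < card {x \<in> P. f x = z}"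
proof (rule ccontr)
  assume "\<not> ?thesis"
  then have "card {x \<in> P. f x = z} \<le> k" if "z \<in> Z" for z using that by (auto simp: not_less)
  then have "(\<Sum>z\<in>Z. card {x \<in> P. f x = z}) \<le> (\<Sum>z\<in>Z. k)" by (intro sum_mono)
  moreover have "P = (\<Union>z\<in>Z. {x \<in> P. f x = z})" using cells by auto
  then have "card P \<le> (\<Sum>z\<in>Z. card {x \<in> P. f x = z})" using card_UN_le[OF cells(1)] by metis
  ultimately show False using card by (simp add: mult.commute)
qed

lemma floor_eq_imp_close:
  assumes "\<lfloor>x\<rfloor> = \<lfloor>y\<rfloor>" shows "\<bar>x - y\<bar> < (1::real)"
  using assms by linarith

lemma floor_mem_cells:
  assumes "\<bar>x\<bar> \<le> (b::real)" shows "\<lfloor>x\<rfloor> \<in> {- \<lceil>b\<rceil>..\<lceil>b\<rceil>}"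
proof -
  have "- b \<le> x" "x \<le> b" using assms by auto
  then show ?thesis unfolding atLeastAtMost_iff by (metis ceiling_def floor_mono floor_le_ceiling minus_minus order_trans)
qed

lemma card_cells:
  assumes "1 \<le> (b::real)" shows "real (card {- \<lceil>b\<rceil>..\<lceil>b\<rceil>}) \<le> 5 * b"
proof -
  have "\<lceil>b\<rceil> \<ge> 1" using assms by (simp add: one_le_ceiling)
  then have "real (card {- \<lceil>b\<rceil>..\<lceil>b\<rceil>}) = 2 * of_int \<lceil>b\<rceil> + 1" by simp
  also have "\<dots> \<le> 5 * b" using assms ceiling_correct[of b] by linarith
  finally show ?thesis .
qed

section \<open>Counting integral vectors in cells and on lines\<close>

definition pair_det :: "'k::field_char_0 \<times> 'k \<Rightarrow> 'k \<times> 'k \<Rightarrow> 'k" where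
  "pair_det w w' = fst w * snd w' - snd w * fst w'"

definition row_entry :: "('k \<Rightarrow> real) \<Rightarrow> real ^ 2 ^ 2 \<Rightarrow> 2 \<Rightarrow> 'k \<times> 'k \<Rightarrow> real" where
  "row_entry f M j w = f (fst w) * M $ 1 $ j + f (snd w) * M $ 2 $ j"

definition row_norm :: "('k \<Rightarrow> real) \<Rightarrow> real ^ 2 ^ 2 \<Rightarrow> real \<Rightarrow> real \<Rightarrow> 'k \<times> 'k \<Rightarrow> real" where
  "row_norm f M r t w = weighted_norm r (row_entry f M 1 w) (row_entry f M 2 w) t"

lemma row_norm_nonneg [simp]: "row_norm f M r t w \<ge> 0"
  by (simp add: row_norm_def)

context field_emb
begin

lemma row_entry_diff: "row_entry f M j (w - w') = row_entry f M j w - row_entry f M j w'"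
  by (simp add: row_entry_def algebra_simps)

lemma row_entry_det:
  assumes "det M = 1"
  shows "row_entry f M 1 w * row_entry f M 2 w' - row_entry f M 2 w * row_entry f M 1 w' = f (pair_det w w')"
proof -
  have "row_entry f M 1 w * row_entry f M 2 w' - row_entry f M 2 w * row_entry f M 1 w' =
      (M $ 1 $ 1 * M $ 2 $ 2 - M $ 1 $ 2 * M $ 2 $ 1) * f (pair_det w w')"
    by (simp add: row_entry_def pair_det_def algebra_simps)
  then show ?thesis using assms by (simp add: det_2)
qed

lemma abs_det_le_row_norm:
  assumes "det M = 1"
  shows "\<bar>f (pair_det w w')\<bar> \<le> 2 * row_norm f M r t w * row_norm f M r t w'"
  unfolding row_entry_det[OF assms, symmetric] row_norm_def by (rule det_le_weighted_norm)

text \<open>At one embedding a K-line becomes a real line, so the two coordinates are proportional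
  along it and the same one attains the maximum for every vector. The norm there is the absolute
  value of an additive function, which makes counting on the line one-dimensional per
  embedding.\<close>

lemma row_norm_on_line:
  assumes M: "det M = 1" and v: "row_norm f M r t v > 0"
  obtains Z where "\<And>x. pair_det x v = 0 \<Longrightarrow> row_norm f M r t x = \<bar>Z x\<bar>" "\<And>x y. Z (x - y) = Z x - Z y"
proof -
  let ?X = "row_entry f M 1" and ?Y = "row_entry f M 2"
  have eqv: "\<bar>?X x\<bar> * \<bar>?Y v\<bar> = \<bar>?Y x\<bar> * \<bar>?X v\<bar>" if "pair_det x v = 0" for x
    using row_entry_det[OF M, of x v] that by (simp flip: abs_mult)
  have aux: "b * e' \<le> a * e"
    if "a * y = b * x" "y * e' \<le> x * e" "x > 0" "a \<ge> 0" for a b x y e e' :: real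
  proof -
    have "(b * e') * x = a * (y * e')" using that(1) by (simp add: mult_ac)
    also have "\<dots> \<le> a * (x * e)" using that by (intro mult_left_mono)
    finally have "(b * e') * x \<le> (a * e) * x" by (simp add: mult_ac)
    then show ?thesis using that(3) by simp
  qed
  show ?thesis
  proof (cases "\<bar>?Y v\<bar> * exp (r * t) \<le> \<bar>?X v\<bar> * exp (- r * t)")
    case True
    then have "\<bar>?X v\<bar> > 0" using v by (auto simp: row_norm_def weighted_norm_def)
    then have "\<bar>?Y x\<bar> * exp (r * t) \<le> \<bar>?X x\<bar> * exp (- r * t)" if "pair_det x v = 0" for x
      using aux[OF eqv[OF that] True] by simp
    then show ?thesis
      by (intro that[of "\<lambda>x. ?X x * exp (- r * t)"])
        (auto simp: row_norm_def weighted_norm_def abs_mult row_entry_diff left_diff_distrib)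
  next
    case False
    then have le: "\<bar>?X v\<bar> * exp (- r * t) \<le> \<bar>?Y v\<bar> * exp (r * t)" by simp
    then have "\<bar>?Y v\<bar> > 0" using v by (auto simp: row_norm_def weighted_norm_def)
    then have "\<bar>?X x\<bar> * exp (- r * t) \<le> \<bar>?Y x\<bar> * exp (r * t)" if "pair_det x v = 0" for x
      using aux[OF eqv[OF that, symmetric] le] by simp
    then show ?thesis
      by (intro that[of "\<lambda>x. ?Y x * exp (r * t)"])
        (auto simp: row_norm_def weighted_norm_def abs_mult row_entry_diff left_diff_distrib)
  qed
qed

lemma row_norm_diff_le_if_same_cell:
  assumes R: "R > 0"
    and "\<lfloor>row_entry f M 1 w * exp (- r * t) / R\<rfloor> = \<lfloor>row_entry f M 1 w' * exp (- r * t) / R\<rfloor>"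
    and "\<lfloor>row_entry f M 2 w * exp (r * t) / R\<rfloor> = \<lfloor>row_entry f M 2 w' * exp (r * t) / R\<rfloor>"
  shows "row_norm f M r t (w - w') \<le> R"
proof -
  have *: "\<bar>x - y\<bar> * e \<le> R" if "\<lfloor>x * e / R\<rfloor> = \<lfloor>y * e / R\<rfloor>" "e > 0" for x y e
  proof -
    have "\<bar>(x - y) * e / R\<bar> < 1" using floor_eq_imp_close[OF that(1)] by (simp add: left_diff_distrib diff_divide_distrib)
    then show ?thesis using R that(2) by (simp add: abs_mult abs_divide)
  qed
  show ?thesis unfolding row_norm_def weighted_norm_def row_entry_diff
    using *[OF assms(2)] *[OF assms(3)] by simp
qed

end

context real_quadratic
begin

definition O2 :: "('k \<times> 'k) set" where
  "O2 = {w. algebraic_int (fst w) \<and> algebraic_int (snd w)}"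

lemma O2_diff: "w \<in> O2 \<Longrightarrow> w' \<in> O2 \<Longrightarrow> w - w' \<in> O2"
  by (simp add: O2_def algebraic_int_diff)

lemma pair_det_algebraic_int: "w \<in> O2 \<Longrightarrow> w' \<in> O2 \<Longrightarrow> algebraic_int (pair_det w w')"
  by (simp add: O2_def pair_det_def algebraic_int_diff algebraic_int_mult)

lemma theta_independent:
  assumes "of_int a + of_int b * \<theta> = of_int a' + of_int b' * \<theta>"
  shows "a = a'" "b = b'"
proof -
  have 1: "real_of_int a + of_int b * \<tau>1 \<theta> = of_int a' + of_int b' * \<tau>1 \<theta>"
    using arg_cong[OF assms, of \<tau>1] by simp
  have 2: "real_of_int a - of_int b * \<tau>1 \<theta> = of_int a' - of_int b' * \<tau>1 \<theta>"
    using arg_cong[OF assms, of \<tau>2] by (simp add: theta2)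
  have "real_of_int a = of_int a'" using 1 2 by linarith
  then show "a = a'" by simp
  then show "b = b'" using 1 theta1 by simp
qed

text \<open>Pairs of elements a + b \<theta> with 0 <= a, b < T: rank 4 gives T^4 vectors, while
  their entries grow only linearly in T.\<close>

lemma many_vectors:
  fixes M1 M2 :: "real ^ 2 ^ 2"
  obtains H where "H > 0" "\<And>T::nat. \<exists>P \<subseteq> O2. finite P \<and> card P = T ^ 4 \<and>
    (\<forall>w\<in>P. \<forall>j. \<bar>row_entry \<tau>1 M1 j w\<bar> \<le> H * real T \<and> \<bar>row_entry \<tau>2 M2 j w\<bar> \<le> H * real T)"
proof -
  define \<mu> where "\<mu> = (\<Sum>i\<in>UNIV. \<Sum>j\<in>UNIV. \<bar>M1 $ i $ j\<bar> + \<bar>M2 $ i $ j\<bar>)"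
  have \<mu>: "\<bar>M1 $ 1 $ j\<bar> + \<bar>M1 $ 2 $ j\<bar> \<le> \<mu>" "\<bar>M2 $ 1 $ j\<bar> + \<bar>M2 $ 2 $ j\<bar> \<le> \<mu>" for j
  proof -
    have "j = 1 \<or> j = 2" using exhaust_2 by blast
    then show "\<bar>M1 $ 1 $ j\<bar> + \<bar>M1 $ 2 $ j\<bar> \<le> \<mu>" "\<bar>M2 $ 1 $ j\<bar> + \<bar>M2 $ 2 $ j\<bar> \<le> \<mu>"
      by (auto simp: \<mu>_def sum_2)
  qed
  have \<mu>0: "\<mu> \<ge> 0" unfolding \<mu>_def by (intro sum_nonneg) auto
  define c where "c = 1 + \<bar>\<tau>1 \<theta>\<bar>"
  have c0: "c > 0" by (simp add: c_def add_pos_nonneg)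
  define H where "H = 1 + c * \<mu>"
  have H: "H > 0" using c0 \<mu>0 by (simp add: H_def add_pos_nonneg)
  have "\<exists>P \<subseteq> O2. finite P \<and> card P = T ^ 4 \<and>
    (\<forall>w\<in>P. \<forall>j. \<bar>row_entry \<tau>1 M1 j w\<bar> \<le> H * real T \<and> \<bar>row_entry \<tau>2 M2 j w\<bar> \<le> H * real T)" for T :: nat
  proof -
    define I where "I = {0..<int T}"
    define g where "g = (\<lambda>(a, b, c, e). (of_int a + of_int b * \<theta>, of_int c + of_int e * \<theta>))"
    define P where "P = g ` (I \<times> I \<times> I \<times> I)"
    have "inj_on g (I \<times> I \<times> I \<times> I)"
      by (auto simp: inj_on_def g_def dest: theta_independent)
    then have card: "card P = T ^ 4"
      by (simp add: P_def card_image I_def card_cartesian_product power4_eq_xxxx)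
    have bound: "\<bar>f (of_int a + of_int b * \<theta>)\<bar> \<le> real T * c"
      if "a \<in> I" "b \<in> I" "f = \<tau>1 \<or> f = \<tau>2" for a b f
    proof -
      have "\<bar>real_of_int b * \<tau>1 \<theta>\<bar> \<le> real T * \<bar>\<tau>1 \<theta>\<bar>"
        using that unfolding abs_mult by (intro mult_right_mono) (auto simp: I_def)
      moreover have "\<bar>real_of_int a\<bar> \<le> real T" using that by (auto simp: I_def)
      moreover have "real T * c = real T + real T * \<bar>\<tau>1 \<theta>\<bar>" by (simp add: c_def algebra_simps)
      ultimately have "\<bar>real_of_int a + of_int b * \<tau>1 \<theta>\<bar> \<le> real T * c"
        "\<bar>real_of_int a - of_int b * \<tau>1 \<theta>\<bar> \<le> real T * c" by linarith+
      then show ?thesis using that(3) by (auto simp: theta2)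
    qed
    have row: "\<bar>row_entry f M j (g x)\<bar> \<le> H * real T"
      if xI: "x \<in> I \<times> I \<times> I \<times> I" and "f = \<tau>1 \<or> f = \<tau>2" "\<bar>M $ 1 $ j\<bar> + \<bar>M $ 2 $ j\<bar> \<le> \<mu>" for x f M j
    proof -
      obtain a b c' e where x: "x = (a, b, c', e)" "a \<in> I" "b \<in> I" "c' \<in> I" "e \<in> I" using xI by auto
      have "\<bar>row_entry f M j (g x)\<bar> \<le>
          \<bar>f (of_int a + of_int b * \<theta>)\<bar> * \<bar>M $ 1 $ j\<bar> + \<bar>f (of_int c' + of_int e * \<theta>)\<bar> * \<bar>M $ 2 $ j\<bar>"
        unfolding row_entry_def x g_def by (simp flip: abs_mult) 
      also have "\<dots> \<le> (real T * c) * \<bar>M $ 1 $ j\<bar> + (real T * c) * \<bar>M $ 2 $ j\<bar>"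
        by (intro add_mono mult_right_mono bound x that(2)) auto
      also have "\<dots> = (real T * c) * (\<bar>M $ 1 $ j\<bar> + \<bar>M $ 2 $ j\<bar>)" by (simp only: distrib_left)
      also have "\<dots> \<le> (real T * c) * \<mu>" using that(3) c0 by (intro mult_left_mono) auto
      also have "\<dots> \<le> H * real T" by (simp add: H_def algebra_simps)
      finally show ?thesis .
    qed
    have "algebraic_int (of_int a + of_int b * \<theta>)" for a b
      by (rule algebraic_int_order) (unfold quad_order_def, blast)
    then have "P \<subseteq> O2"
      by (auto simp: P_def g_def O2_def)
    moreover have "finite P" by (simp add: P_def I_def)
    moreover have "\<forall>w\<in>P. \<forall>j. \<bar>row_entry \<tau>1 M1 j w\<bar> \<le> H * real T \<and> \<bar>row_entry \<tau>2 M2 j w\<bar> \<le> H * real T"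
    proof (intro ballI allI)
      fix w and j :: 2 assume "w \<in> P"
      then obtain x where x: "w = g x" "x \<in> I \<times> I \<times> I \<times> I" unfolding P_def by (rule imageE)
      show "\<bar>row_entry \<tau>1 M1 j w\<bar> \<le> H * real T \<and> \<bar>row_entry \<tau>2 M2 j w\<bar> \<le> H * real T"
        unfolding x(1) by (intro conjI row[OF x(2)] \<mu> disjI1 disjI2 refl)
    qed
    ultimately show ?thesis using card by (intro exI[of _ P] conjI)
  qed
  with H show ?thesis by (rule that)
qed

end

text \<open>A point of the line is located by two reals, one per embedding. Two points in one square
  of side \<delta> would differ by a vector whose norm product is below \<delta>^2, against
  \<open>lower\<close>; so each square of the grid contains at most one.\<close>

lemma (in real_quadratic) collinear_cell_card:
  fixes M1 M2 :: "real ^ 2 ^ 2"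
  assumes det: "det M1 = 1" "det M2 = 1" and \<delta>: "\<delta> > 0"
    and lower: "\<And>w. w \<in> O2 \<Longrightarrow> w \<noteq> 0 \<Longrightarrow> \<delta> * \<delta> \<le> row_norm \<tau>1 M1 r1 t w * row_norm \<tau>2 M2 r2 t w"
    and Q: "Q \<subseteq> O2" "w0 \<in> Q"
    and small: "\<And>w. w \<in> Q \<Longrightarrow> row_norm \<tau>1 M1 r1 t (w - w0) \<le> R \<and> row_norm \<tau>2 M2 r2 t (w - w0) \<le> R"
    and collinear: "\<And>w w'. w \<in> Q \<Longrightarrow> w' \<in> Q \<Longrightarrow> pair_det (w - w0) (w' - w0) = 0"
  shows "card Q \<le> card ({- \<lceil>R / \<delta>\<rceil>..\<lceil>R / \<delta>\<rceil>} \<times> {- \<lceil>R / \<delta>\<rceil>..\<lceil>R / \<delta>\<rceil>})"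
\<comment> \<open>A single point spans no direction, so in this case only nonemptiness of the grid
  is checked.\<close>
proof (cases "Q = {w0}")
  case True
  have "R \<ge> 0" by (rule order_trans[OF row_norm_nonneg conjunct1[OF small[OF Q(2)]]])
  then have "\<lfloor>0 :: real\<rfloor> \<in> {- \<lceil>R / \<delta>\<rceil>..\<lceil>R / \<delta>\<rceil>}"
    using \<delta> by (intro floor_mem_cells) simp
  then have "card {- \<lceil>R / \<delta>\<rceil>..\<lceil>R / \<delta>\<rceil>} \<noteq> 0"
    by (metis card_0_eq empty_iff finite_atLeastAtMost_int)
  then have "1 \<le> card ({- \<lceil>R / \<delta>\<rceil>..\<lceil>R / \<delta>\<rceil>} \<times> {- \<lceil>R / \<delta>\<rceil>..\<lceil>R / \<delta>\<rceil>})"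
    unfolding card_cartesian_product by (metis One_nat_def Suc_leI mult_pos_pos not_gr0)
  then show ?thesis using True by simp
next
  case False
  then obtain w1 where w1: "w1 \<in> Q" "w1 \<noteq> w0" using Q(2) by blast
  define v where "v = w1 - w0"
  have "v \<in> O2" "v \<noteq> 0" using w1 Q by (auto simp: v_def intro: O2_diff)
  then have "\<delta> * \<delta> \<le> row_norm \<tau>1 M1 r1 t v * row_norm \<tau>2 M2 r2 t v" by (rule lower)
  moreover have "0 < \<delta> * \<delta>" using \<delta> by simp
  ultimately have "row_norm \<tau>1 M1 r1 t v \<noteq> 0" "row_norm \<tau>2 M2 r2 t v \<noteq> 0" by auto
  then have pos: "row_norm \<tau>1 M1 r1 t v > 0" "row_norm \<tau>2 M2 r2 t v > 0"
    by (simp_all add: less_le)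
  obtain Z1 where Z1: "\<And>x. pair_det x v = 0 \<Longrightarrow> row_norm \<tau>1 M1 r1 t x = \<bar>Z1 x\<bar>" "\<And>x y. Z1 (x - y) = Z1 x - Z1 y"
    by (rule e1.row_norm_on_line[OF det(1) pos(1)]) (rule that)
  obtain Z2 where Z2: "\<And>x. pair_det x v = 0 \<Longrightarrow> row_norm \<tau>2 M2 r2 t x = \<bar>Z2 x\<bar>" "\<And>x y. Z2 (x - y) = Z2 x - Z2 y"
    by (rule e2.row_norm_on_line[OF det(2) pos(2)]) (rule that)
  have line: "pair_det (w - w0) v = 0" if "w \<in> Q" for w
    unfolding v_def by (rule collinear[OF that w1(1)])
  define g where "g = (\<lambda>w. (\<lfloor>Z1 (w - w0) / \<delta>\<rfloor>, \<lfloor>Z2 (w - w0) / \<delta>\<rfloor>))"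
  show ?thesis
  proof (rule card_inj_on_le)
    show "g ` Q \<subseteq> {- \<lceil>R / \<delta>\<rceil>..\<lceil>R / \<delta>\<rceil>} \<times> {- \<lceil>R / \<delta>\<rceil>..\<lceil>R / \<delta>\<rceil>}"
    proof (rule image_subsetI)
      fix w assume w: "w \<in> Q"
      have "\<bar>Z1 (w - w0) / \<delta>\<bar> \<le> R / \<delta>" "\<bar>Z2 (w - w0) / \<delta>\<bar> \<le> R / \<delta>"
        using small[OF w] Z1(1)[OF line[OF w]] Z2(1)[OF line[OF w]] \<delta> by (simp_all add: divide_right_mono)
      then show "g w \<in> {- \<lceil>R / \<delta>\<rceil>..\<lceil>R / \<delta>\<rceil>} \<times> {- \<lceil>R / \<delta>\<rceil>..\<lceil>R / \<delta>\<rceil>}"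
        unfolding g_def by (intro SigmaI floor_mem_cells)
    qed
    show "inj_on g Q"
    proof (rule inj_onI, rule ccontr)
      fix w w' assume w: "w \<in> Q" "w' \<in> Q" "g w = g w'" "w \<noteq> w'"
      let ?x = "w - w'"
      have x: "?x = (w - w0) - (w' - w0)" by simp
      have "pair_det ?x v = pair_det (w - w0) v - pair_det (w' - w0) v"
        by (simp add: pair_det_def algebra_simps)
      then have x0: "pair_det ?x v = 0" using line w by simp
      have close: "\<bar>Z (w - w0) - Z (w' - w0)\<bar> < \<delta>" if "\<lfloor>Z (w - w0) / \<delta>\<rfloor> = \<lfloor>Z (w' - w0) / \<delta>\<rfloor>" for Z
        using floor_eq_imp_close[OF that] \<delta> by (simp flip: diff_divide_distrib)
      have "row_norm \<tau>1 M1 r1 t ?x < \<delta>"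
        unfolding Z1(1)[OF x0] using close[of Z1] w(3) Z1(2)[of "w - w0" "w' - w0"] by (simp add: g_def)
      moreover have "row_norm \<tau>2 M2 r2 t ?x < \<delta>"
        unfolding Z2(1)[OF x0] using close[of Z2] w(3) Z2(2)[of "w - w0" "w' - w0"] by (simp add: g_def)
      ultimately have "row_norm \<tau>1 M1 r1 t ?x * row_norm \<tau>2 M2 r2 t ?x < \<delta> * \<delta>"
        by (intro mult_strict_mono') auto
      moreover have "?x \<in> O2" "?x \<noteq> 0" using w Q by (auto intro: O2_diff)
      ultimately show False using lower[of ?x] by simp
    qed
  qed simp
qed

text \<open>R is independent of t because the weights exp (r t) and exp (- r t) cancel in the number
  of cells. One cell holds more than k vectors, and \<open>collinear_cell_card\<close> allows at
  most k if their differences from a base point are all collinear.\<close>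

lemma (in real_quadratic) two_short_vectors:
  fixes M1 M2 :: "real ^ 2 ^ 2"
  assumes det: "det M1 = 1" "det M2 = 1" and \<delta>: "\<delta> > 0"
  shows "\<exists>R>0. \<forall>t. (\<forall>w\<in>O2. w \<noteq> 0 \<longrightarrow> \<delta> * \<delta> \<le> row_norm \<tau>1 M1 r1 t w * row_norm \<tau>2 M2 r2 t w) \<longrightarrow>
    (\<exists>w\<in>O2. \<exists>w'\<in>O2. pair_det w w' \<noteq> 0 \<and> row_norm \<tau>1 M1 r1 t w \<le> R \<and> row_norm \<tau>2 M2 r2 t w \<le> R \<and>
      row_norm \<tau>1 M1 r1 t w' \<le> R \<and> row_norm \<tau>2 M2 r2 t w' \<le> R)"
proof -
  obtain H where H: "H > 0" "\<And>T::nat. \<exists>P \<subseteq> O2. finite P \<and> card P = T ^ 4 \<and>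
    (\<forall>w\<in>P. \<forall>j. \<bar>row_entry \<tau>1 M1 j w\<bar> \<le> H * real T \<and> \<bar>row_entry \<tau>2 M2 j w\<bar> \<le> H * real T)"
    by (rule many_vectors[of M1 M2]) (rule that)
  \<comment> \<open>There are at most 625 (H T / R)^4 cells and k is at most 25 R^2 / \<delta>^2, so
    T^4 vectors suffice when (\<delta> R)^2 > 125^2 H^4; 126 makes this strict. The summand \<delta>
    gives R >= \<delta>, needed to apply \<open>card_cells\<close>.\<close>
  define R where "R = \<delta> + 126 * H^2 / \<delta>"
  have R: "R > 0" "R \<ge> \<delta>" using \<delta> H(1) by (auto simp: R_def add_pos_nonneg)
  have "126 * H^2 \<le> \<delta> * R" using \<delta> by (simp add: R_def algebra_simps)
  then have "(126 * H^2)^2 \<le> (\<delta> * R)^2" using H(1) by (intro power_mono) auto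
  moreover have "(126 * H^2)^2 = 15876 * H^4" by (simp add: power_mult_distrib flip: power_mult)
  moreover have "15625 * H^4 < 15876 * H^4" using H(1) by simp
  ultimately have key: "15625 * H^4 < (\<delta> * R)^2" by linarith
  let ?I = "\<lambda>b::real. {- \<lceil>b\<rceil>..\<lceil>b\<rceil>}"
  define k where "k = card (?I (R / \<delta>) \<times> ?I (R / \<delta>))"
  have "real k \<le> (5 * (R / \<delta>)) * (5 * (R / \<delta>))"
    unfolding k_def card_cartesian_product of_nat_mult using R \<delta> by (intro mult_mono card_cells) auto
  then have k: "real k \<le> 25 * R^2 / \<delta>^2" by (simp add: power2_eq_square)
  have "\<exists>w\<in>O2. \<exists>w'\<in>O2. pair_det w w' \<noteq> 0 \<and> row_norm \<tau>1 M1 r1 t w \<le> R \<and> row_norm \<tau>2 M2 r2 t w \<le> R \<and>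
      row_norm \<tau>1 M1 r1 t w' \<le> R \<and> row_norm \<tau>2 M2 r2 t w' \<le> R"
    if lower: "\<And>w. w \<in> O2 \<Longrightarrow> w \<noteq> 0 \<Longrightarrow> \<delta> * \<delta> \<le> row_norm \<tau>1 M1 r1 t w * row_norm \<tau>2 M2 r2 t w" for t
  proof -
    \<comment> \<open>T may depend on t: it is so large that every side of the box, counted in
      cells, is at least 1.\<close>
    define T where "T = nat \<lceil>R / H * exp (\<bar>r1 * t\<bar> + \<bar>r2 * t\<bar>)\<rceil> + 1"
    have T0: "real T > 0" by (simp add: T_def)
    define B where "B = (\<lambda>e. H * real T * exp e / R)"
    have B0: "B e \<ge> 0" for e using H(1) R(1) by (simp add: B_def)
    have B: "B e \<ge> 1" if "\<bar>e\<bar> \<le> \<bar>r1 * t\<bar> + \<bar>r2 * t\<bar>" for e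
    proof -
      have "R / H * exp (- e) \<le> R / H * exp (\<bar>r1 * t\<bar> + \<bar>r2 * t\<bar>)"
        using R H(1) that by (intro mult_left_mono) auto
      also have "\<dots> \<le> real T" unfolding T_def by linarith
      finally have "R / H * exp (- e) * (H * exp e) \<le> real T * (H * exp e)"
        using H(1) by (intro mult_right_mono) auto
      moreover have "R / H * exp (- e) * (H * exp e) = R * (exp (- e) * exp e)" using H(1) by simp
      moreover have "exp (- e) * exp e = 1" by (simp flip: exp_add)
      ultimately show ?thesis using R(1) by (simp add: B_def mult_ac)
    qed
    obtain P where P: "P \<subseteq> O2" "finite P" "card P = T ^ 4"
      "\<And>w j. w \<in> P \<Longrightarrow> \<bar>row_entry \<tau>1 M1 j w\<bar> \<le> H * real T"
      "\<And>w j. w \<in> P \<Longrightarrow> \<bar>row_entry \<tau>2 M2 j w\<bar> \<le> H * real T"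
      using H(2)[of T] by blast
    define Z where "Z = ?I (B (- r1 * t)) \<times> ?I (B (r1 * t)) \<times> ?I (B (- r2 * t)) \<times> ?I (B (r2 * t))"
    define g where "g = (\<lambda>w. (\<lfloor>row_entry \<tau>1 M1 1 w * exp (- r1 * t) / R\<rfloor>, \<lfloor>row_entry \<tau>1 M1 2 w * exp (r1 * t) / R\<rfloor>,
      \<lfloor>row_entry \<tau>2 M2 1 w * exp (- r2 * t) / R\<rfloor>, \<lfloor>row_entry \<tau>2 M2 2 w * exp (r2 * t) / R\<rfloor>))"
    have cell: "\<lfloor>x * exp e / R\<rfloor> \<in> ?I (B e)" if "\<bar>x\<bar> \<le> H * real T" for x e
    proof (rule floor_mem_cells)
      show "\<bar>x * exp e / R\<bar> \<le> B e"
        using that R(1) by (simp add: B_def abs_mult divide_right_mono)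
    qed
    have gZ: "g ` P \<subseteq> Z"
      unfolding g_def Z_def by (intro image_subsetI SigmaI cell P) auto
    have finZ: "finite Z" unfolding Z_def by (intro finite_cartesian_product) auto
    have "real (card Z) \<le> (5 * B (- r1 * t)) * ((5 * B (r1 * t)) * ((5 * B (- r2 * t)) * (5 * B (r2 * t))))"
      unfolding Z_def card_cartesian_product of_nat_mult
      by (intro mult_mono card_cells B mult_nonneg_nonneg) (use B0 in auto)
    also have "\<dots> = 625 * (H * real T / R)^4 * (exp (- r1 * t) * exp (r1 * t)) * (exp (- r2 * t) * exp (r2 * t))"
      by (simp add: B_def power4_eq_xxxx mult_ac)
    also have "\<dots> = 625 * (H * real T / R)^4" by (simp flip: exp_add)
    finally have cardZ: "real (card Z) \<le> 625 * (H * real T / R)^4" .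
    have "real (k * card Z) \<le> (25 * R^2 / \<delta>^2) * (625 * (H * real T / R)^4)"
      unfolding of_nat_mult using k cardZ by (intro mult_mono) auto
    also have "\<dots> = 15625 * H^4 / (\<delta> * R)^2 * real T ^ 4"
      using R \<delta> by (simp add: power_divide power_mult_distrib power4_eq_xxxx power2_eq_square mult_ac)
    also have "\<dots> < 1 * real T ^ 4"
      using key R \<delta> T0 by (intro mult_strict_right_mono) auto
    finally have "real (k * card Z) < real (card P)" by (simp only: P(3) of_nat_power mult_1)
    then have "k * card Z < card P" by (simp only: of_nat_less_iff)
    then obtain z where z: "k < card {w \<in> P. g w = z}"
      using pigeonhole_fibre[OF P(2) finZ gZ] by blast
    define Q where "Q = {w \<in> P. g w = z}"
    have QO: "Q \<subseteq> O2" using P(1) by (auto simp: Q_def)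
    have "Q \<noteq> {}" using z unfolding Q_def by (metis card.empty not_less0)
    then obtain w0 where w0: "w0 \<in> Q" by blast
    have short: "row_norm \<tau>1 M1 r1 t (w - w0) \<le> R \<and> row_norm \<tau>2 M2 r2 t (w - w0) \<le> R" if "w \<in> Q" for w
    proof -
      have "g w = g w0" using that w0 by (simp add: Q_def)
      then show ?thesis unfolding g_def prod.inject
        by (intro conjI e1.row_norm_diff_le_if_same_cell e2.row_norm_diff_le_if_same_cell R(1)) blast+
    qed
    have "\<exists>w\<in>Q. \<exists>w'\<in>Q. pair_det (w - w0) (w' - w0) \<noteq> 0"
    proof (rule ccontr)
      assume "\<not> ?thesis"
      then have "card Q \<le> k" unfolding k_def
        by (intro collinear_cell_card[OF det \<delta> lower QO w0 short]) auto
      then show False using z by (simp add: Q_def)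
    qed
    then show ?thesis using short O2_diff QO w0 by (meson subsetD)
  qed
  then show ?thesis using R(1) by (intro exI[of _ R] conjI allI impI) simp_all
qed

section \<open>Integral matrices modulo unimodular ones\<close>

definition adjugate2 :: "'a::comm_ring_1 ^ 2 ^ 2 \<Rightarrow> 'a ^ 2 ^ 2" where
  "adjugate2 A = vector [vector [A $ 2 $ 2, - A $ 1 $ 2], vector [- A $ 2 $ 1, A $ 1 $ 1]]"

lemma adjugate2_simps [simp]:
  "adjugate2 A $ 1 $ 1 = A $ 2 $ 2" "adjugate2 A $ 1 $ 2 = - A $ 1 $ 2"
  "adjugate2 A $ 2 $ 1 = - A $ 2 $ 1" "adjugate2 A $ 2 $ 2 = A $ 1 $ 1"
  by (simp_all add: adjugate2_def)

lemma matrix_mult_2: "(A ** B) $ i $ j = A $ i $ 1 * B $ 1 $ j + A $ i $ 2 * B $ 2 $ j"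
  for A B :: "'a::comm_ring_1 ^ 2 ^ 2"
  by (simp add: matrix_matrix_mult_def sum_2)

lemma matrix_eq_2:
  "A = B \<longleftrightarrow> A $ 1 $ 1 = B $ 1 $ 1 \<and> A $ 1 $ 2 = B $ 1 $ 2 \<and> A $ 2 $ 1 = B $ 2 $ 1 \<and> A $ 2 $ 2 = B $ 2 $ 2"
  for A B :: "'a ^ 2 ^ 2"
  by (auto simp: vec_eq_iff forall_2)

lemma adjugate2_left: "(adjugate2 A ** A) $ i $ j = (if i = j then det A else 0)"
  using exhaust_2[of i] exhaust_2[of j] by (auto simp: matrix_mult_2 det_2 algebra_simps)

lemma adjugate2_right: "(A ** adjugate2 A) $ i $ j = (if i = j then det A else 0)"
  using exhaust_2[of i] exhaust_2[of j] by (auto simp: matrix_mult_2 det_2 algebra_simps)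

lemma adjugate2_inverse:
  assumes "det A = 1" shows "adjugate2 A ** A = mat 1" "A ** adjugate2 A = mat 1" "det (adjugate2 A) = 1"
proof -
  show "adjugate2 A ** A = mat 1" "A ** adjugate2 A = mat 1"
    using assms by (simp_all add: vec_eq_iff adjugate2_left adjugate2_right mat_def)
  show "det (adjugate2 A) = 1" using assms by (simp add: det_2 mult.commute)
qed

context real_quadratic
begin

definition integral_matrix :: "'k ^ 2 ^ 2 \<Rightarrow> bool" where
  "integral_matrix A \<longleftrightarrow> (\<forall>i j. algebraic_int (A $ i $ j))"

lemma integral_matrix_mult: "integral_matrix A \<Longrightarrow> integral_matrix B \<Longrightarrow> integral_matrix (A ** B)"
  by (simp add: integral_matrix_def matrix_mult_2 algebraic_int_add algebraic_int_mult)

lemma integral_matrix_adjugate2: "integral_matrix A \<Longrightarrow> integral_matrix (adjugate2 A)"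
  by (simp add: integral_matrix_def forall_2)

lemma integral_matrix_add: "integral_matrix A \<Longrightarrow> integral_matrix B \<Longrightarrow> integral_matrix (A + B)"
  by (simp add: integral_matrix_def algebraic_int_add)

lemma integral_matrix_det: "integral_matrix A \<Longrightarrow> algebraic_int (det A)"
  by (simp add: integral_matrix_def det_2 algebraic_int_diff algebraic_int_mult)

text \<open>After multiplication by 2 d an algebraic integer has integer coordinates in Z[\<theta>].
  Reducing these modulo 2 d |n| leaves a factor n after 2 d is cancelled.\<close>

lemma residue_classes_of_int:
  assumes "n \<noteq> 0"
  obtains \<rho> :: "'k \<Rightarrow> int \<times> int" where "finite (range \<rho>)"
    "\<And>x y. algebraic_int x \<Longrightarrow> algebraic_int y \<Longrightarrow> \<rho> x = \<rho> y \<Longrightarrow> \<exists>z. algebraic_int z \<and> x - y = of_int n * z"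
proof -
  define N where "N = 2 * d * \<bar>n\<bar>"
  have N: "N > 0" using assms d_pos by (simp add: N_def)
  have "\<exists>m k. of_int (2 * d) * x = of_int m + of_int k * \<theta>" if "algebraic_int x" for x
    using algebraic_int_denominator[OF that] by (auto simp: quad_order_def)
  then obtain m k where mk: "\<And>x. algebraic_int x \<Longrightarrow> of_int (2 * d) * x = of_int (m x) + of_int (k x) * \<theta>"
    by metis
  define \<rho> where "\<rho> = (\<lambda>x. (m x mod N, k x mod N))"
  have "range \<rho> \<subseteq> {0..<N} \<times> {0..<N}" using N by (auto simp: \<rho>_def)
  then have "finite (range \<rho>)" by (rule finite_subset) simp
  moreover have "\<exists>z. algebraic_int z \<and> x - y = of_int n * z"
    if xy: "algebraic_int x" "algebraic_int y" "\<rho> x = \<rho> y" for x y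
  proof -
    have "N dvd m x - m y" "N dvd k x - k y" using xy(3) by (simp_all add: \<rho>_def mod_eq_dvd_iff)
    then obtain e f where ef: "m x - m y = N * e" "k x - k y = N * f" by (auto elim!: dvdE)
    have "of_int (2 * d) * (x - y) = of_int (m x - m y) + of_int (k x - k y) * \<theta>"
      using mk[OF xy(1)] mk[OF xy(2)] by (simp add: algebra_simps)
    also have "\<dots> = of_int N * (of_int e + of_int f * \<theta>)" unfolding ef by (simp add: algebra_simps)
    also have "\<dots> = of_int (2 * d) * (of_int \<bar>n\<bar> * (of_int e + of_int f * \<theta>))"
      unfolding N_def by (simp only: of_int_mult mult.assoc)
    finally have "x - y = of_int \<bar>n\<bar> * (of_int e + of_int f * \<theta>)"
      using d_pos by (subst (asm) mult_left_cancel) auto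
    also have "\<dots> = of_int n * (of_int (sgn n) * (of_int e + of_int f * \<theta>))"
      by (simp add: abs_sgn)
    finally have "x - y = of_int n * (of_int (sgn n) * (of_int e + of_int f * \<theta>))" .
    moreover have "algebraic_int (of_int (sgn n) * (of_int e + of_int f * \<theta>))"
      by (intro algebraic_int_mult algebraic_int_of_int algebraic_int_add algebraic_int_order order_theta)
    ultimately show ?thesis by blast
  qed
  ultimately show ?thesis by (rule that)
qed

text \<open>\<delta> divides its norm n, with cofactor the conjugate t - \<delta>, so classes modulo
  n separate classes modulo \<delta>.\<close>

lemma residue_classes:
  assumes \<delta>: "algebraic_int \<delta>" "\<delta> \<noteq> 0"
  obtains \<rho> :: "'k \<Rightarrow> int \<times> int" where "finite (range \<rho>)"
    "\<And>x y. algebraic_int x \<Longrightarrow> algebraic_int y \<Longrightarrow> \<rho> x = \<rho> y \<Longrightarrow> \<exists>z. algebraic_int z \<and> x - y = \<delta> * z"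
proof -
  obtain t n where tn: "\<tau>1 \<delta> + \<tau>2 \<delta> = of_int t" "\<tau>1 \<delta> * \<tau>2 \<delta> = of_int n"
    using norm_Ints[OF \<delta>(1)] trace_Ints[OF \<delta>(1)] by (auto elim!: Ints_cases)
  have "real_of_int n \<noteq> 0" unfolding tn(2)[symmetric] using \<delta>(2) by simp
  then have n: "n \<noteq> 0" by simp
  have eq: "\<delta> * (of_int t - \<delta>) = of_int n"
    using char_poly[OF tn] by (simp add: algebra_simps)
  have conj: "algebraic_int (of_int t - \<delta>)" using \<delta>(1) by (intro algebraic_int_diff) auto
  obtain \<rho> :: "'k \<Rightarrow> int \<times> int" where \<rho>: "finite (range \<rho>)"
    "\<And>x y. algebraic_int x \<Longrightarrow> algebraic_int y \<Longrightarrow> \<rho> x = \<rho> y \<Longrightarrow> \<exists>z. algebraic_int z \<and> x - y = of_int n * z"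
    by (rule residue_classes_of_int[OF n]) (rule that)
  have "\<exists>z. algebraic_int z \<and> x - y = \<delta> * z" if xy: "algebraic_int x" "algebraic_int y" "\<rho> x = \<rho> y" for x y
  proof -
    obtain z where z: "algebraic_int z" "x - y = of_int n * z" using \<rho>(2)[OF xy] by blast
    then have "x - y = \<delta> * ((of_int t - \<delta>) * z)" by (simp only: eq[symmetric] mult.assoc)
    then show ?thesis using algebraic_int_mult[OF conj z(1)] by blast
  qed
  with \<rho>(1) show ?thesis by (rule that)
qed

text \<open>Two integral matrices of the same determinant \<open>\<delta>\<close> that agree modulo \<open>\<delta>\<close> differ by a
  unimodular right factor.\<close>

lemma finitely_many_matrix_classes:
  assumes "finite D"
  obtains F where "finite F" "\<And>B. B \<in> F \<Longrightarrow> det B \<noteq> 0"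
    "\<And>A. integral_matrix A \<Longrightarrow> det A \<in> D \<Longrightarrow> det A \<noteq> 0 \<Longrightarrow>
      \<exists>B\<in>F. \<exists>G. integral_matrix G \<and> det G = 1 \<and> A = B ** G"
proof -
  define S where "S = {A. integral_matrix A \<and> det A \<in> D \<and> det A \<noteq> 0}"
  have "\<exists>\<rho>. algebraic_int \<delta> \<longrightarrow> \<delta> \<noteq> 0 \<longrightarrow> finite (range (\<rho> :: 'k \<Rightarrow> int \<times> int)) \<and>
    (\<forall>x y. algebraic_int x \<longrightarrow> algebraic_int y \<longrightarrow> \<rho> x = \<rho> y \<longrightarrow> (\<exists>z. algebraic_int z \<and> x - y = \<delta> * z))" for \<delta>
  proof (cases "algebraic_int \<delta> \<and> \<delta> \<noteq> 0")
    case True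
    then have "algebraic_int \<delta>" "\<delta> \<noteq> 0" by auto
    then show ?thesis by (rule residue_classes) blast
  qed blast
  then obtain \<rho> where \<rho>: "\<And>\<delta>. algebraic_int \<delta> \<Longrightarrow> \<delta> \<noteq> 0 \<Longrightarrow> finite (range (\<rho> \<delta> :: 'k \<Rightarrow> int \<times> int))"
    "\<And>\<delta> x y. algebraic_int \<delta> \<Longrightarrow> \<delta> \<noteq> 0 \<Longrightarrow> algebraic_int x \<Longrightarrow> algebraic_int y \<Longrightarrow> \<rho> \<delta> x = \<rho> \<delta> y \<Longrightarrow>
      \<exists>z. algebraic_int z \<and> x - y = \<delta> * z"
    by metis
  define \<kappa> where "\<kappa> = (\<lambda>A :: 'k ^ 2 ^ 2. (det A, \<rho> (det A) (A $ 1 $ 1), \<rho> (det A) (A $ 1 $ 2),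
    \<rho> (det A) (A $ 2 $ 1), \<rho> (det A) (A $ 2 $ 2)))"
  define D' where "D' = {\<delta> \<in> D. algebraic_int \<delta> \<and> \<delta> \<noteq> 0}"
  have "\<kappa> ` S \<subseteq> Sigma D' (\<lambda>\<delta>. range (\<rho> \<delta>) \<times> range (\<rho> \<delta>) \<times> range (\<rho> \<delta>) \<times> range (\<rho> \<delta>))"
    by (auto simp: \<kappa>_def S_def D'_def integral_matrix_det)
  moreover have "finite (Sigma D' (\<lambda>\<delta>. range (\<rho> \<delta>) \<times> range (\<rho> \<delta>) \<times> range (\<rho> \<delta>) \<times> range (\<rho> \<delta>)))"
    using assms \<rho>(1) by (intro finite_SigmaI finite_cartesian_product) (auto simp: D'_def)
  ultimately have fin: "finite (\<kappa> ` S)" by (rule finite_subset)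
  define rep where "rep = (\<lambda>c. SOME A. A \<in> S \<and> \<kappa> A = c)"
  have rep: "rep (\<kappa> A) \<in> S \<and> \<kappa> (rep (\<kappa> A)) = \<kappa> A" if "A \<in> S" for A
    unfolding rep_def by (rule someI_ex) (use that in blast)
  have "\<exists>B\<in>rep ` \<kappa> ` S. \<exists>G. integral_matrix G \<and> det G = 1 \<and> A = B ** G"
    if A: "integral_matrix A" "det A \<in> D" "det A \<noteq> 0" for A
  proof -
    define B where "B = rep (\<kappa> A)"
    have AS: "A \<in> S" using A by (simp add: S_def)
    have B: "B \<in> S" "\<kappa> B = \<kappa> A" using rep[OF AS] by (simp_all add: B_def)
    have detB: "det B = det A" using B(2) by (simp add: \<kappa>_def)
    have iB: "integral_matrix B" using B(1) by (simp add: S_def)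
    have "\<exists>z. algebraic_int z \<and> A $ i $ j - B $ i $ j = det A * z" for i j
    proof (rule \<rho>(2))
      show "algebraic_int (det A)" by (rule integral_matrix_det[OF A(1)])
      show "algebraic_int (A $ i $ j)" "algebraic_int (B $ i $ j)" using A iB by (simp_all add: integral_matrix_def)
      show "\<rho> (det A) (A $ i $ j) = \<rho> (det A) (B $ i $ j)"
        using B(2) exhaust_2[of i] exhaust_2[of j] by (auto simp: \<kappa>_def)
    qed (fact A(3))
    then obtain z where z: "\<And>i j. algebraic_int (z i j)" "\<And>i j. A $ i $ j - B $ i $ j = det A * z i j"
      by metis
    define E where "E = (\<chi> i j. z i j)"
    \<comment> \<open>A = B + \<delta> E with \<delta> = det B, and B times its adjugate is
      \<delta>, so B can be factored out on the left without leaving the integral matrices.\<close>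
    define G where "G = mat 1 + adjugate2 B ** E"
    have "integral_matrix E" using z by (simp add: integral_matrix_def E_def)
    moreover have "integral_matrix (mat 1)" by (simp add: integral_matrix_def mat_def)
    ultimately have iG: "integral_matrix G" unfolding G_def
      by (intro integral_matrix_add integral_matrix_mult integral_matrix_adjugate2 iB)
    have "B ** G = B + (B ** adjugate2 B) ** E"
      by (simp add: G_def matrix_add_ldistrib matrix_mul_assoc)
    also have "\<dots> = A"
    proof -
      have "(B + (B ** adjugate2 B) ** E) $ i $ j = A $ i $ j" for i j
        using z(2)[of i j] exhaust_2[of i]
        by (auto simp: matrix_mult_2[of "B ** adjugate2 B"] adjugate2_right detB E_def algebra_simps)
      then show ?thesis by (simp add: vec_eq_iff)
    qed
    finally have "A = B ** G" by simp
    moreover from this have "det G = 1" using det_mul[of B G] detB A(3) by simp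
    ultimately show ?thesis using iG AS unfolding B_def by blast
  qed
  moreover have "det B \<noteq> 0" if "B \<in> rep ` \<kappa> ` S" for B :: "'k ^ 2 ^ 2"
  proof -
    obtain A where "A \<in> S" "B = rep (\<kappa> A)" using \<open>B \<in> rep ` \<kappa> ` S\<close> by blast
    then show ?thesis using rep[of A] by (simp add: S_def)
  qed
  moreover have "finite (rep ` \<kappa> ` S)" using fin by (rule finite_imageI)
  ultimately show ?thesis using that by blast
qed

end

section \<open>Bounded representatives along the flow\<close>

lemma weighted_norm_scale: "weighted_norm r (c * A) (c * B) t = \<bar>c\<bar> * weighted_norm r A B t"
  by (simp add: weighted_norm_def abs_mult max_mult_distrib_left mult.assoc)

lemma weighted_norm_add: "weighted_norm r (A + A') (B + B') t \<le> weighted_norm r A B t + weighted_norm r A' B' t"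
proof -
  have "\<bar>A + A'\<bar> * exp (- r * t) \<le> \<bar>A\<bar> * exp (- r * t) + \<bar>A'\<bar> * exp (- r * t)"
    unfolding distrib_right[symmetric] by (intro mult_right_mono abs_triangle_ineq) auto
  moreover have "\<bar>B + B'\<bar> * exp (r * t) \<le> \<bar>B\<bar> * exp (r * t) + \<bar>B'\<bar> * exp (r * t)"
    unfolding distrib_right[symmetric] by (intro mult_right_mono abs_triangle_ineq) auto
  ultimately show ?thesis
    using weighted_norm_bounds(1)[of A r t B] weighted_norm_bounds(1)[of A' r t B']
      weighted_norm_bounds(2)[of B r t A] weighted_norm_bounds(2)[of B' r t A']
    unfolding weighted_norm_def[of r "A + A'"] max.bounded_iff by linarith
qed

lemma (in field_emb) row_norm_combination:
  assumes "fst x = c * fst w + c' * fst w'" "snd x = c * snd w + c' * snd w'"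
  shows "row_norm f M r t x \<le> \<bar>f c\<bar> * row_norm f M r t w + \<bar>f c'\<bar> * row_norm f M r t w'"
proof -
  have "row_entry f M j x = f c * row_entry f M j w + f c' * row_entry f M j w'" for j
    by (simp add: row_entry_def assms algebra_simps)
  then show ?thesis unfolding row_norm_def
    using weighted_norm_add weighted_norm_scale by metis
qed

definition matrix_row :: "'a ^ 2 ^ 2 \<Rightarrow> 2 \<Rightarrow> 'a \<times> 'a" where
  "matrix_row A i = (A $ i $ 1, A $ i $ 2)"

text \<open>Two short independent vectors are the rows of an integral matrix A whose determinant
  lies in a finite set. Writing A = B G with B from a finite list, the rows of G are combinations of
  the rows of A with coefficients from the inverses of that list, so C does not depend on t.\<close>

lemma (in real_quadratic) mahler_bound:
  fixes M1 M2 :: "real ^ 2 ^ 2"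
  assumes det: "det M1 = 1" "det M2 = 1" and \<delta>: "\<delta> > 0"
  shows "\<exists>C. \<forall>t. (\<forall>w\<in>O2. w \<noteq> 0 \<longrightarrow> \<delta> * \<delta> \<le> row_norm \<tau>1 M1 r1 t w * row_norm \<tau>2 M2 r2 t w) \<longrightarrow>
    (\<exists>G. integral_matrix G \<and> det G = 1 \<and>
      (\<forall>i. row_norm \<tau>1 M1 r1 t (matrix_row G i) \<le> C \<and> row_norm \<tau>2 M2 r2 t (matrix_row G i) \<le> C))"
proof -
  obtain R where R: "R > 0" and vectors: "\<forall>t. (\<forall>w\<in>O2. w \<noteq> 0 \<longrightarrow>
      \<delta> * \<delta> \<le> row_norm \<tau>1 M1 r1 t w * row_norm \<tau>2 M2 r2 t w) \<longrightarrow>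
    (\<exists>w\<in>O2. \<exists>w'\<in>O2. pair_det w w' \<noteq> 0 \<and> row_norm \<tau>1 M1 r1 t w \<le> R \<and> row_norm \<tau>2 M2 r2 t w \<le> R \<and>
      row_norm \<tau>1 M1 r1 t w' \<le> R \<and> row_norm \<tau>2 M2 r2 t w' \<le> R)"
    using two_short_vectors[OF det \<delta>, of r1 r2] by blast
  define D where "D = {x. algebraic_int x \<and> \<bar>\<tau>1 x\<bar> \<le> 2 * R * R \<and> \<bar>\<tau>2 x\<bar> \<le> 2 * R * R}"
  have "finite D" unfolding D_def by (rule finite_algebraic_int_bounded)
  then obtain F where F: "finite F" "\<And>B. B \<in> F \<Longrightarrow> det B \<noteq> 0"
    "\<And>A. integral_matrix A \<Longrightarrow> det A \<in> D \<Longrightarrow> det A \<noteq> 0 \<Longrightarrow>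
      \<exists>B\<in>F. \<exists>G. integral_matrix G \<and> det G = 1 \<and> A = B ** G"
    by (rule finitely_many_matrix_classes) (rule that)
  define b where "b = (\<lambda>B i j. adjugate2 B $ i $ j / det B :: 'k)"
  define m where "m = (\<lambda>B. \<Sum>i\<in>UNIV. \<Sum>j\<in>UNIV. \<bar>\<tau>1 (b B i j)\<bar> + \<bar>\<tau>2 (b B i j)\<bar>)"
  define C where "C = (\<Sum>B\<in>F. m B) * R"
  have m: "\<bar>\<tau>1 (b B i 1)\<bar> + \<bar>\<tau>1 (b B i 2)\<bar> \<le> m B" "\<bar>\<tau>2 (b B i 1)\<bar> + \<bar>\<tau>2 (b B i 2)\<bar> \<le> m B" for B i
    using exhaust_2[of i] by (auto simp: m_def sum_2)
  have m0: "m B \<ge> 0" for B unfolding m_def by (intro sum_nonneg) auto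
  have "\<exists>G. integral_matrix G \<and> det G = 1 \<and>
      (\<forall>i. row_norm \<tau>1 M1 r1 t (matrix_row G i) \<le> C \<and> row_norm \<tau>2 M2 r2 t (matrix_row G i) \<le> C)"
    if lower: "\<forall>w\<in>O2. w \<noteq> 0 \<longrightarrow> \<delta> * \<delta> \<le> row_norm \<tau>1 M1 r1 t w * row_norm \<tau>2 M2 r2 t w" for t
  proof -
    obtain w w' where w: "w \<in> O2" "w' \<in> O2" "pair_det w w' \<noteq> 0"
      "row_norm \<tau>1 M1 r1 t w \<le> R" "row_norm \<tau>2 M2 r2 t w \<le> R"
      "row_norm \<tau>1 M1 r1 t w' \<le> R" "row_norm \<tau>2 M2 r2 t w' \<le> R"
      using vectors[rule_format, OF lower[rule_format]] by blast
    define A where "A = (vector [vector [fst w, snd w], vector [fst w', snd w']] :: 'k ^ 2 ^ 2)"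
    have A: "A $ 1 $ 1 = fst w" "A $ 1 $ 2 = snd w" "A $ 2 $ 1 = fst w'" "A $ 2 $ 2 = snd w'"
      by (simp_all add: A_def)
    have detA: "det A = pair_det w w'" by (simp add: det_2 A pair_det_def)
    have iA: "integral_matrix A" using w(1,2) by (simp add: integral_matrix_def forall_2 A O2_def)
    have "\<bar>\<tau>1 (det A)\<bar> \<le> 2 * R * R"
    proof -
      have "\<bar>\<tau>1 (det A)\<bar> \<le> 2 * row_norm \<tau>1 M1 r1 t w * row_norm \<tau>1 M1 r1 t w'"
        unfolding detA by (rule e1.abs_det_le_row_norm[OF det(1)])
      also have "\<dots> \<le> 2 * R * R" using w R by (intro mult_mono) auto
      finally show ?thesis .
    qed
    moreover have "\<bar>\<tau>2 (det A)\<bar> \<le> 2 * R * R"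
    proof -
      have "\<bar>\<tau>2 (det A)\<bar> \<le> 2 * row_norm \<tau>2 M2 r2 t w * row_norm \<tau>2 M2 r2 t w'"
        unfolding detA by (rule e2.abs_det_le_row_norm[OF det(2)])
      also have "\<dots> \<le> 2 * R * R" using w R by (intro mult_mono) auto
      finally show ?thesis .
    qed
    ultimately have "det A \<in> D" using integral_matrix_det[OF iA] by (simp add: D_def)
    then obtain B G where BG: "B \<in> F" "integral_matrix G" "det G = 1" "A = B ** G"
      using F(3)[OF iA] w(3) detA by auto
    have "adjugate2 B ** A = (adjugate2 B ** B) ** G" unfolding BG(4) by (rule matrix_mul_assoc)
    then have "(adjugate2 B ** A) $ i $ j = det B * G $ i $ j" for i j
      using exhaust_2[of i] by (auto simp: matrix_mult_2[of "adjugate2 B ** B"] adjugate2_left)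
    then have G: "G $ i $ j = b B i 1 * A $ 1 $ j + b B i 2 * A $ 2 $ j" for i j
      using F(2)[OF BG(1)] by (simp add: matrix_mult_2 b_def field_simps)
    have mC: "m B * R \<le> C" unfolding C_def using R F(1) BG(1) m0
      by (intro mult_right_mono member_le_sum) auto
    have row: "fst (matrix_row G i) = b B i 1 * fst w + b B i 2 * fst w'"
      "snd (matrix_row G i) = b B i 1 * snd w + b B i 2 * snd w'" for i
      by (simp_all add: matrix_row_def G A)
    have "row_norm \<tau>1 M1 r1 t (matrix_row G i) \<le> C" for i
    proof -
      have "row_norm \<tau>1 M1 r1 t (matrix_row G i) \<le> \<bar>\<tau>1 (b B i 1)\<bar> * R + \<bar>\<tau>1 (b B i 2)\<bar> * R"
        by (rule order_trans[OF e1.row_norm_combination[OF row]]) (intro add_mono mult_left_mono w abs_ge_zero)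
      also have "\<dots> \<le> m B * R" unfolding distrib_right[symmetric] using R by (intro mult_right_mono m) auto
      finally show ?thesis using mC by linarith
    qed
    moreover have "row_norm \<tau>2 M2 r2 t (matrix_row G i) \<le> C" for i
    proof -
      have "row_norm \<tau>2 M2 r2 t (matrix_row G i) \<le> \<bar>\<tau>2 (b B i 1)\<bar> * R + \<bar>\<tau>2 (b B i 2)\<bar> * R"
        by (rule order_trans[OF e2.row_norm_combination[OF row]]) (intro add_mono mult_left_mono w abs_ge_zero)
      also have "\<dots> \<le> m B * R" unfolding distrib_right[symmetric] using R by (intro mult_right_mono m) auto
      finally show ?thesis using mC by linarith
    qed
    ultimately show ?thesis using BG by blast
  qed
  then show ?thesis by (intro exI[of _ C] allI impI)
qed

section \<open>Relative compactness in the homogeneous space\<close>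

locale indexed_quadratic = real_quadratic "\<sigma> a" "\<sigma> b" \<theta> d
  for \<sigma> :: "'s::finite \<Rightarrow> 'k::field_char_0 \<Rightarrow> real" and a b \<theta> d +
  assumes ab: "a \<noteq> b" "UNIV = {a, b}"
begin

lemma index_cases: "s = a \<or> s = b"
  using ab(2) by blast

lemma emb: "field_emb (\<sigma> s)"
  using index_cases[of s] e1.field_emb_axioms e2.field_emb_axioms by auto

lemma tau_matrix_mult: "tau_matrix \<sigma> A \<otimes>\<^bsub>SL2_KS\<^esub> tau_matrix \<sigma> B = tau_matrix \<sigma> (A ** B)"
proof -
  have "(\<chi> i j. \<sigma> s (A $ i $ j)) ** (\<chi> i j. \<sigma> s (B $ i $ j)) = (\<chi> i j. \<sigma> s ((A ** B) $ i $ j))" for s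
  proof -
    interpret field_emb "\<sigma> s" by (rule emb)
    show ?thesis by (simp add: vec_eq_iff matrix_mult_2)
  qed
  then show ?thesis by (simp add: tau_matrix_def SL2_KS_def)
qed

lemma det_tau_matrix: "det (tau_matrix \<sigma> A $ s) = \<sigma> s (det A)"
proof -
  interpret field_emb "\<sigma> s" by (rule emb)
  show ?thesis by (simp add: det_2 tau_matrix_def)
qed

lemma tau_matrix_one: "tau_matrix \<sigma> (mat 1) = \<one>\<^bsub>SL2_KS\<^esub>"
proof -
  have eq: "(\<chi> i j. \<sigma> s (mat 1 $ i $ j)) = mat 1" for s
  proof -
    interpret field_emb "\<sigma> s" by (rule emb)
    show ?thesis by (simp add: vec_eq_iff mat_def)
  qed
  show ?thesis by (simp add: tau_matrix_def SL2_KS_def eq)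
qed

lemma SL2_OK_eq: "SL2_OK \<sigma> = tau_matrix \<sigma> ` {A. integral_matrix A \<and> det A = 1}"
  unfolding SL2_OK_def integral_matrix_def by (rule arg_cong[of _ _ "\<lambda>X. tau_matrix \<sigma> ` X"]) blast

lemma tau_matrix_carrier: "det A = 1 \<Longrightarrow> tau_matrix \<sigma> A \<in> carrier SL2_KS"
  by (simp add: SL2_KS_def det_tau_matrix field_emb.f_1[OF emb])

lemma subgroup_SL2_OK: "subgroup (SL2_OK \<sigma>) SL2_KS"
proof (rule group.subgroupI[OF group_SL2_KS])
  show "SL2_OK \<sigma> \<subseteq> carrier SL2_KS" by (auto simp: SL2_OK_eq tau_matrix_carrier)
  have "integral_matrix (mat 1)" by (simp add: integral_matrix_def mat_def)
  then show "SL2_OK \<sigma> \<noteq> {}" by (auto simp: SL2_OK_eq intro!: exI[of _ "mat 1"])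
  fix x assume "x \<in> SL2_OK \<sigma>"
  then obtain A where A: "x = tau_matrix \<sigma> A" "integral_matrix A" "det A = 1" by (auto simp: SL2_OK_eq)
  have "inv\<^bsub>SL2_KS\<^esub> x = tau_matrix \<sigma> (adjugate2 A)"
    by (rule group.inv_equality[OF group_SL2_KS])
      (simp_all add: A adjugate2_inverse tau_matrix_mult tau_matrix_one tau_matrix_carrier)
  moreover have "integral_matrix (adjugate2 A)" "det (adjugate2 A) = 1"
    using A by (simp_all add: integral_matrix_adjugate2 adjugate2_inverse)
  ultimately show "inv\<^bsub>SL2_KS\<^esub> x \<in> SL2_OK \<sigma>" unfolding SL2_OK_eq by blast
  fix y assume "y \<in> SL2_OK \<sigma>"
  then obtain B where B: "y = tau_matrix \<sigma> B" "integral_matrix B" "det B = 1" by (auto simp: SL2_OK_eq)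
  have "x \<otimes>\<^bsub>SL2_KS\<^esub> y = tau_matrix \<sigma> (A ** B)" by (simp add: A B tau_matrix_mult)
  moreover have "integral_matrix (A ** B)" "det (A ** B) = 1"
    using A B by (simp_all add: integral_matrix_mult det_mul)
  ultimately show "x \<otimes>\<^bsub>SL2_KS\<^esub> y \<in> SL2_OK \<sigma>" unfolding SL2_OK_eq by blast
qed

lemma SL2_OK_subset: "SL2_OK \<sigma> \<subseteq> carrier SL2_KS"
  using subgroup_SL2_OK by (rule subgroup.subset)

lemma coset_absorb:
  assumes "\<gamma> \<in> SL2_OK \<sigma>" "x \<in> carrier SL2_KS"
  shows "SL2_OK \<sigma> #>\<^bsub>SL2_KS\<^esub> (\<gamma> \<otimes>\<^bsub>SL2_KS\<^esub> x) = SL2_OK \<sigma> #>\<^bsub>SL2_KS\<^esub> x"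
proof -
  have \<gamma>: "\<gamma> \<in> carrier SL2_KS" using assms SL2_OK_subset by blast
  have "SL2_OK \<sigma> #>\<^bsub>SL2_KS\<^esub> (\<gamma> \<otimes>\<^bsub>SL2_KS\<^esub> x) = (SL2_OK \<sigma> #>\<^bsub>SL2_KS\<^esub> \<gamma>) #>\<^bsub>SL2_KS\<^esub> x"
    by (rule group.coset_mult_assoc[OF group_SL2_KS SL2_OK_subset \<gamma> assms(2), symmetric])
  also have "SL2_OK \<sigma> #>\<^bsub>SL2_KS\<^esub> \<gamma> = SL2_OK \<sigma>"
    by (rule group.coset_join2[OF group_SL2_KS \<gamma> subgroup_SL2_OK assms(1)])
  finally show ?thesis .
qed

lemma coset_eqD:
  assumes "SL2_OK \<sigma> #>\<^bsub>SL2_KS\<^esub> x = SL2_OK \<sigma> #>\<^bsub>SL2_KS\<^esub> c" "c \<in> carrier SL2_KS"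
  shows "\<exists>\<gamma>\<in>SL2_OK \<sigma>. c = \<gamma> \<otimes>\<^bsub>SL2_KS\<^esub> x"
proof -
  have "c \<in> SL2_OK \<sigma> #>\<^bsub>SL2_KS\<^esub> c"
    by (rule group.rcos_self[OF group_SL2_KS assms(2) subgroup_SL2_OK])
  then show ?thesis unfolding assms(1)[symmetric] by (auto simp: r_coset_def)
qed

definition bounded_part :: "real \<Rightarrow> 's matrix_KS set" where
  "bounded_part M = {g \<in> carrier SL2_KS. \<forall>s i j. \<bar>g $ s $ i $ j\<bar> \<le> M}"

lemma closed_carrier: "closed (carrier (SL2_KS :: 's matrix_KS monoid))"
  unfolding SL2_KS_def by (simp add: det_2) (intro closed_Collect_all closed_Collect_eq continuous_intros)

lemma compact_bounded_part: "compact (bounded_part M)"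
proof -
  have "bounded_part M = carrier SL2_KS \<inter> {g. \<forall>s i j. \<bar>g $ s $ i $ j\<bar> \<le> M}"
    by (auto simp: bounded_part_def)
  moreover have "closed {g :: 's matrix_KS. \<forall>s i j. \<bar>g $ s $ i $ j\<bar> \<le> M}"
    by (intro closed_Collect_all closed_Collect_le continuous_intros)
  ultimately have "closed (bounded_part M)" using closed_carrier by (simp add: closed_Int)
  moreover have "norm g \<le> (\<Sum>s\<in>(UNIV :: 's set). \<Sum>i\<in>(UNIV :: 2 set). \<Sum>j\<in>(UNIV :: 2 set). M)" if "g \<in> bounded_part M" for g
  proof -
    have "norm g \<le> (\<Sum>s\<in>UNIV. norm (g $ s))" unfolding norm_vec_def by (rule L2_set_le_sum) simp
    also have "\<dots> \<le> (\<Sum>s\<in>UNIV. \<Sum>i\<in>UNIV. norm (g $ s $ i))"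
      by (rule sum_mono) (subst norm_vec_def, rule L2_set_le_sum, simp)
    also have "\<dots> \<le> (\<Sum>s\<in>UNIV. \<Sum>i\<in>UNIV. \<Sum>j\<in>UNIV. norm (g $ s $ i $ j))"
      by (intro sum_mono) (subst norm_vec_def, rule L2_set_le_sum, simp)
    also have "\<dots> \<le> (\<Sum>s\<in>(UNIV :: 's set). \<Sum>i\<in>(UNIV :: 2 set). \<Sum>j\<in>(UNIV :: 2 set). M)"
      using that by (intro sum_mono) (simp add: bounded_part_def)
    finally show ?thesis .
  qed
  then have "bounded (bounded_part M)" unfolding bounded_iff by blast
  ultimately show ?thesis by (simp add: compact_eq_bounded_closed)
qed

text \<open>Discreteness of the arithmetic group: all entries are algebraic integers with both
  conjugates bounded.\<close>

lemma finite_SL2_OK_bounded: "finite {\<gamma> \<in> SL2_OK \<sigma>. \<forall>s i j. \<bar>\<gamma> $ s $ i $ j\<bar> \<le> Q}"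
proof -
  let ?X = "{x. algebraic_int x \<and> \<bar>\<sigma> a x\<bar> \<le> Q \<and> \<bar>\<sigma> b x\<bar> \<le> Q}"
  let ?m = "\<lambda>(x, y, z, w). vector [vector [x, y], vector [z, w]] :: 'k ^ 2 ^ 2"
  have "finite (tau_matrix \<sigma> ` ?m ` (?X \<times> ?X \<times> ?X \<times> ?X))"
    by (intro finite_imageI finite_cartesian_product finite_algebraic_int_bounded)
  moreover have "{\<gamma> \<in> SL2_OK \<sigma>. \<forall>s i j. \<bar>\<gamma> $ s $ i $ j\<bar> \<le> Q} \<subseteq> tau_matrix \<sigma> ` ?m ` (?X \<times> ?X \<times> ?X \<times> ?X)"
  proof
    fix \<gamma> assume "\<gamma> \<in> {\<gamma> \<in> SL2_OK \<sigma>. \<forall>s i j. \<bar>\<gamma> $ s $ i $ j\<bar> \<le> Q}"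
    then obtain A where A: "\<gamma> = tau_matrix \<sigma> A" "integral_matrix A" "\<And>s i j. \<bar>\<sigma> s (A $ i $ j)\<bar> \<le> Q"
      by (auto simp: SL2_OK_eq tau_matrix_def)
    have "A = ?m (A $ 1 $ 1, A $ 1 $ 2, A $ 2 $ 1, A $ 2 $ 2)" by (simp add: matrix_eq_2)
    moreover have "A $ i $ j \<in> ?X" for i j using A by (simp add: integral_matrix_def)
    ultimately have "A \<in> ?m ` (?X \<times> ?X \<times> ?X \<times> ?X)"
      by (intro image_eqI[where x = "(A $ 1 $ 1, A $ 1 $ 2, A $ 2 $ 1, A $ 2 $ 2)"] SigmaI)
    then show "\<gamma> \<in> tau_matrix \<sigma> ` ?m ` (?X \<times> ?X \<times> ?X \<times> ?X)"
      unfolding A(1) by (rule imageI)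
  qed
  ultimately show ?thesis by (rule finite_subset[rotated])
qed

text \<open>\<gamma> is c times the inverse of x, and for determinant 1 this inverse has the entries
  of x up to sign and order.\<close>

lemma entries_of_left_factor:
  fixes x c :: "real ^ 2 ^ 2"
  assumes "c = \<gamma> ** x" "det x = 1" "\<And>i j. \<bar>c $ i $ j\<bar> \<le> M" "\<And>i j. \<bar>x $ i $ j\<bar> \<le> N"
  shows "\<bar>\<gamma> $ i $ j\<bar> \<le> 2 * M * N"
proof -
  have "\<gamma> = \<gamma> ** (x ** adjugate2 x)" using assms(2) by (simp add: adjugate2_inverse)
  then have "\<gamma> = c ** adjugate2 x" by (simp add: assms(1) matrix_mul_assoc)
  then have \<gamma>: "\<gamma> $ i $ j = c $ i $ 1 * adjugate2 x $ 1 $ j + c $ i $ 2 * adjugate2 x $ 2 $ j"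
    by (simp only: matrix_mult_2)
  have adj: "\<bar>adjugate2 x $ k $ j\<bar> \<le> N" for k
    using exhaust_2[of k] exhaust_2[of j] assms(4) by auto
  have "\<bar>c $ i $ k * adjugate2 x $ k $ j\<bar> \<le> M * N" for k
    unfolding abs_mult using assms(3)[of i k] by (intro mult_mono adj) (auto intro: order_trans[OF abs_ge_zero])
  from this[of 1] this[of 2] show ?thesis unfolding \<gamma> by linarith
qed

text \<open>The saturation is a union over an infinite group, but along a convergent sequence the
  entries of the \<gamma> involved are bounded, so only finitely many occur and the limit stays in a
  finite union of closed sets.\<close>

lemma closed_saturation:
  "closed {x \<in> carrier SL2_KS. \<exists>\<gamma>\<in>SL2_OK \<sigma>. \<gamma> \<otimes>\<^bsub>SL2_KS\<^esub> x \<in> bounded_part M}" (is "closed ?S")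
proof (unfold closed_sequential_limits, intro allI impI, elim conjE)
  fix X l assume X: "\<forall>n. X n \<in> ?S" and lim: "X \<longlonglongrightarrow> l"
  have "Bseq X" using lim by (intro convergent_imp_Bseq convergentI)
  then obtain N where N: "\<And>n. norm (X n) \<le> N" by (auto simp: Bseq_def)
  have XN: "\<bar>X n $ s $ i $ j\<bar> \<le> N" for n s i j
  proof -
    have "\<bar>X n $ s $ i $ j\<bar> \<le> norm (X n $ s $ i)" by (rule component_le_norm_cart)
    also have "\<dots> \<le> norm (X n $ s)" by (rule Finite_Cartesian_Product.norm_nth_le)
    also have "\<dots> \<le> norm (X n)" by (rule Finite_Cartesian_Product.norm_nth_le)
    finally show ?thesis using N[of n] by linarith
  qed
  define \<Gamma> where "\<Gamma> = {\<gamma> \<in> SL2_OK \<sigma>. \<forall>s i j. \<bar>\<gamma> $ s $ i $ j\<bar> \<le> 2 * M * N}"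
  define S' where "S' = (\<Union>\<gamma>\<in>\<Gamma>. {x. \<gamma> \<otimes>\<^bsub>SL2_KS\<^esub> x \<in> bounded_part M}) \<inter> carrier SL2_KS"
  have "closed {x. \<gamma> \<otimes>\<^bsub>SL2_KS\<^esub> x \<in> bounded_part M}" for \<gamma>
  proof (rule closed_vimage[of "bounded_part M" "\<lambda>x. \<gamma> \<otimes>\<^bsub>SL2_KS\<^esub> x", unfolded vimage_def])
    show "closed (bounded_part M)" using compact_bounded_part by (rule compact_imp_closed)
    show "continuous_on UNIV (\<lambda>x. \<gamma> \<otimes>\<^bsub>SL2_KS\<^esub> x)"
      unfolding SL2_KS_def by (simp add: matrix_matrix_mult_def) (intro continuous_intros)
  qed
  then have "closed S'" unfolding S'_def \<Gamma>_def
    by (intro closed_Int closed_UN finite_SL2_OK_bounded closed_carrier) auto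
  moreover have "X n \<in> S'" for n
  proof -
    obtain \<gamma> where \<gamma>: "\<gamma> \<in> SL2_OK \<sigma>" "\<gamma> \<otimes>\<^bsub>SL2_KS\<^esub> X n \<in> bounded_part M" and Xn: "X n \<in> carrier SL2_KS"
      using X by blast
    have "\<bar>\<gamma> $ s $ i $ j\<bar> \<le> 2 * M * N" for s i j
    proof (rule entries_of_left_factor)
      show "\<gamma> $ s ** X n $ s = \<gamma> $ s ** X n $ s" ..
      show "det (X n $ s) = 1" using Xn by (simp add: SL2_KS_def)
      show "\<bar>(\<gamma> $ s ** X n $ s) $ i $ j\<bar> \<le> M" for i j using \<gamma>(2) by (simp add: bounded_part_def SL2_KS_def)
    qed (rule XN)
    then show ?thesis using \<gamma> Xn by (auto simp: S'_def \<Gamma>_def)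
  qed
  ultimately have "l \<in> S'" using lim by (auto simp: closed_sequential_limits)
  then show "l \<in> ?S" by (auto simp: S'_def \<Gamma>_def)
qed

text \<open>Compactness of the image of \<open>bounded_part M\<close> does not by itself bound the
  closure of T, as Hausdorffness of the quotient is not established. The image is closed because its
  preimage is the set of \<open>closed_saturation\<close>, so it contains the closure.\<close>

lemma relatively_compactin_bounded:
  assumes T: "T \<subseteq> (\<lambda>g. SL2_OK \<sigma> #>\<^bsub>SL2_KS\<^esub> g) ` bounded_part M"
  shows "relatively_compactin (homogeneous_space \<sigma>) T"
proof -
  let ?X = "top_of_set (carrier SL2_KS) :: 's matrix_KS topology"
  let ?q = "\<lambda>g. SL2_OK \<sigma> #>\<^bsub>SL2_KS\<^esub> g"
  let ?C = "?q ` bounded_part M"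
  have sub: "bounded_part M \<subseteq> carrier SL2_KS" by (auto simp: bounded_part_def)
  have q: "quotient_map ?X (homogeneous_space \<sigma>) ?q"
    unfolding homogeneous_space_def by (rule quotient_map_quotient_topology)
  have "compactin ?X (bounded_part M)"
    using compact_bounded_part sub by (simp add: compactin_subtopology)
  then have cpt: "compactin (homogeneous_space \<sigma>) ?C"
    by (rule image_compactin[OF _ quotient_imp_continuous_map[OF q]])
  have eq: "{x \<in> topspace ?X. ?q x \<in> ?C} = {x \<in> carrier SL2_KS. \<exists>\<gamma>\<in>SL2_OK \<sigma>. \<gamma> \<otimes>\<^bsub>SL2_KS\<^esub> x \<in> bounded_part M}"
  proof (rule Set.set_eqI, rule iffI)
    fix x assume "x \<in> {x \<in> topspace ?X. ?q x \<in> ?C}"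
    then obtain c where c: "x \<in> carrier SL2_KS" "c \<in> bounded_part M" "?q x = ?q c" by auto
    then obtain \<gamma> where "\<gamma> \<in> SL2_OK \<sigma>" "c = \<gamma> \<otimes>\<^bsub>SL2_KS\<^esub> x" using coset_eqD sub by blast
    then show "x \<in> {x \<in> carrier SL2_KS. \<exists>\<gamma>\<in>SL2_OK \<sigma>. \<gamma> \<otimes>\<^bsub>SL2_KS\<^esub> x \<in> bounded_part M}" using c by blast
  next
    fix x assume "x \<in> {x \<in> carrier SL2_KS. \<exists>\<gamma>\<in>SL2_OK \<sigma>. \<gamma> \<otimes>\<^bsub>SL2_KS\<^esub> x \<in> bounded_part M}"
    then obtain \<gamma> where \<gamma>: "x \<in> carrier SL2_KS" "\<gamma> \<in> SL2_OK \<sigma>" "\<gamma> \<otimes>\<^bsub>SL2_KS\<^esub> x \<in> bounded_part M" by blast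
    then have "?q x = ?q (\<gamma> \<otimes>\<^bsub>SL2_KS\<^esub> x)" by (simp add: coset_absorb)
    then show "x \<in> {x \<in> topspace ?X. ?q x \<in> ?C}" using \<gamma> by auto
  qed
  have cl: "closedin ?X {x \<in> carrier SL2_KS. \<exists>\<gamma>\<in>SL2_OK \<sigma>. \<gamma> \<otimes>\<^bsub>SL2_KS\<^esub> x \<in> bounded_part M}"
    by (rule closed_subset[OF _ closed_saturation]) blast
  have Csub: "?C \<subseteq> topspace (homogeneous_space \<sigma>)" using cpt by (rule compactin_subset_topspace)
  have "closedin (homogeneous_space \<sigma>) ?C"
    using quotient_map_closedin[THEN iffD1, OF q, THEN conjunct2, THEN spec, THEN mp, OF Csub, THEN iffD1]
      cl unfolding eq .
  then have "(homogeneous_space \<sigma>) closure_of T \<subseteq> ?C" using T by (rule closure_of_minimal[rotated])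
  then have "compactin (homogeneous_space \<sigma>) ((homogeneous_space \<sigma>) closure_of T)"
    by (rule closed_compactin[OF cpt _ closedin_closure_of])
  then show ?thesis using T Csub unfolding relatively_compactin_def by blast
qed

text \<open>For each t the matrix from \<open>mahler_bound\<close> lies in SL_2(O_K), so multiplying
  h g(r)_t by it on the left keeps the coset and moves the representative into one fixed compact
  set.\<close>

lemma bounded_trajectoryI:
  assumes h: "h \<in> carrier SL2_KS" and \<epsilon>: "\<epsilon> > 0"
    and lower: "\<And>w t. w \<in> O2 \<Longrightarrow> w \<noteq> 0 \<Longrightarrow> t \<ge> 0 \<Longrightarrow>
      \<epsilon> \<le> row_norm (\<sigma> a) (h $ a) (r $ a) t w * row_norm (\<sigma> b) (h $ b) (r $ b) t w"
  shows "bounded_trajectory \<sigma> r (SL2_OK \<sigma> #>\<^bsub>SL2_KS\<^esub> h)"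
proof -
  have det: "det (h $ s) = 1" for s using h by (simp add: SL2_KS_def)
  have sq: "sqrt \<epsilon> > 0" "sqrt \<epsilon> * sqrt \<epsilon> = \<epsilon>" using \<epsilon> by auto
  obtain C where C: "\<forall>t. (\<forall>w\<in>O2. w \<noteq> 0 \<longrightarrow>
      sqrt \<epsilon> * sqrt \<epsilon> \<le> row_norm (\<sigma> a) (h $ a) (r $ a) t w * row_norm (\<sigma> b) (h $ b) (r $ b) t w) \<longrightarrow>
    (\<exists>G. integral_matrix G \<and> det G = 1 \<and>
      (\<forall>i. row_norm (\<sigma> a) (h $ a) (r $ a) t (matrix_row G i) \<le> C \<and>
        row_norm (\<sigma> b) (h $ b) (r $ b) t (matrix_row G i) \<le> C))"
    using mahler_bound[OF det[of a] det[of b] sq(1), where ?r1.0 = "r $ a" and ?r2.0 = "r $ b"] by blast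
  have "(SL2_OK \<sigma> #>\<^bsub>SL2_KS\<^esub> h) #>\<^bsub>SL2_KS\<^esub> flow r t \<in> (\<lambda>g. SL2_OK \<sigma> #>\<^bsub>SL2_KS\<^esub> g) ` bounded_part C"
    if t: "t \<ge> 0" for t
  proof -
    obtain G where G: "integral_matrix G" "det G = 1"
      "\<And>i. row_norm (\<sigma> a) (h $ a) (r $ a) t (matrix_row G i) \<le> C"
      "\<And>i. row_norm (\<sigma> b) (h $ b) (r $ b) t (matrix_row G i) \<le> C"
    proof -
      have "\<forall>w\<in>O2. w \<noteq> 0 \<longrightarrow>
          sqrt \<epsilon> * sqrt \<epsilon> \<le> row_norm (\<sigma> a) (h $ a) (r $ a) t w * row_norm (\<sigma> b) (h $ b) (r $ b) t w"
        using lower[OF _ _ t] unfolding sq(2) by blast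
      from C[THEN spec[of _ t], THEN mp, OF this] show ?thesis using that by blast
    qed
    define \<gamma> where "\<gamma> = tau_matrix \<sigma> G"
    define x where "x = h \<otimes>\<^bsub>SL2_KS\<^esub> flow r t"
    have \<gamma>: "\<gamma> \<in> SL2_OK \<sigma>" using G by (auto simp: SL2_OK_eq \<gamma>_def)
    have x: "x \<in> carrier SL2_KS"
      unfolding x_def by (intro monoid.m_closed[OF group.is_monoid[OF group_SL2_KS]] h flow_in_SL2_KS)
    have \<gamma>x: "\<gamma> \<otimes>\<^bsub>SL2_KS\<^esub> x \<in> carrier SL2_KS"
      using \<gamma> SL2_OK_subset by (intro monoid.m_closed[OF group.is_monoid[OF group_SL2_KS]] x) blast
    have entry: "(\<gamma> \<otimes>\<^bsub>SL2_KS\<^esub> x) $ s $ i $ 1 = row_entry (\<sigma> s) (h $ s) 1 (matrix_row G i) * exp (- (r $ s) * t)"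
      "(\<gamma> \<otimes>\<^bsub>SL2_KS\<^esub> x) $ s $ i $ 2 = row_entry (\<sigma> s) (h $ s) 2 (matrix_row G i) * exp (r $ s * t)" for s i
      by (simp_all add: \<gamma>_def x_def SL2_KS_def tau_matrix_def flow_def matrix_mult_2 row_entry_def
          matrix_row_def algebra_simps)
    have "\<bar>(\<gamma> \<otimes>\<^bsub>SL2_KS\<^esub> x) $ s $ i $ j\<bar> \<le> C" for s i j
    proof -
      have "row_norm (\<sigma> s) (h $ s) (r $ s) t (matrix_row G i) \<le> C" using G(3,4) index_cases[of s] by auto
      moreover have "\<bar>(\<gamma> \<otimes>\<^bsub>SL2_KS\<^esub> x) $ s $ i $ j\<bar> \<le> row_norm (\<sigma> s) (h $ s) (r $ s) t (matrix_row G i)"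
        unfolding row_norm_def using exhaust_2[of j] weighted_norm_bounds
        by (auto simp: entry abs_mult simp del: minus_mult_left)
      ultimately show ?thesis by linarith
    qed
    then have "\<gamma> \<otimes>\<^bsub>SL2_KS\<^esub> x \<in> bounded_part C" using \<gamma>x by (simp add: bounded_part_def)
    moreover have "(SL2_OK \<sigma> #>\<^bsub>SL2_KS\<^esub> h) #>\<^bsub>SL2_KS\<^esub> flow r t = SL2_OK \<sigma> #>\<^bsub>SL2_KS\<^esub> (\<gamma> \<otimes>\<^bsub>SL2_KS\<^esub> x)"
      unfolding coset_absorb[OF \<gamma> x] unfolding x_def
      by (rule group.coset_mult_assoc[OF group_SL2_KS SL2_OK_subset h flow_in_SL2_KS])
    ultimately show ?thesis by blast
  qed
  then show ?thesis unfolding bounded_trajectory_def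
    by (intro relatively_compactin_bounded[of _ C]) blast
qed

end

section \<open>Bounded trajectories on curves\<close>

lemma field_lipschitz_on_unit_interval:
  fixes f f' :: "real \<Rightarrow> real"
  assumes deriv: "\<And>x. x \<in> {0..1} \<Longrightarrow> (f has_real_derivative f' x) (at x within {0..1})"
    and cont: "continuous_on {0..1} f'"
  obtains C where "C \<ge> 0" "\<And>x y. x \<in> {0..1} \<Longrightarrow> y \<in> {0..1} \<Longrightarrow> \<bar>f x - f y\<bar> \<le> C * \<bar>x - y\<bar>"
proof -
  have "compact (f' ` {0..1})" using cont by (intro compact_continuous_image) auto
  then have "bounded (f' ` {0..1})" by (rule compact_imp_bounded)
  then obtain C where "\<forall>y\<in>f' ` {0..1}. norm y \<le> C" unfolding bounded_iff by blast
  then have C: "norm (f' x) \<le> C" if "x \<in> {0..1}" for x using that by simp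
  have "\<bar>f x - f y\<bar> \<le> C * \<bar>x - y\<bar>" if "x \<in> {0..1}" "y \<in> {0..1}" for x y
    using field_differentiable_bound[OF convex_real_interval(5) deriv C that] by (simp add: abs_minus_commute)
  moreover have "C \<ge> 0" by (rule order_trans[OF norm_ge_zero C[of 0]]) simp
  ultimately show ?thesis using that by blast
qed

text \<open>This undoes the shear and the matrix at time 0: the norm n bounds the first coordinate
  by n and the unsheared second one by n (1 + F), and Cramer's rule with entries at most \<mu>
  recovers w. It gives a starting bound that is uniform along the curve.\<close>

lemma (in field_emb) row_norm_lower_bound:
  assumes M: "det M = 1" and \<mu>: "\<And>i j. \<bar>M $ i $ j\<bar> \<le> \<mu>" and y: "\<bar>y\<bar> \<le> F"
  shows "max \<bar>f (fst w)\<bar> \<bar>f (snd w)\<bar> \<le>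
    \<mu> * (2 + F) * weighted_norm r (row_entry f M 1 w) (row_entry f M 1 w * y + row_entry f M 2 w) 0"
proof -
  let ?A = "row_entry f M 1 w" and ?D = "row_entry f M 2 w"
  let ?n = "weighted_norm r ?A (?A * y + ?D) 0"
  have A: "\<bar>?A\<bar> \<le> ?n" and B: "\<bar>?A * y + ?D\<bar> \<le> ?n"
    by (simp_all add: weighted_norm_def)
  have "\<bar>?A * y\<bar> \<le> ?n * F" unfolding abs_mult using A y by (intro mult_mono) auto
  then have D: "\<bar>?D\<bar> \<le> ?n * (1 + F)" using B by (simp add: distrib_left)
  have \<mu>0: "\<mu> \<ge> 0" by (rule order_trans[OF abs_ge_zero \<mu>])
  have det: "M $ 1 $ 1 * M $ 2 $ 2 - M $ 1 $ 2 * M $ 2 $ 1 = 1" using M by (simp add: det_2)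
  have "f (fst w) * (M $ 1 $ 1 * M $ 2 $ 2 - M $ 1 $ 2 * M $ 2 $ 1) = ?A * M $ 2 $ 2 - ?D * M $ 2 $ 1"
    by (simp add: row_entry_def algebra_simps)
  then have u: "f (fst w) = ?A * M $ 2 $ 2 - ?D * M $ 2 $ 1" unfolding det by simp
  have "f (snd w) * (M $ 1 $ 1 * M $ 2 $ 2 - M $ 1 $ 2 * M $ 2 $ 1) = ?D * M $ 1 $ 1 - ?A * M $ 1 $ 2"
    by (simp add: row_entry_def algebra_simps)
  then have v: "f (snd w) = ?D * M $ 1 $ 1 - ?A * M $ 1 $ 2" unfolding det by simp
  have bA: "\<bar>?A * M $ i $ j\<bar> \<le> ?n * \<mu>" for i j
    unfolding abs_mult using A by (intro mult_mono \<mu>) auto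
  have bD: "\<bar>?D * M $ i $ j\<bar> \<le> ?n * (1 + F) * \<mu>" for i j
    unfolding abs_mult using D by (intro mult_mono \<mu>) (auto intro: order_trans[OF abs_ge_zero])
  have e: "\<mu> * (2 + F) * ?n = ?n * \<mu> + ?n * (1 + F) * \<mu>" by (simp add: algebra_simps)
  show ?thesis unfolding e max.bounded_iff u v
    using bA[of 2 2] bD[of 2 1] bD[of 1 1] bA[of 1 2] by linarith
qed

text \<open>A nonzero coordinate of w is a nonzero algebraic integer, whose norm has absolute value
  at least 1.\<close>

lemma (in real_quadratic) max_norm_product_ge_1:
  assumes "w \<in> O2" "w \<noteq> 0"
  shows "1 \<le> max \<bar>\<tau>1 (fst w)\<bar> \<bar>\<tau>1 (snd w)\<bar> * max \<bar>\<tau>2 (fst w)\<bar> \<bar>\<tau>2 (snd w)\<bar>"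
proof -
  have "\<exists>x. (x = fst w \<or> x = snd w) \<and> x \<noteq> 0" using assms(2) by (auto simp: prod_eq_iff)
  then obtain x where x: "x = fst w \<or> x = snd w" "x \<noteq> 0" by blast
  then have "1 \<le> \<bar>\<tau>1 x\<bar> * \<bar>\<tau>2 x\<bar>" using assms(1) by (intro norm_ge_1) (auto simp: O2_def)
  also have "\<dots> \<le> max \<bar>\<tau>1 (fst w)\<bar> \<bar>\<tau>1 (snd w)\<bar> * max \<bar>\<tau>2 (fst w)\<bar> \<bar>\<tau>2 (snd w)\<bar>"
    using x(1) by (intro mult_mono) auto
  finally show ?thesis .
qed

theorem theorem1p3:
  fixes \<sigma> :: "'s::finite \<Rightarrow> 'k::field_char_0 \<Rightarrow> real"
    and \<phi> \<phi>' :: "real \<Rightarrow> real ^ 's"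
    and r :: "real ^ 's"
    and g :: "'s matrix_KS"
    and \<Lambda> :: "'s matrix_KS set"
  assumes K: "real_quadratic_field TYPE('k)"
    and S: "bij_betw \<sigma> UNIV (real_embeddings :: ('k \<Rightarrow> real) set)"
    and \<phi>_deriv: "\<And>x. x \<in> {0..1} \<Longrightarrow> (\<phi> has_vector_derivative \<phi>' x) (at x within {0..1})"
    and \<phi>'_cont: "continuous_on {0..1} \<phi>'"
    and \<phi>'_nonzero: "finite {x \<in> {0..1}. \<not> (\<forall>s. \<phi>' x $ s \<noteq> 0)}"
    and r_nonneg: "\<And>s. r $ s \<ge> 0"
    and r_sum: "(\<Sum>s\<in>UNIV. r $ s) = 1"
    and g: "g \<in> carrier SL2_KS"
    and \<Lambda>: "\<Lambda> = SL2_OK \<sigma> #>\<^bsub>SL2_KS\<^esub> g"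
  defines "W \<equiv> {x \<in> {0..1}. bounded_trajectory \<sigma> r (\<Lambda> #>\<^bsub>SL2_KS\<^esub> unipotent (\<phi> x))}"
  shows "schmidt_winning {0..1} W \<and> hausdorff_dimension W = 1"
proof -
  have "card (UNIV :: 's set) = 2" by (rule CARD_real_embeddings[OF K S])
  then obtain a' b' :: 's where ab': "UNIV = {a', b'}" "a' \<noteq> b'" by (auto simp: card_2_iff)
  obtain a b :: 's where ab: "a \<noteq> b" "UNIV = {a, b}" and rab: "r $ b \<le> r $ a"
  proof (cases "r $ b' \<le> r $ a'")
    case True
    then show ?thesis using that ab' by blast
  next
    case False
    then show ?thesis using that[of b' a'] ab' by auto
  qed
  obtain \<theta> d where "real_quadratic (\<sigma> a) (\<sigma> b) \<theta> d"
    by (rule real_quadratic_field_structure[OF K S ab(1)])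
  then interpret quad: real_quadratic "\<sigma> a" "\<sigma> b" \<theta> d .
  interpret indexed_quadratic \<sigma> a b \<theta> d by unfold_locales (rule ab)+
  have deriv: "((\<lambda>x. \<phi> x $ s) has_real_derivative \<phi>' x $ s) (at x within {0..1})" if "x \<in> {0..1}" for s x
    using bounded_linear.has_vector_derivative[OF bounded_linear_vec_nth \<phi>_deriv[OF that]]
    by (simp add: has_real_derivative_iff_has_vector_derivative)
  have cont: "continuous_on {0..1} (\<lambda>x. \<phi>' x $ s)" for s
    by (intro continuous_intros \<phi>'_cont)
  obtain Ca where Ca: "Ca \<ge> 0" "\<And>x y. x \<in> {0..1} \<Longrightarrow> y \<in> {0..1} \<Longrightarrow> \<bar>\<phi> x $ a - \<phi> y $ a\<bar> \<le> Ca * \<bar>x - y\<bar>"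
    using field_lipschitz_on_unit_interval[OF deriv cont, of a] by blast
  obtain Cb where Cb: "Cb \<ge> 0" "\<And>x y. x \<in> {0..1} \<Longrightarrow> y \<in> {0..1} \<Longrightarrow> \<bar>\<phi> x $ b - \<phi> y $ b\<bar> \<le> Cb * \<bar>x - y\<bar>"
    using field_lipschitz_on_unit_interval[OF deriv cont, of b] by blast
  define C where "C = max Ca Cb"
  have det: "det (g $ s) = 1" for s using g by (simp add: SL2_KS_def)
  define \<mu> where "\<mu> = Max (range (\<lambda>(s, i, j). \<bar>g $ s $ i $ j\<bar>)) + 1"
  have \<mu>: "\<bar>g $ s $ i $ j\<bar> \<le> \<mu>" for s i j
  proof -
    have "\<bar>g $ s $ i $ j\<bar> \<le> Max (range (\<lambda>(s, i, j). \<bar>g $ s $ i $ j\<bar>))"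
      by (intro Max_ge) (auto intro: image_eqI[of _ _ "(s, i, j)"])
    then show ?thesis by (simp add: \<mu>_def)
  qed
  have \<mu>1: "\<mu> > 0"
  proof -
    have "0 \<le> \<bar>g $ a $ 1 $ 1\<bar>" by simp
    also have "\<dots> \<le> Max (range (\<lambda>(s, i, j). \<bar>g $ s $ i $ j\<bar>))"
      by (intro Max_ge) (auto intro: image_eqI[of _ _ "(a, 1, 1)"])
    finally show ?thesis by (simp add: \<mu>_def)
  qed
  define F where "F = max (\<bar>\<phi> 0 $ a\<bar> + Ca) (\<bar>\<phi> 0 $ b\<bar> + Cb)"
  have F: "\<bar>\<phi> x $ a\<bar> \<le> F" "\<bar>\<phi> x $ b\<bar> \<le> F" if x: "x \<in> {0..1}" for x
  proof -
    have "Ca * \<bar>x - 0\<bar> \<le> Ca * 1" "Cb * \<bar>x - 0\<bar> \<le> Cb * 1" using x Ca(1) Cb(1) by (auto intro!: mult_left_le)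
    moreover have "\<bar>\<phi> x $ a - \<phi> 0 $ a\<bar> \<le> Ca * \<bar>x - 0\<bar>" "\<bar>\<phi> x $ b - \<phi> 0 $ b\<bar> \<le> Cb * \<bar>x - 0\<bar>"
      using Ca(2)[OF x, of 0] Cb(2)[OF x, of 0] by simp_all
    ultimately show "\<bar>\<phi> x $ a\<bar> \<le> F" "\<bar>\<phi> x $ b\<bar> \<le> F"
      unfolding F_def le_max_iff_disj by linarith+
  qed
  have F0: "F \<ge> 0" using F(1)[of 0] by simp
  define c where "c = \<mu> * (2 + F)"
  have c: "c > 0" using \<mu>1 F0 by (simp add: c_def)
  define A where "A = (\<lambda>s w. row_entry (\<sigma> s) (g $ s) 1 w)"
  define D where "D = (\<lambda>s w. row_entry (\<sigma> s) (g $ s) 2 w)"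
  define L where "L = quad.O2 - {0}"
  have "(\<Sum>s\<in>{a, b}. r $ s) = 1" using r_sum unfolding ab(2) .
  then have "r $ a + r $ b = 1" using ab(1) by simp
  \<comment> \<open>The constant 1 / (c * c) collects one factor 1 / c from
    \<open>row_norm_lower_bound\<close> at each embedding.\<close>
  interpret pair: weighted_pair L "A a" "D a" "A b" "D b" "\<lambda>x. \<phi> x $ a" "\<lambda>x. \<phi> x $ b" "r $ a" "r $ b" C "1 / (c * c)"
  proof unfold_locales
    show "0 \<le> r $ b" "r $ b \<le> r $ a" "r $ a + r $ b = 1" by fact+
    show "0 \<le> C" using Ca(1) by (simp add: C_def)
    show "\<bar>\<phi> x $ a - \<phi> y $ a\<bar> \<le> C * \<bar>x - y\<bar>" if "x \<in> {0..1}" "y \<in> {0..1}" for x y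
      by (rule order_trans[OF Ca(2)[OF that]]) (simp add: C_def mult_right_mono)
    show "\<bar>\<phi> x $ b - \<phi> y $ b\<bar> \<le> C * \<bar>x - y\<bar>" if "x \<in> {0..1}" "y \<in> {0..1}" for x y
      by (rule order_trans[OF Cb(2)[OF that]]) (simp add: C_def mult_right_mono)
    show "A a w * D a w' = D a w * A a w' \<or> 1 \<le> \<bar>A a w * D a w' - D a w * A a w'\<bar> * \<bar>A b w * D b w' - D b w * A b w'\<bar>"
      if "w \<in> L" "w' \<in> L" for w w'
    proof -
      have *: "A a w * D a w' - D a w * A a w' = \<sigma> a (pair_det w w')" "A b w * D b w' - D b w * A b w' = \<sigma> b (pair_det w w')"
        unfolding A_def D_def by (rule quad.e1.row_entry_det[OF det] quad.e2.row_entry_det[OF det])+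
      show ?thesis
      proof (cases "pair_det w w' = 0")
        case True
        then show ?thesis using *(1) by simp
      next
        case False
        then show ?thesis unfolding *
          using quad.norm_ge_1[OF quad.pair_det_algebraic_int] that by (auto simp: L_def)
      qed
    qed
    show "0 < 1 / (c * c)" using c by simp
    fix w x assume w: "w \<in> L" and x: "x \<in> {0..1::real}"
    let ?na = "weighted_norm (r $ a) (A a w) (A a w * \<phi> x $ a + D a w) 0"
    let ?nb = "weighted_norm (r $ b) (A b w) (A b w * \<phi> x $ b + D b w) 0"
    have "1 \<le> max \<bar>\<sigma> a (fst w)\<bar> \<bar>\<sigma> a (snd w)\<bar> * max \<bar>\<sigma> b (fst w)\<bar> \<bar>\<sigma> b (snd w)\<bar>"
      using w by (intro quad.max_norm_product_ge_1) (auto simp: L_def)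
    also have "\<dots> \<le> (c * ?na) * (c * ?nb)"
      unfolding c_def A_def D_def using \<mu>1 F0
      by (intro mult_mono quad.e1.row_norm_lower_bound quad.e2.row_norm_lower_bound det \<mu> F x)
        (auto simp: le_max_iff_disj)
    finally have "1 \<le> (c * c) * (?na * ?nb)" by (simp only: mult_ac)
    then show "1 / (c * c) \<le> ?na * ?nb" using c by (simp add: divide_le_eq mult.commute)
  qed
  have win: "schmidt_winning {0..1} W"
  proof (rule pair.winning[OF deriv cont])
    show "finite {x \<in> {0..1}. \<phi>' x $ a = 0}" by (rule finite_subset[OF _ \<phi>'_nonzero]) auto
    fix z :: real assume z: "z \<in> {0..1}" and "\<exists>\<epsilon>>0. \<forall>w\<in>L. \<forall>t\<ge>0. \<epsilon> \<le> pair.N w z t"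
    then obtain \<epsilon> where \<epsilon>: "\<epsilon> > 0" "\<And>w t. w \<in> L \<Longrightarrow> t \<ge> 0 \<Longrightarrow> \<epsilon> \<le> pair.N w z t" by blast
    define h where "h = g \<otimes>\<^bsub>SL2_KS\<^esub> unipotent (\<phi> z)"
    have h: "h \<in> carrier SL2_KS"
      unfolding h_def by (intro monoid.m_closed[OF group.is_monoid[OF group_SL2_KS]] g unipotent_in_SL2_KS)
    \<comment> \<open>The unipotent fixes the first coordinate of w g and adds \<phi> times it to
      the second, which is the shape built into \<open>weighted_pair\<close>.\<close>
    have entry: "row_entry (\<sigma> s) (h $ s) 1 w = A s w" "row_entry (\<sigma> s) (h $ s) 2 w = A s w * \<phi> z $ s + D s w" for s w
      by (simp_all add: row_entry_def A_def D_def h_def SL2_KS_def unipotent_def matrix_mult_2 algebra_simps)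
    have "bounded_trajectory \<sigma> r (SL2_OK \<sigma> #>\<^bsub>SL2_KS\<^esub> h)"
    proof (rule bounded_trajectoryI[OF h \<epsilon>(1)])
      fix w t assume "w \<in> quad.O2" "w \<noteq> 0" "t \<ge> (0::real)"
      then have "\<epsilon> \<le> pair.N w z t" by (intro \<epsilon>(2)) (auto simp: L_def)
      then show "\<epsilon> \<le> row_norm (\<sigma> a) (h $ a) (r $ a) t w * row_norm (\<sigma> b) (h $ b) (r $ b) t w"
        by (simp add: pair.N_def pair.n1_def pair.n2_def row_norm_def entry)
    qed
    moreover have "\<Lambda> #>\<^bsub>SL2_KS\<^esub> unipotent (\<phi> z) = SL2_OK \<sigma> #>\<^bsub>SL2_KS\<^esub> h"
      unfolding \<Lambda> h_def
      by (rule group.coset_mult_assoc[OF group_SL2_KS SL2_OK_subset g unipotent_in_SL2_KS])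
    ultimately show "z \<in> W" using z by (simp add: W_def)
  qed
  moreover have "W \<subseteq> {0..1}" by (auto simp: W_def)
  ultimately show ?thesis using schmidt_winning_imp_hausdorff_dimension by blast
qed

end
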